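(* Let $d>1$ be an integer, $\mu\ge 0$, and let $\widehat a$ be admissible. Then for any $k>0$ there exists a constant $c_k>0$ depending only on $k$, $d$, $\mu$, and $\widehat a$ such that for all integers $n\ge 1$ $$ |L_n^\mu(x,y)| \le c_k \frac{n^d}{\sqrt{\mathcal{W}_\mu(n;x)}\,\sqrt{\mathcal{W}_\mu(n;y)}\,(1+n\,d(x,y))^k},\qquad x,y\in B^d . $$
   Context: $B^d$ is the closed unit ball of $\mathbb{R}^d$, $|x|$ is the Euclidean norm, $\langle x,y\rangle$ the Euclidean inner product, and $W_\mu(x)=(1-|x|^2)^{\mu-1/2}$. The distance on $B^d$ is $d(x,y)=\arccos\{\langle x,y\rangle+\sqrt{1-|x|^2}\sqrt{1-|y|^2}\}$, and $\mathcal{W}_\mu(n;x)=(\sqrt{1-|x|^2}+n^{-1})^{2\mu}$. $\Pi_n^d$ is the space of polynomials of total degree at most $n$ in $d$ variables; $\mathcal{V}_n^d\subset\Pi_n^d$ is the subspace of polynomials of degree $n$ orthogonal in $L^2(B^d,W_\mu)$ to all polynomials of lower degree. With $(b_d^\mu)^{-1}=\int_{B^d}W_\mu(x)\,dx$, the kernel $P_n(W_\mu;x,y)$ is the (polynomial) kernel of the orthogonal projector $\operatorname{Proj}_n:L^2(B^d,W_\mu)\to\mathcal{V}_n^d$ in the sense that $(\operatorname{Proj}_nf)(x)=b_d^\mu\int_{B^d}f(y)P_n(W_\mu;x,y)W_\mu(y)\,dy$. A function $\widehat a$ is admissible if $\widehat a\in C^\infty[0,\infty)$, $\widehat a\ge0$,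 and either (a) $\operatorname{supp}\widehat a\subset[0,2]$, $\widehat a(t)=1$ on $[0,1]$ and $0\le\widehat a(t)\le1$ on $[1,2]$; or (b) $\operatorname{supp}\widehat a\subset[1/2,2]$. The kernel is $L_n^\mu(x,y)=\sum_{j=0}^\infty\widehat a(j/n)\,P_j(W_\mu;x,y)$. *)

theory Defs
  imports "HOL-Analysis.Analysis"
begin

abbreviation unit_ball :: "(real ^ 'd) set"
  where "unit_ball \<equiv> cball 0 1"

text \<open>On the unit sphere \<open>0 powr a = 0\<close>, also for \<open>a \<le> 0\<close>; this concerns a null set only.\<close>

definition ball_weight :: "real \<Rightarrow> real ^ 'd \<Rightarrow> real"
  where "ball_weight \<mu> x = (1 - (norm x)\<^sup>2) powr (\<mu> - 1/2)"

definition ball_const :: "'d::finite itself \<Rightarrow> real \<Rightarrow> real"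
  where "ball_const _ \<mu> = inverse (LINT x:(unit_ball :: (real ^ 'd) set)|lebesgue. ball_weight \<mu> x)"

definition ball_dist :: "real ^ 'd \<Rightarrow> real ^ 'd \<Rightarrow> real"
  where "ball_dist x y = arccos (x \<bullet> y + sqrt (1 - (norm x)\<^sup>2) * sqrt (1 - (norm y)\<^sup>2))"

definition ball_weight_n :: "real \<Rightarrow> nat \<Rightarrow> real ^ 'd \<Rightarrow> real"
  where "ball_weight_n \<mu> n x = (sqrt (1 - (norm x)\<^sup>2) + 1 / real n) powr (2 * \<mu>)"

text \<open>Polynomials are identified with the functions they induce on the whole space; a multi-index
  is a function \<open>\<alpha>\<close> on the coordinates.\<close>

definition poly_space :: "nat \<Rightarrow> (real ^ 'd \<Rightarrow> real) set"
  where "poly_space n =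
    {p. \<exists>c :: ('d \<Rightarrow> nat) \<Rightarrow> real.
          p = (\<lambda>x. \<Sum>\<alpha> | (\<Sum>i\<in>UNIV. \<alpha> i) \<le> n. c \<alpha> * (\<Prod>i\<in>UNIV. (x $ i) ^ \<alpha> i))}"

definition ball_L2 :: "real \<Rightarrow> (real ^ 'd \<Rightarrow> real) set"
  where "ball_L2 \<mu> =
    {f. set_borel_measurable lebesgue unit_ball f \<and>
        set_integrable lebesgue unit_ball (\<lambda>x. (f x)\<^sup>2 * ball_weight \<mu> x)}"

definition ball_inner :: "real \<Rightarrow> (real ^ 'd \<Rightarrow> real) \<Rightarrow> (real ^ 'd \<Rightarrow> real) \<Rightarrow> real"
  where "ball_inner \<mu> f g = (LINT x:unit_ball|lebesgue. f x * g x * ball_weight \<mu> x)"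

definition orth_poly_space :: "real \<Rightarrow> nat \<Rightarrow> (real ^ 'd \<Rightarrow> real) set"
  where "orth_poly_space \<mu> n =
    {p \<in> poly_space n. \<forall>m<n. \<forall>q\<in>poly_space m. ball_inner \<mu> p q = 0}"

text \<open>The value of the orthogonal projector is taken to be the polynomial representing the
  \<open>L\<^sup>2\<close> class.\<close>

definition orth_proj :: "real \<Rightarrow> nat \<Rightarrow> (real ^ 'd \<Rightarrow> real) \<Rightarrow> real ^ 'd \<Rightarrow> real"
  where "orth_proj \<mu> n f =
    (THE g. g \<in> orth_poly_space \<mu> n \<and>
            (\<forall>h\<in>orth_poly_space \<mu> n. ball_inner \<mu> (\<lambda>x. f x - g x) h = 0))"

text \<open>Requiring the kernel to be a polynomial in \<open>(x, y)\<close> makes it unique: the integral formula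
  alone determines it only up to null sets in \<open>y\<close>.\<close>

definition proj_kernel :: "real \<Rightarrow> nat \<Rightarrow> real ^ 'd \<Rightarrow> real ^ 'd \<Rightarrow> real"
  where "proj_kernel \<mu> n =
    (THE P. real_polynomial_function (\<lambda>z. P (fst z) (snd z)) \<and>
            (\<forall>f\<in>ball_L2 \<mu>. \<forall>x\<in>unit_ball.
               orth_proj \<mu> n f x =
               ball_const TYPE('d) \<mu> * (LINT y:unit_ball|lebesgue. f y * P x y * ball_weight \<mu> y)))"

text \<open>Derivatives at the endpoint 0 are one-sided; \<open>D k\<close> is the \<open>k\<close>-th derivative.\<close>

definition smooth_halfline :: "(real \<Rightarrow> real) \<Rightarrow> bool"
  where "smooth_halfline a \<longleftrightarrow>
    (\<exists>D :: nat \<Rightarrow> real \<Rightarrow> real. (\<forall>t\<ge>0. D 0 t = a t) \<and>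
       (\<forall>k. \<forall>t\<ge>0. (D k has_real_derivative D (Suc k) t) (at t within {0..})))"

definition halfline_supp :: "(real \<Rightarrow> real) \<Rightarrow> real set"
  where "halfline_supp a = closure (support_on {0..} a)"

definition admissible :: "(real \<Rightarrow> real) \<Rightarrow> bool"
  where "admissible a \<longleftrightarrow> smooth_halfline a \<and> (\<forall>t\<ge>0. a t \<ge> 0) \<and>
    ((halfline_supp a \<subseteq> {0..2} \<and> (\<forall>t\<in>{0..1}. a t = 1) \<and> (\<forall>t\<in>{1..2}. 0 \<le> a t \<and> a t \<le> 1))
     \<or> halfline_supp a \<subseteq> {1/2..2})"

text \<open>For admissible \<open>a\<close> and \<open>n \<ge> 1\<close> only the terms with \<open>j \<le> 2 * n\<close> are nonzero.\<close>

definition needlet_kernel :: "(real \<Rightarrow> real) \<Rightarrow> real \<Rightarrow> nat \<Rightarrow> real ^ 'd \<Rightarrow> real ^ 'd \<Rightarrow> real"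
  where "needlet_kernel a \<mu> n x y = (\<Sum>j. a (real j / real n) * proj_kernel \<mu> j x y)"

end

theory Submission
  imports Defs "HOL-Probability.Probability"
begin

text \<open>
  Put \<open>l = \<mu> + (d - 1) / 2\<close>. Let \<open>R\<^sub>j\<close> be the Gegenbauer polynomials of index \<open>l\<close> with \<open>R\<^sub>j 1 = 1\<close> and \<open>h\<^sub>j\<close>
  the inverse squares of their norms. The kernel \<open>P\<^sub>j(x, y)\<close> is the mean of
  \<open>h\<^sub>j R\<^sub>j(\<langle>x, y\<rangle> + u s\<^sub>x s\<^sub>y)\<close>, \<open>s\<^sub>x = sqrt (1 - |x|\<^sup>2)\<close>, over the probability density proportional to
  \<open>(1 - u\<^sup>2) powr (\<mu> - 1)\<close>: under the ball weight and this density, \<open>(y, u s\<^sub>y)\<close> has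
  rotation invariant moments in dimension \<open>d + 1\<close>. Hence the moments of \<open>\<langle>x, y\<rangle> + u s\<^sub>x s\<^sub>y\<close> and \<open>\<langle>\<omega>, y\<rangle>\<close>,
  \<open>|\<omega>| = 1\<close>, depend on \<open>\<langle>x, \<omega>\<rangle>\<close> only, the Gegenbauer operator is symmetric for them, and the
  reproducing property holds on ridge polynomials \<open>R\<^sub>m(\<langle>\<omega>, y\<rangle>)\<close>, which span all polynomials.

  The one-dimensional sum \<open>L = (\<Sum>j. a(j/n) h\<^sub>j R\<^sub>j)\<close> is localised at \<open>t = 1\<close> because multiplication by
  \<open>1 - t\<close> acts on the coefficient sequence \<open>a(j/n)\<close> as a second order difference operator, which gains
  \<open>n\<^sup>-\<^sup>2\<close> each time, while \<open>|R\<^sub>j| \<le> 1\<close>. Averaging this bound over \<open>u\<close> produces the weights.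
\<close>

section \<open>Localisation of Gegenbauer sums\<close>

text \<open>The density in \<open>u\<close> degenerates as \<open>\<mu>\<close> tends to 0, and
  \<open>s_x\<close> is imaginary for \<open>|x| > 1\<close>. Both difficulties disappear if the
  mean over \<open>u\<close> is replaced by its even moments: the kernel becomes a polynomial in
  \<open>x\<close> and \<open>y\<close>, and everything behind the reproducing property is an
  identity between moments, valid for all \<open>\<mu> \<ge> 0\<close> on the whole space. A genuine
  measure enters only in the final estimate, where positivity matters.

  The weights arise as follows. With \<open>z = s_x s_y\<close> the argument satisfies
  \<open>1 - t = (1 - cos d(x,y)) + (1 - u) z\<close>. Part of the decay in
  \<open>n^2 (1 - t)\<close> is spent on the first summand and gives the power of
  \<open>1 + n d(x,y)\<close>; part is spent on the second, whose mean over \<open>u\<close> is at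
  most of order \<open>(1 + n^2 z) powr (-\<mu>)\<close>. Passing from \<open>1 + n^2 z\<close> to
  the product of \<open>1 + n s_x\<close> and \<open>1 + n s_y\<close> costs one factor
  \<open>1 + n d(x,y)\<close>, which is affordable because the exponent available is arbitrary.

  The bound \<open>|R_j| \<le> 1\<close> on \<open>[-1, 1]\<close> is itself drawn from the
  reproducing property, so the localisation estimate carries it as a hypothesis.\<close>

fun geg :: "real \<Rightarrow> nat \<Rightarrow> real poly" where
  "geg l 0 = 1"
| "geg l (Suc 0) = [:0, 1:]"
| "geg l (Suc (Suc j)) = smult (1 / (real j + 1 + 2 * l))
     (smult (2 * (real j + 1 + l)) ([:0, 1:] * geg l (Suc j)) - smult (real j + 1) (geg l j))"

text \<open>In closed form \<open>(j + l) / l * pochhammer (2 * l) j / fact j\<close>; for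
  \<open>l = (D - 2) / 2\<close> with \<open>D > 2\<close> this is the dimension of the space of
  spherical harmonics of degree \<open>j\<close> in \<open>D\<close> dimensions.\<close>

primrec gegw :: "real \<Rightarrow> nat \<Rightarrow> real" where
  "gegw l 0 = 1"
| "gegw l (Suc j) = gegw l j * ((real j + 2 * l) * (real j + 1 + l)) / ((real j + l) * (real j + 1))"

lemma geg_rec:
  assumes "l > 0"
  shows "(real j + 2 * l) * poly (geg l (Suc j)) t
    = 2 * (real j + l) * t * poly (geg l j) t - real j * poly (geg l (j - 1)) t"
proof (cases j)
  case (Suc i)
  have nz: "real i + 1 + 2 * l \<noteq> 0" using assms by linarith
  have e: "poly (geg l (Suc j)) t = (2 * (real i + 1 + l) * (t * poly (geg l j) t) - (real i + 1) * poly (geg l i) t)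
      / (real i + 1 + 2 * l)"
    by (simp add: Suc)
  show ?thesis using e[unfolded nonzero_eq_divide_eq[OF nz]] by (simp add: Suc algebra_simps del: geg.simps)
qed simp

lemma gegw_pos: "l > 0 \<Longrightarrow> gegw l j > 0"
  by (induction j) (auto intro!: divide_pos_pos mult_pos_pos add_nonneg_pos)

lemma geg_one: "l > 0 \<Longrightarrow> poly (geg l j) 1 = 1"
proof (induction l j rule: geg.induct)
  case (3 l j)
  then show ?case by (simp add: field_simps)
qed simp_all

lemma degree_geg: "degree (geg l j) \<le> j"
proof (induction l j rule: geg.induct)
  case (3 l j)
  have "degree ([:0, 1:] * geg l (Suc j)) \<le> Suc (Suc j)"
    using 3(1) degree_pCons_le[of 0 "geg l (Suc j)"] by simp
  then have "degree (smult (2 * (real j + 1 + l)) ([:0, 1:] * geg l (Suc j)) - smult (real j + 1) (geg l j)) \<le> Suc (Suc j)"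
    using 3(2) by (intro degree_diff_le order.trans[OF degree_smult_le]) auto
  then show ?case by (auto intro: order.trans[OF degree_smult_le])
qed auto

text \<open>The ratio of consecutive weights is \<open>(j + 1 + l) / (j + l)\<close>, which
  telescopes, times \<open>(j + 2 * l) / (j + 1)\<close>, which is at most
  \<open>((j + 1) / j) powr (2 * l - 1)\<close> and telescopes after this replacement. The
  hypothesis on \<open>l\<close> makes the exponent nonnegative; the induction starts at index 1
  because the base has \<open>j\<close> in the denominator.\<close>

lemma gegw_growth:
  assumes "l \<ge> 1/2"
  shows "\<exists>C>0. \<forall>j. gegw l j \<le> C * (real j + 1) powr (2 * l)"
proof -
  have one: "gegw l (Suc j) \<le> gegw l 1 * ((real j + 1) powr (2 * l - 1) * ((real j + 1 + l) / (1 + l)))" for j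
  proof (induction j)
    case (Suc j)
    define X where "X = real j + 1"
    have X: "X \<ge> 1" by (simp add: X_def)
    have "1 + (2 * l - 1) / (X + 1) \<le> ((X + 1) / X) powr (2 * l - 1)"
    proof -
      have "1 / (X + 1) \<le> ln ((X + 1) / X)"
        using ln_le_minus_one[of "X / (X + 1)"] X by (simp add: ln_div field_simps)
      then have "(2 * l - 1) / (X + 1) \<le> (2 * l - 1) * ln ((X + 1) / X)"
        using assms mult_left_mono[of "1 / (X + 1)" "ln ((X + 1) / X)" "2 * l - 1"] by simp
      then have "1 + (2 * l - 1) / (X + 1) \<le> exp ((2 * l - 1) * ln ((X + 1) / X))"
        by (smt (verit) exp_ge_add_one_self exp_le_cancel_iff)
      then show ?thesis using X by (simp add: powr_def)
    qed
    then have A: "(X + 2 * l) / (X + 1) \<le> ((X + 1) / X) powr (2 * l - 1)"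
      using X by (simp add: field_simps)
    have "gegw l (Suc (Suc j)) = gegw l (Suc j) * ((X + 2 * l) / (X + 1) * ((X + 1 + l) / (X + l)))"
      by (simp add: X_def add.commute add.left_commute)
    also have "\<dots> \<le> (gegw l 1 * (X powr (2 * l - 1) * ((X + l) / (1 + l)))) * (((X + 1) / X) powr (2 * l - 1) * ((X + 1 + l) / (X + l)))"
      using Suc A X assms gegw_pos[of l] less_imp_le[OF gegw_pos[of l "Suc 0"]] unfolding X_def[symmetric]
      by (intro mult_mono mult_right_mono) (auto simp del: gegw.simps intro!: divide_nonneg_nonneg mult_nonneg_nonneg)
    also have "\<dots> = gegw l 1 * ((X + 1) powr (2 * l - 1) * ((X + 1 + l) / (1 + l)))"
    proof -
      have "X powr (2 * l - 1) * ((X + 1) / X) powr (2 * l - 1) = (X + 1) powr (2 * l - 1)"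
        using X by (simp add: powr_divide)
      moreover have "(X + l) / (1 + l) * ((X + 1 + l) / (X + l)) = (X + 1 + l) / (1 + l)"
        using X assms by simp
      moreover have "(g * (P * A)) * (Q * B) = g * (R * C)" if "P * Q = R" "A * B = C" for g P Q R A B C :: real
        using that by (metis mult.assoc mult.left_commute)
      ultimately show ?thesis by blast
    qed
    finally show ?case by (simp add: X_def algebra_simps del: gegw.simps)
  next
    case 0
    have "1 + l > 0" using assms by simp
    then show ?case by (simp del: gegw.simps)
  qed
  define C where "C = max 1 (gegw l 1)"
  show ?thesis
  proof (intro exI[of _ C] conjI allI)
    show "C > 0" by (simp add: C_def)
    fix j show "gegw l j \<le> C * (real j + 1) powr (2 * l)"
    proof (cases j)
      case 0 then show ?thesis by (simp add: C_def)
    next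
      case (Suc i)
      have "(real i + 1) powr (2 * l - 1) * ((real i + 1 + l) / (1 + l)) \<le> (real i + 2) powr (2 * l - 1) * (real i + 2)"
        using assms by (intro mult_mono powr_mono2) (auto simp: field_simps)
      also have "\<dots> = (real i + 2) powr (2 * l)"
        by (simp add: powr_diff)
      finally have le: "(real i + 1) powr (2 * l - 1) * ((real i + 1 + l) / (1 + l)) \<le> (real i + 2) powr (2 * l)" .
      have "gegw l j \<le> gegw l 1 * (real i + 2) powr (2 * l)"
        unfolding Suc using assms
        by (intro order.trans[OF one mult_left_mono[OF le]]) (auto intro: less_imp_le[OF gegw_pos] simp del: gegw.simps)
      also have "\<dots> \<le> C * (real i + 2) powr (2 * l)"
        by (intro mult_right_mono) (auto simp: C_def)
      finally show ?thesis using Suc by (simp add: add.commute)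
    qed
  qed
qed

section \<open>Finite differences of sampled coefficient sequences\<close>

definition fdiff :: "(nat \<Rightarrow> int \<Rightarrow> real) \<Rightarrow> nat \<Rightarrow> int \<Rightarrow> real"
  where "fdiff u = (\<lambda>n j. u n (j + 1) - u n j)"

text \<open>Uniform \<open>O(n^-s)\<close> for large \<open>n\<close> on the indices
  \<open>j \<ge> (n - N) / 2\<close>. Smaller indices are left out because an admissible function is
  constant on \<open>[0, 1/2)\<close>. The slack \<open>N\<close> is arbitrary so that the notion
  survives shifts of \<open>j\<close>; the threshold \<open>M\<close> allows any fixed number of
  small indices to be ignored.\<close>

definition bnd :: "nat \<Rightarrow> (nat \<Rightarrow> int \<Rightarrow> real) \<Rightarrow> bool"
  where "bnd s u \<longleftrightarrow> (\<forall>N. \<exists>C M. \<forall>n\<ge>M. \<forall>j. int n \<le> 2 * j + N \<longrightarrow> \<bar>u n j\<bar> * real n ^ s \<le> C)"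

text \<open>A discrete symbol class of order \<open>-s\<close>: up to order \<open>K\<close>, every
  forward difference gains a further factor \<open>1/n\<close>, as for samples of a smooth function
  at spacing \<open>1/n\<close>.\<close>

primrec decay :: "nat \<Rightarrow> nat \<Rightarrow> (nat \<Rightarrow> int \<Rightarrow> real) \<Rightarrow> bool" where
  "decay 0 s u \<longleftrightarrow> bnd s u"
| "decay (Suc K) s u \<longleftrightarrow> bnd s u \<and> decay K (Suc s) (fdiff u)"

definition sh :: "int \<Rightarrow> (nat \<Rightarrow> int \<Rightarrow> real) \<Rightarrow> nat \<Rightarrow> int \<Rightarrow> real"
  where "sh i u = (\<lambda>n j. u n (j + i))"

lemma bnd_add: assumes "bnd s u" "bnd s v" shows "bnd s (\<lambda>n j. u n j + v n j)"
  unfolding bnd_def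
proof
  fix N
  obtain C M where 1: "\<forall>n\<ge>M. \<forall>j. int n \<le> 2 * j + N \<longrightarrow> \<bar>u n j\<bar> * real n ^ s \<le> C"
    using assms(1) unfolding bnd_def by metis
  obtain C' M' where 2: "\<forall>n\<ge>M'. \<forall>j. int n \<le> 2 * j + N \<longrightarrow> \<bar>v n j\<bar> * real n ^ s \<le> C'"
    using assms(2) unfolding bnd_def by metis
  show "\<exists>C M. \<forall>n\<ge>M. \<forall>j. int n \<le> 2 * j + N \<longrightarrow> \<bar>u n j + v n j\<bar> * real n ^ s \<le> C"
  proof (intro exI[of _ "C + C'"] exI[of _ "max M M'"] allI impI)
    fix n j assume n: "max M M' \<le> n" "int n \<le> 2 * j + N"
    have "\<bar>u n j + v n j\<bar> * real n ^ s \<le> (\<bar>u n j\<bar> + \<bar>v n j\<bar>) * real n ^ s"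
      by (intro mult_right_mono) auto
    with n 1 2 show "\<bar>u n j + v n j\<bar> * real n ^ s \<le> C + C'"
      by (fastforce simp: distrib_right)
  qed
qed

lemma bnd_mult: assumes "bnd s u" "bnd r v" shows "bnd (s + r) (\<lambda>n j. u n j * v n j)"
  unfolding bnd_def
proof
  fix N
  obtain C M where 1: "\<forall>n\<ge>M. \<forall>j. int n \<le> 2 * j + N \<longrightarrow> \<bar>u n j\<bar> * real n ^ s \<le> C"
    using assms(1) unfolding bnd_def by metis
  obtain C' M' where 2: "\<forall>n\<ge>M'. \<forall>j. int n \<le> 2 * j + N \<longrightarrow> \<bar>v n j\<bar> * real n ^ r \<le> C'"
    using assms(2) unfolding bnd_def by metis
  show "\<exists>C M. \<forall>n\<ge>M. \<forall>j. int n \<le> 2 * j + N \<longrightarrow> \<bar>u n j * v n j\<bar> * real n ^ (s + r) \<le> C"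
  proof (intro exI[of _ "C * C'"] exI[of _ "max M M'"] allI impI)
    fix n j assume n: "max M M' \<le> n" "int n \<le> 2 * j + N"
    have "\<bar>u n j * v n j\<bar> * real n ^ (s + r) = (\<bar>u n j\<bar> * real n ^ s) * (\<bar>v n j\<bar> * real n ^ r)"
      by (simp add: abs_mult power_add)
    also have "\<dots> \<le> C * C'"
    proof (rule mult_mono)
      show 3: "\<bar>u n j\<bar> * real n ^ s \<le> C" using 1 n by auto
      show "\<bar>v n j\<bar> * real n ^ r \<le> C'" using 2 n by auto
      show "0 \<le> C" using 3 by (smt (verit) mult_nonneg_nonneg zero_le_power of_nat_0_le_iff)
    qed simp
    finally show "\<bar>u n j * v n j\<bar> * real n ^ (s + r) \<le> C * C'" .
  qed
qed

lemma bnd_sh: assumes "bnd s u" shows "bnd s (sh i u)"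
  unfolding bnd_def
proof
  fix N
  obtain C M where "\<forall>n\<ge>M. \<forall>j. int n \<le> 2 * j + (N - 2 * i) \<longrightarrow> \<bar>u n j\<bar> * real n ^ s \<le> C"
    using assms unfolding bnd_def by metis
  then show "\<exists>C M. \<forall>n\<ge>M. \<forall>j. int n \<le> 2 * j + N \<longrightarrow> \<bar>sh i u n j\<bar> * real n ^ s \<le> C"
    by (intro exI[of _ C] exI[of _ M]) (auto simp: sh_def)
qed

lemma decay_bnd: "decay K s u \<Longrightarrow> bnd s u"
  by (cases K) auto

lemma decay_less: "decay (Suc K) s u \<Longrightarrow> decay K s u"
  by (induction K arbitrary: s u) auto

lemma decay_add: "decay K s u \<Longrightarrow> decay K s v \<Longrightarrow> decay K s (\<lambda>n j. u n j + v n j)"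
proof (induction K arbitrary: s u v)
  case (Suc K)
  have "fdiff (\<lambda>n j. u n j + v n j) = (\<lambda>n j. fdiff u n j + fdiff v n j)"
    by (simp add: fdiff_def fun_eq_iff)
  with Suc show ?case by (auto intro: bnd_add)
qed (auto intro: bnd_add)

lemma decay_sh: "decay K s u \<Longrightarrow> decay K s (sh i u)"
proof (induction K arbitrary: s u)
  case (Suc K)
  have "fdiff (sh i u) = sh i (fdiff u)"
    by (simp add: fdiff_def sh_def fun_eq_iff algebra_simps)
  with Suc show ?case by (auto intro: bnd_sh)
qed (auto intro: bnd_sh)

text \<open>Leibniz rule for forward differences. It shifts one of the factors, which is why closure
  under \<open>sh\<close> is needed first.\<close>

lemma decay_mult: "decay K s u \<Longrightarrow> decay K r v \<Longrightarrow> decay K (s + r) (\<lambda>n j. u n j * v n j)"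
proof (induction K arbitrary: s r u v)
  case (Suc K)
  have "fdiff (\<lambda>n j. u n j * v n j) = (\<lambda>n j. fdiff u n j * sh 1 v n j + u n j * fdiff v n j)"
    by (simp add: fdiff_def sh_def fun_eq_iff algebra_simps)
  moreover have "decay K (Suc s + r) (\<lambda>n j. fdiff u n j * sh 1 v n j)"
    using Suc.prems decay_less by (intro Suc.IH decay_sh) auto
  moreover have "decay K (s + Suc r) (\<lambda>n j. u n j * fdiff v n j)"
    using Suc.prems decay_less by (intro Suc.IH) auto
  ultimately show ?case using Suc.prems
    by (auto intro!: bnd_mult decay_add)
qed (auto intro: bnd_mult)

lemma decay_const: "decay K 0 (\<lambda>n j. c)"
proof -
  have "decay K s (\<lambda>n j. 0)" for s
    by (induction K arbitrary: s) (auto simp: fdiff_def bnd_def)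
  moreover have "bnd 0 (\<lambda>n j. c)" by (auto simp: bnd_def)
  ultimately show ?thesis by (cases K) (auto simp: fdiff_def)
qed

lemma decay_cmult: "decay K s u \<Longrightarrow> decay K s (\<lambda>n j. c * u n j)"
  using decay_mult[OF decay_const, of K s u c] by simp

text \<open>For \<open>n \<ge> N + 2 * L\<close> all indices in the range of \<open>bnd\<close> are
  at least \<open>L\<close>.\<close>

lemma bnd_cong:
  assumes "bnd s u" "\<And>n j. int L \<le> j \<Longrightarrow> v n j = u n j"
  shows "bnd s v"
  unfolding bnd_def
proof
  fix N :: int
  obtain C M where 1: "\<forall>n\<ge>M. \<forall>j. int n \<le> 2 * j + N \<longrightarrow> \<bar>u n j\<bar> * real n ^ s \<le> C"
    using assms(1) unfolding bnd_def by metis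
  show "\<exists>C M. \<forall>n\<ge>M. \<forall>j. int n \<le> 2 * j + N \<longrightarrow> \<bar>v n j\<bar> * real n ^ s \<le> C"
  proof (intro exI[of _ C] exI[of _ "max M (nat (N + 2 * int L))"] allI impI)
    fix n :: nat and j :: int assume n: "max M (nat (N + 2 * int L)) \<le> n" "int n \<le> 2 * j + N"
    then have "int L \<le> j" by linarith
    with n 1 assms(2) show "\<bar>v n j\<bar> * real n ^ s \<le> C" by auto
  qed
qed

lemma decay_cong:
  assumes "decay K s u" "\<And>n j. int L \<le> j \<Longrightarrow> v n j = u n j"
  shows "decay K s v"
  using assms
proof (induction K arbitrary: s u v)
  case 0
  then show ?case by (auto intro: bnd_cong)
next
  case (Suc K)
  have "decay K (Suc s) (fdiff v)"
    by (rule Suc.IH[of "Suc s" "fdiff u"]) (use Suc.prems in \<open>auto simp: fdiff_def\<close>)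
  with Suc.prems show ?case by (auto intro: bnd_cong[of s u])
qed

text \<open>For large \<open>n\<close> the range in question satisfies \<open>n \<le> 4 * j\<close>,
  so the reciprocal is at most \<open>4 / n\<close>. Its difference is minus the product of itself
  with its shift, so the induction closes without computing higher differences; that identity is
  used for \<open>j \<ge> 0\<close>, where no denominator vanishes.\<close>

lemma decay_recip:
  assumes "l > 0"
  shows "decay K 1 (\<lambda>n j. 1 / (real_of_int j + l))"
proof -
  let ?r = "\<lambda>(n::nat) j. 1 / (real_of_int j + l)"
  have bd: "bnd 1 ?r"
    unfolding bnd_def
  proof (rule allI)
    fix N :: int
    show "\<exists>C M. \<forall>n\<ge>M. \<forall>j. int n \<le> 2 * j + N \<longrightarrow> \<bar>?r n j\<bar> * real n ^ 1 \<le> C"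
    proof (intro exI[of _ "4::real"] exI[of _ "nat (2 * N) + 1"] allI impI)
      fix n :: nat and j :: int assume n: "nat (2 * N) + 1 \<le> n" "int n \<le> 2 * j + N"
      then have 0: "int n \<le> 4 * j" by linarith
      then have "real n \<le> 4 * real_of_int j" by linarith
      moreover have "j > 0" using n 0 by linarith
      ultimately show "\<bar>?r n j\<bar> * real n ^ 1 \<le> 4" using assms by (simp add: field_simps)
    qed
  qed
  show ?thesis
  proof (induction K)
    case (Suc K)
    have "decay K (Suc (Suc 0)) (\<lambda>n j. - 1 * (?r n j * sh 1 ?r n j))"
      using decay_cmult[OF decay_mult[OF Suc.IH decay_sh[OF Suc.IH, of 1]], of "-1"] by simp
    moreover have "fdiff ?r n j = - 1 * (?r n j * sh 1 ?r n j)" if "int 0 \<le> j" for n j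
    proof -
      have "real_of_int j + l > 0" "real_of_int j + 1 + l > 0" using that assms by auto
      then show ?thesis by (simp add: fdiff_def sh_def field_simps)
    qed
    ultimately have "decay K (Suc (Suc 0)) (fdiff ?r)" by (rule decay_cong)
    with bd show ?case by simp
  qed (use bd in simp)
qed

text \<open>The action of multiplication by \<open>1 - t\<close> on the coefficients with respect to \<open>gegw l j * geg l j\<close>.\<close>

definition gop :: "real \<Rightarrow> (int \<Rightarrow> real) \<Rightarrow> int \<Rightarrow> real"
  where "gop l f j = - (f (j + 1) - 2 * f j + f (j - 1)) / 2
     - l / 2 * (1 / (real_of_int j + l)) * (f (j + 1) - f (j - 1))"

text \<open>One part of \<open>gop\<close> is a second difference, the other a first difference
  times \<open>1 / (j + l)\<close>; both gain two orders. The central differences are expressed by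
  forward ones and a shift by -1.\<close>

lemma decay_gop:
  assumes "l > 0" "\<And>K. decay K s u"
  shows "decay K (s + 2) (\<lambda>n. gop l (u n))"
proof -
  have 1: "decay K (s + 1) (fdiff u)" for K
    using assms(2)[of "Suc K"] by simp
  have 2: "decay K (s + 2) (fdiff (fdiff u))" for K
    using 1[of "Suc K"] unfolding decay.simps by simp
  have 3: "decay K (1 + (s + 1)) (\<lambda>n j. 1 / (real_of_int j + l) * (fdiff u n j + sh (-1) (fdiff u) n j))"
    by (intro decay_mult decay_add decay_recip decay_sh 1 assms)
  have "decay K (s + 2) (\<lambda>n j. (-1/2) * sh (-1) (fdiff (fdiff u)) n j
     + (- l / 2) * (1 / (real_of_int j + l) * (fdiff u n j + sh (-1) (fdiff u) n j)))"
    using 3 by (intro decay_add decay_cmult decay_sh 2) simp_all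
  also have "(\<lambda>n j. (-1/2) * sh (-1) (fdiff (fdiff u)) n j
     + (- l / 2) * (1 / (real_of_int j + l) * (fdiff u n j + sh (-1) (fdiff u) n j))) = (\<lambda>n. gop l (u n))"
    by (simp add: gop_def fdiff_def sh_def fun_eq_iff) (simp add: algebra_simps diff_divide_distrib add_divide_distrib)
  finally show ?thesis .
qed

lemma decay_gop_funpow:
  assumes "l > 0" "\<And>K. decay K 0 u"
  shows "decay K (2 * m) (\<lambda>n. (gop l ^^ m) (u n))"
proof (induction m arbitrary: K)
  case (Suc m)
  show ?case using decay_gop[OF assms(1) Suc.IH, of K] by (simp add: o_def)
qed (use assms in simp)

text \<open>The functions \<open>D n\<close> may depend on \<open>n\<close> so that the induction
  can pass to their increments over a step \<open>1/n\<close>. Increments commute with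
  differentiation and are smaller by a factor \<open>1/n\<close> by the mean value theorem.\<close>

lemma decay_sample:
  fixes D :: "nat \<Rightarrow> nat \<Rightarrow> real \<Rightarrow> real"
  assumes "\<And>n i t. t \<ge> 0 \<Longrightarrow> (D n i has_real_derivative D n (Suc i) t) (at t within {0..})"
    and "\<And>i. \<exists>C. \<forall>n\<ge>1. \<forall>t\<ge>0. \<bar>D n i t\<bar> * real n ^ s \<le> C"
  shows "decay K s (\<lambda>n j. D n 0 (real_of_int j / real n))"
  using assms
proof (induction K arbitrary: s D)
  case 0
  show ?case unfolding decay.simps bnd_def
  proof
    fix N
    obtain C where "\<forall>n\<ge>1. \<forall>t\<ge>0. \<bar>D n 0 t\<bar> * real n ^ s \<le> C" using 0 by meson
    \<comment> \<open>Once \<open>n \<ge> N\<close>, the index \<open>j\<close> is nonnegative and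
      the sample point lies in the half-line.\<close>
    then show "\<exists>C M. \<forall>n\<ge>M. \<forall>j. int n \<le> 2 * j + N \<longrightarrow> \<bar>D n 0 (real_of_int j / real n)\<bar> * real n ^ s \<le> C"
      by (intro exI[of _ C] exI[of _ "max 1 (nat N)"]) auto
  qed
next
  case (Suc K)
  define D' where "D' n i t = D n i (t + 1 / real n) - D n i t" for n i t
  have der: "(D' n i has_real_derivative D' n (Suc i) t) (at t within {0..})" if "t \<ge> 0" for n i t
  proof -
    have sub: "((\<lambda>t. t + 1 / real n) ` {0..}) \<subseteq> {0..}"
      by auto
    have "((\<lambda>t. D n i (t + 1 / real n)) has_real_derivative D n (Suc i) (t + 1 / real n) * 1) (at t within {0..})"
      using DERIV_image_chain[of "D n i" "D n (Suc i) (t + 1 / real n)" "\<lambda>t. t + 1 / real n" t "{0..}" 1]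
        DERIV_subset[OF Suc.prems(1)[of "t + 1 / real n" n i] sub] that
      by (simp add: o_def DERIV_add[OF DERIV_ident DERIV_const, where s="{0..}", simplified])
    then show ?thesis unfolding D'_def
      by (auto intro!: derivative_eq_intros Suc.prems(1) that)
  qed
  have bd: "\<exists>C. \<forall>n\<ge>1. \<forall>t\<ge>0. \<bar>D' n i t\<bar> * real n ^ Suc s \<le> C" for i
  proof -
    obtain C where C: "\<forall>n\<ge>1. \<forall>t\<ge>0. \<bar>D n (Suc i) t\<bar> * real n ^ s \<le> C" using Suc.prems(2) by meson
    show ?thesis
    proof (intro exI[of _ C] allI impI)
      fix n :: nat and t :: real assume n: "n \<ge> 1" "t \<ge> 0"
      have "\<exists>x. t < x \<and> x < t + 1 / real n \<and> D n i (t + 1 / real n) - D n i t = D n (Suc i) x * (t + 1 / real n - t)"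
      proof -
        have "(D n i has_derivative (\<lambda>h. D n (Suc i) x * h)) (at x within {t..t + 1 / real n})" if "x \<in> {t..t + 1 / real n}" for x
          using Suc.prems(1)[of x n i] that n
          by (auto simp: has_field_derivative_def intro: has_derivative_subset)
        from mvt_simple[of t "t + 1 / real n" "D n i" "\<lambda>x h. D n (Suc i) x * h", OF _ this]
        show ?thesis using n by force
      qed
      then obtain x where x: "t < x" "D' n i t = D n (Suc i) x * (1 / real n)"
        unfolding D'_def by force
      have "\<bar>D' n i t\<bar> * real n ^ Suc s = \<bar>D n (Suc i) x\<bar> * real n ^ s"
        using n by (simp add: x abs_mult)
      also have "\<dots> \<le> C" using C n x by auto
      finally show "\<bar>D' n i t\<bar> * real n ^ Suc s \<le> C" .
    qed
  qed
  have "bnd s (\<lambda>n j. D n 0 (real_of_int j / real n))"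
    unfolding bnd_def
  proof
    fix N
    obtain C where "\<forall>n\<ge>1. \<forall>t\<ge>0. \<bar>D n 0 t\<bar> * real n ^ s \<le> C" using Suc.prems by meson
    then show "\<exists>C M. \<forall>n\<ge>M. \<forall>j. int n \<le> 2 * j + N \<longrightarrow> \<bar>D n 0 (real_of_int j / real n)\<bar> * real n ^ s \<le> C"
      by (intro exI[of _ C] exI[of _ "max 1 (nat N)"]) auto
  qed
  moreover have "decay K (Suc s) (\<lambda>n j. D' n 0 (real_of_int j / real n))"
    by (rule Suc.IH) (use der bd in auto)
  moreover have "fdiff (\<lambda>n j. D n 0 (real_of_int j / real n)) = (\<lambda>n j. D' n 0 (real_of_int j / real n))"
    by (simp add: fdiff_def D'_def add_divide_distrib)
  ultimately show ?case by simp
qed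

text \<open>Summation by parts on the three-term recurrence, with the boundary term kept so that
  induction on \<open>J\<close> works. At \<open>j = 0\<close> the coefficient of
  \<open>f (-1)\<close> in \<open>gop\<close> is \<open>-1/2 + 1/2 = 0\<close>, so values at
  negative indices never enter.\<close>

lemma gop_mult_step:
  assumes "l > 0"
  shows "(1 - t) * (\<Sum>j\<le>J. f (int j) * gegw l j * poly (geg l j) t)
    = (\<Sum>j\<le>J. gop l f (int j) * gegw l j * poly (geg l j) t)
      + gegw l J * ((real J + 2 * l) / (2 * (real J + l)))
        * (f (int J + 1) * poly (geg l J) t - f (int J) * poly (geg l (Suc J)) t)"
proof (induction J)
  case 0
  show ?case using assms by (simp add: gop_def field_simps)
next
  case (Suc J)
  define X where "X = real J"
  have X: "X \<ge> 0" by (simp add: X_def)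
  have r: "(X + 1 + 2 * l) * poly (geg l (Suc (Suc J))) t
     = 2 * (X + 1 + l) * t * poly (geg l (Suc J)) t - (X + 1) * poly (geg l J) t"
    using geg_rec[OF assms, of "Suc J" t] by (simp add: X_def algebra_simps)
  \<comment> \<open>Symmetry of the Jacobi matrix: the weights turn the upward coefficient at
    \<open>J\<close> into the downward coefficient at \<open>J + 1\<close>.\<close>
  have w: "gegw l J * ((X + 2 * l) / (2 * (X + l))) = gegw l (Suc J) * ((X + 1) / (2 * (X + 1 + l)))"
  proof -
    have nz: "X + l \<noteq> 0" "X + 1 + l \<noteq> 0" "X + 1 \<noteq> 0" using X assms by auto
    have e: "A * (B * C) / (D * E) * (E / (2 * C)) = A * (B / (2 * D))"
      if "C \<noteq> 0" "E \<noteq> 0" for A B C D E :: real using that by simp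
    show ?thesis using e[OF nz(2,3), of "gegw l J" "X + 2 * l" "X + l"] by (simp add: X_def del: times_divide_eq_right)
  qed
  define h where "h = gegw l (Suc J)"
  define g0 where "g0 = poly (geg l J) t"
  define g1 where "g1 = poly (geg l (Suc J)) t"
  define g2 where "g2 = poly (geg l (Suc (Suc J))) t"
  have g2: "g2 = (2 * (X + 1 + l) * t * g1 - (X + 1) * g0) / (X + 1 + 2 * l)"
    using r X assms unfolding g0_def g1_def g2_def
    by (smt (verit, best) nonzero_mult_div_cancel_left)
  have i1: "int (Suc J) = int J + 1" by simp
  have nz: "X + 1 + l \<noteq> 0" "X + 1 + 2 * l \<noteq> 0" using X assms by auto
  have p: "(X + 1 + 2 * l) / (2 * (X + 1 + l)) * g2 = t * g1 - (X + 1) / (2 * (X + 1 + l)) * g0"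
  proof -
    have "A / (2 * B) * ((2 * B * t * g1 - E * g0) / A) = t * g1 - E / (2 * B) * g0"
      if "A \<noteq> 0" "B \<noteq> 0" for A B E :: real using that by (simp add: field_simps)
    then show ?thesis unfolding g2 using nz by blast
  qed
  have "(1 - t) * (f (int J + 1) * h * g1) =
     gop l f (int J + 1) * h * g1
      + h * ((X + 1 + 2 * l) / (2 * (X + 1 + l))) * (f (int J + 1 + 1) * g1 - f (int J + 1) * g2)
      - h * ((X + 1) / (2 * (X + 1 + l))) * (f (int J + 1) * g0 - f (int J) * g1)"
  proof -
    have "gop l f (int J + 1) = f (int J + 1) - (X + 1 + 2 * l) / (2 * (X + 1 + l)) * f (int J + 1 + 1)
       - (X + 1) / (2 * (X + 1 + l)) * f (int J)"
    proof -
      have "- (u - 2 * v + w) / 2 - l / 2 * (1 / B) * (u - w) = v - (B + l) / (2 * B) * u - (B - l) / (2 * B) * w"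
        if "B \<noteq> 0" for B u v w :: real using that by (simp add: field_simps)
      from this[OF nz(1), of "f (int J + 1 + 1)" "f (int J + 1)" "f (int J)"]
      show ?thesis unfolding gop_def by (simp add: X_def add.commute add.left_commute)
    qed
    moreover have "(1 - t) * (v * h * g1) = G * h * g1 + h * c1 * (u * g1 - v * g2) - h * c2 * (v * g0 - w * g1)"
      if "G = v - c1 * u - c2 * w" "c1 * g2 = t * g1 - c2 * g0" for G c1 c2 u v w :: real
      using that by algebra
    ultimately show ?thesis using p by blast
  qed
  note step = this
  define S where "S = (\<Sum>j\<le>J. f (int j) * gegw l j * poly (geg l j) t)"
  define S' where "S' = (\<Sum>j\<le>J. gop l f (int j) * gegw l j * poly (geg l j) t)"
  have IH: "(1 - t) * S = S' + h * ((X + 1) / (2 * (X + 1 + l))) * (f (int J + 1) * g0 - f (int J) * g1)"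
    using Suc.IH[folded X_def, unfolded w] unfolding S_def S'_def g0_def g1_def h_def .
  have "(1 - t) * (S + f (int J + 1) * h * g1) = S' + gop l f (int J + 1) * h * g1
      + h * ((X + 1 + 2 * l) / (2 * (X + 1 + l))) * (f (int J + 1 + 1) * g1 - f (int J + 1) * g2)"
    unfolding distrib_left[of "1 - t"] IH step by simp
  then show ?case
    unfolding S_def S'_def h_def g0_def g1_def g2_def X_def by (simp add: add_ac del: gegw.simps geg.simps)
qed

lemma gop_mult:
  assumes "l > 0" "\<And>j. j \<ge> int J \<Longrightarrow> f j = 0"
  shows "(1 - t) * (\<Sum>j\<le>J. f (int j) * gegw l j * poly (geg l j) t)
    = (\<Sum>j\<le>J. gop l f (int j) * gegw l j * poly (geg l j) t)"
  using gop_mult_step[OF assms(1), of t f J] assms(2) by simp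

lemma gop_funpow_upper:
  assumes "\<And>j. j > B \<Longrightarrow> f j = 0" "j > B + int m"
  shows "(gop l ^^ m) f j = 0"
  using assms(2) by (induction m arbitrary: j) (auto simp: gop_def assms(1))

text \<open>\<open>gop\<close> annihilates constants, and each application shortens the region of
  constancy by one index at its upper end. The lower end stays at 0 because the value at -1 has
  coefficient 0 there.\<close>

lemma gop_funpow_lower:
  assumes "l > 0" "\<And>j. j \<ge> 0 \<Longrightarrow> 2 * j < N \<Longrightarrow> f j = c" "0 \<le> j" "2 * j + 2 * int m < N" "m > 0"
  shows "(gop l ^^ m) f j = 0"
  using assms(3-5)
proof (induction m arbitrary: j)
  case (Suc m)
  have *: "gop l u j = 0" if "\<And>i. i \<ge> 0 \<Longrightarrow> i \<le> j + 1 \<Longrightarrow> u i = d" for u d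
  proof (cases "j = 0")
    case True then show ?thesis using that[of 0] that[of 1] assms(1) by (simp add: gop_def)
  next
    case False then show ?thesis using that[of j] that[of "j + 1"] that[of "j - 1"] Suc.prems by (simp add: gop_def)
  qed
  show ?case
  proof (cases "m = 0")
    case True
    then show ?thesis using Suc.prems by (auto intro!: *[of _ c] assms(2))
  next
    case False
    then show ?thesis using Suc.prems by (auto intro!: *[of _ 0] Suc.IH)
  qed
qed simp

lemma gop_funpow_mult:
  assumes "l > 0" "\<And>j. j > B \<Longrightarrow> f j = 0" "B + int m < int J"
  shows "(1 - t) ^ m * (\<Sum>j\<le>J. f (int j) * gegw l j * poly (geg l j) t)
    = (\<Sum>j\<le>J. (gop l ^^ m) f (int j) * gegw l j * poly (geg l j) t)"
  using assms(3)
proof (induction m)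
  case (Suc m)
  have "(1 - t) * (\<Sum>j\<le>J. (gop l ^^ m) f (int j) * gegw l j * poly (geg l j) t)
     = (\<Sum>j\<le>J. gop l ((gop l ^^ m) f) (int j) * gegw l j * poly (geg l j) t)"
    by (intro gop_mult assms(1) gop_funpow_upper[of B]) (use assms Suc.prems in auto)
  with Suc show ?case by (simp add: mult.assoc)
qed simp


section \<open>Sampled admissible functions and the one-dimensional kernel\<close>

lemma admissible_cases:
  assumes "admissible a"
  obtains D c where "\<And>t. t \<ge> 0 \<Longrightarrow> D 0 t = a t"
    "\<And>k t. t \<ge> 0 \<Longrightarrow> (D k has_real_derivative D (Suc k) t) (at t within {0..})"
    "\<And>k. \<exists>C. \<forall>t\<ge>0. \<bar>D k t\<bar> \<le> C"
    "\<And>t. t > 2 \<Longrightarrow> a t = 0"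
    "\<And>t. 0 \<le> t \<Longrightarrow> t < 1/2 \<Longrightarrow> a t = c"
proof -
  obtain D where D0: "\<And>t. t \<ge> 0 \<Longrightarrow> D 0 t = a t"
    and D: "\<And>k t. t \<ge> 0 \<Longrightarrow> (D k has_real_derivative D (Suc k) t) (at t within {0..})"
    using assms unfolding admissible_def smooth_halfline_def by metis
  have supp: "t \<in> halfline_supp a" if "t \<ge> 0" "a t \<noteq> 0" for t
    using that closure_subset[of "support_on {0..} a"] by (auto simp: halfline_supp_def support_on_def)
  have two: "a t = 0" if "t > 2" for t
    using assms supp[of t] that unfolding admissible_def by fastforce
  \<comment> \<open>From here on both kinds of admissibility are treated together: the constant near
    0 is 0 for support in \<open>[1/2, 2]\<close> and 1 otherwise.\<close>
  have "\<exists>c. \<forall>t. 0 \<le> t \<longrightarrow> t < 1/2 \<longrightarrow> a t = c"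
  proof (cases "halfline_supp a \<subseteq> {1/2..2}")
    case True
    then show ?thesis using supp by (intro exI[of _ 0]) fastforce
  next
    case False
    then show ?thesis using assms unfolding admissible_def by (intro exI[of _ 1]) auto
  qed
  then obtain c where c: "\<And>t. 0 \<le> t \<Longrightarrow> t < 1/2 \<Longrightarrow> a t = c" by auto
  have Dz: "D k t = 0" if "t > 2" for k t
    using that
  proof (induction k arbitrary: t)
    case (Suc k)
    have "(D k has_real_derivative D (Suc k) t) (at t)"
      using D[of t k] Suc.prems at_within_interior[of t "{0..}"] by (auto simp: interior_real_atLeast)
    moreover have "(D k has_real_derivative 0) (at t)"
      by (rule has_field_derivative_transform_within_open[of "\<lambda>_. 0" 0 t "{2<..}"])
        (use Suc in auto)
    ultimately show ?case using DERIV_unique by blast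
  qed (use D0 two in auto)
  \<comment> \<open>The compact interval \<open>[0, 3]\<close> overlaps the region beyond 2, where
    all derivatives are 0.\<close>
  have bd: "\<exists>C. \<forall>t\<ge>0. \<bar>D k t\<bar> \<le> C" for k
  proof -
    have "continuous_on {0..} (D k)"
      by (rule DERIV_continuous_on[of _ _ "D (Suc k)"]) (use D in auto)
    then have "continuous_on {0..3} (D k)" by (rule continuous_on_subset) auto
    then have "compact (D k ` {0..3})" by (rule compact_continuous_image) auto
    then obtain C where C: "\<forall>x\<in>D k ` {0..3}. norm x \<le> C"
      using compact_imp_bounded bounded_iff by metis
    have "\<bar>D k t\<bar> \<le> max C 0" if "t \<ge> 0" for t
    proof (cases "t \<le> 3")
      case True then show ?thesis using C that by (force simp: le_max_iff_disj)
    qed (simp add: Dz)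
    then show ?thesis by blast
  qed
  show ?thesis by (rule that[OF D0 D bd two c])
qed

lemma admissible_vanish: "admissible a \<Longrightarrow> t > 2 \<Longrightarrow> a t = 0"
  by (erule admissible_cases) blast

definition gker :: "(real \<Rightarrow> real) \<Rightarrow> real \<Rightarrow> nat \<Rightarrow> real \<Rightarrow> real"
  where "gker a l n t = (\<Sum>j\<le>2 * n. a (real j / real n) * gegw l j * poly (geg l j) t)"

text \<open>The difference calculus covers \<open>2 * j + 2 * m \<ge> n\<close>. At the remaining
  indices the iterate only sees the constant part of \<open>a\<close> and is exactly 0. For
  \<open>m = 0\<close> nothing annihilates that constant, and boundedness of \<open>a\<close> is
  used instead.\<close>

lemma gop_funpow_sample_bound:
  assumes "l > 0" "admissible a"
  shows "\<exists>C M. \<forall>n\<ge>M. \<forall>j\<ge>0.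
    \<bar>(gop l ^^ m) (\<lambda>j. a (real_of_int j / real n)) j\<bar> * real n ^ (2 * m) \<le> C"
proof -
  obtain D c where D0: "\<And>t. t \<ge> 0 \<Longrightarrow> D 0 t = a t"
    and D: "\<And>k t. t \<ge> 0 \<Longrightarrow> (D k has_real_derivative D (Suc k) t) (at t within {0..})"
    and bd: "\<And>k. \<exists>C. \<forall>t\<ge>0. \<bar>D k t\<bar> \<le> C"
    and "\<And>t. t > 2 \<Longrightarrow> a t = 0"
    and c: "\<And>t. 0 \<le> t \<Longrightarrow> t < 1/2 \<Longrightarrow> a t = c"
    by (rule admissible_cases[OF assms(2)]) blast
  define u where "u = (\<lambda>n j. a (real_of_int j / real n))"
  have "decay K 0 (\<lambda>n j. D 0 (real_of_int j / real n))" for K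
    by (rule decay_sample) (use D bd in auto)
  then have "decay K 0 u" for K
    by (rule decay_cong[where L=0]) (auto simp: u_def D0)
  then have "bnd (2 * m) (\<lambda>n. (gop l ^^ m) (u n))"
    using decay_bnd decay_gop_funpow assms(1) by blast
  then obtain C M where CM: "\<And>n j. n \<ge> M \<Longrightarrow> int n \<le> 2 * j + 2 * int m \<Longrightarrow> \<bar>(gop l ^^ m) (u n) j\<bar> * real n ^ (2 * m) \<le> C"
    unfolding bnd_def by metis
  obtain C0 where C0: "\<And>t. t \<ge> 0 \<Longrightarrow> \<bar>a t\<bar> \<le> C0" using bd[of 0] D0 by metis
  show ?thesis
  proof (cases "m = 0")
    case True
    then show ?thesis using C0 by (intro exI[of _ C0]) auto
  next
    case False
    have "\<bar>(gop l ^^ m) (u n) j\<bar> * real n ^ (2 * m) \<le> max C 0" if "n \<ge> max 1 M" "j \<ge> 0" for n j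
    proof (cases "int n \<le> 2 * j + 2 * int m")
      case True then show ?thesis using CM that by (simp add: le_max_iff_disj)
    next
      case nle: False
      have *: "u n i = c" if "i \<ge> 0" "2 * i < int n" for i
      proof -
        have "real_of_int i / real n < 1/2"
          using that by (simp add: field_simps)
        then show ?thesis using that by (auto simp: u_def intro!: c)
      qed
      have "(gop l ^^ m) (u n) j = 0"
        by (rule gop_funpow_lower[of l "int n" "u n" c]) (use * False nle that assms in auto)
      then show ?thesis by simp
    qed
    then show ?thesis unfolding u_def by blast
  qed
qed

text \<open>The factor \<open>(1 - t) ^ m\<close> is traded for \<open>m\<close> applications of
  \<open>gop\<close> to the coefficients. What remains has about \<open>2 * n\<close> terms, each of
  order \<open>n powr (2 * l)\<close> divided by \<open>n ^ (2 * m)\<close>.\<close>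

lemma gker_power_bound:
  assumes "l \<ge> 1/2" "admissible a"
    and g1: "\<And>j t. \<bar>t\<bar> \<le> 1 \<Longrightarrow> \<bar>poly (geg l j) t\<bar> \<le> 1"
  shows "\<exists>C. \<forall>n\<ge>1. \<forall>t. \<bar>t\<bar> \<le> 1 \<longrightarrow> (real n ^ 2 * (1 - t)) ^ m * \<bar>gker a l n t\<bar> \<le> C * real n powr (2 * l + 1)"
proof -
  have l: "l > 0" using assms by simp
  obtain C M where CM: "\<And>n j. n \<ge> M \<Longrightarrow> j \<ge> 0 \<Longrightarrow>
    \<bar>(gop l ^^ m) (\<lambda>j. a (real_of_int j / real n)) j\<bar> * real n ^ (2 * m) \<le> C"
    using gop_funpow_sample_bound[OF l assms(2), of m] by blast
  obtain C' where C': "C' > 0" "\<And>j. gegw l j \<le> C' * (real j + 1) powr (2 * l)"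
    using gegw_growth[OF assms(1)] by blast
  have Cnn: "C \<ge> 0" by (rule order.trans[OF _ CM[of M 0]]) auto
  have large: "(real n ^ 2 * (1 - t)) ^ m * \<bar>gker a l n t\<bar>
       \<le> C * C' * (real m + 4) powr (2 * l + 1) * real n powr (2 * l + 1)"
    if n: "n \<ge> 1" "n \<ge> M" and t: "\<bar>t\<bar> \<le> 1" for n t
  proof -
    define f where "f = (\<lambda>j. a (real_of_int j / real n))"
    \<comment> \<open>Each application of \<open>gop\<close> widens the support by one index, so the
      cut-off lies \<open>m + 1\<close> beyond \<open>2 * n\<close>.\<close>
    define J where "J = 2 * n + m + 1"
    have f0: "f j = 0" if "j > 2 * int n" for j
    proof -
      have "real_of_int j / real n > 2" using that n by (simp add: field_simps)
      then show ?thesis by (simp add: f_def admissible_vanish[OF assms(2)])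
    qed
    have "gker a l n t = (\<Sum>j\<le>J. f (int j) * gegw l j * poly (geg l j) t)"
      unfolding gker_def
    proof (rule sum.mono_neutral_cong_left)
      show "\<forall>i\<in>{..J} - {..2 * n}. f (int i) * gegw l i * poly (geg l i) t = 0"
        using f0 by auto
    qed (auto simp: J_def f_def)
    then have *: "(1 - t) ^ m * gker a l n t = (\<Sum>j\<le>J. (gop l ^^ m) f (int j) * gegw l j * poly (geg l j) t)"
      using gop_funpow_mult[where m=m and J=J and t=t and f=f and B="2 * int n", OF l f0] by (simp add: J_def)
    have "(1 - t) ^ m \<ge> 0" using t by simp
    then have "(1 - t) ^ m * \<bar>gker a l n t\<bar> = \<bar>\<Sum>j\<le>J. (gop l ^^ m) f (int j) * gegw l j * poly (geg l j) t\<bar>"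
      unfolding *[symmetric] abs_mult by (simp only: abs_of_nonneg)
    then have "(real n ^ 2 * (1 - t)) ^ m * \<bar>gker a l n t\<bar>
       = real n ^ (2 * m) * \<bar>\<Sum>j\<le>J. (gop l ^^ m) f (int j) * gegw l j * poly (geg l j) t\<bar>"
      by (simp add: power_mult_distrib power_mult mult.assoc)
    also have "\<dots> \<le> real n ^ (2 * m) * (\<Sum>j\<le>J. \<bar>(gop l ^^ m) f (int j) * gegw l j * poly (geg l j) t\<bar>)"
      by (intro mult_left_mono sum_abs) auto
    also have "\<dots> = (\<Sum>j\<le>J. (\<bar>(gop l ^^ m) f (int j)\<bar> * real n ^ (2 * m)) * (gegw l j * \<bar>poly (geg l j) t\<bar>))"
      using gegw_pos[OF l] by (simp add: sum_distrib_left abs_mult mult_ac less_imp_le abs_of_pos)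
    also have "\<dots> \<le> (\<Sum>j\<le>J. C * ((C' * (real J + 1) powr (2 * l)) * 1))"
    proof (intro sum_mono mult_mono)
      fix j assume j: "j \<in> {..J}"
      show "\<bar>(gop l ^^ m) f (int j)\<bar> * real n ^ (2 * m) \<le> C" unfolding f_def using CM n by auto
      show "gegw l j \<le> C' * (real J + 1) powr (2 * l)"
        using j assms C' by (intro order.trans[OF C'(2)] mult_left_mono powr_mono2) auto
    qed (use g1 t C' Cnn gegw_pos[OF l] in \<open>auto intro!: mult_nonneg_nonneg intro: less_imp_le\<close>)
    also have "\<dots> = C * C' * (real J + 1) powr (2 * l + 1)"
      by (simp add: powr_add)
    also have "\<dots> \<le> C * C' * ((real m + 4) * real n) powr (2 * l + 1)"
    proof (intro mult_left_mono powr_mono2)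
      have "real m + 2 \<le> (real m + 2) * real n" using n by simp
      then show "real J + 1 \<le> (real m + 4) * real n"
        unfolding J_def by (simp add: algebra_simps)
    qed (use assms Cnn C' in auto)
    finally show ?thesis by (simp add: powr_mult mult.assoc)
  qed
  \<comment> \<open>The calculus says nothing for \<open>n < M\<close>; these finitely many
    \<open>n\<close> get a crude constant.\<close>
  define S where "S = (\<lambda>n. \<Sum>j\<le>2 * n. \<bar>a (real j / real n)\<bar> * gegw l j)"
  have S0: "S n \<ge> 0" for n unfolding S_def using gegw_pos[OF l] by (intro sum_nonneg mult_nonneg_nonneg) (auto intro: less_imp_le)
  have small: "(real n ^ 2 * (1 - t)) ^ m * \<bar>gker a l n t\<bar>
       \<le> ((real M ^ 2 * 2) ^ m * (\<Sum>n<M. S n)) * real n powr (2 * l + 1)"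
    if n: "n \<ge> 1" "n < M" and t: "\<bar>t\<bar> \<le> 1" for n t
  proof -
    have "\<bar>gker a l n t\<bar> \<le> (\<Sum>j\<le>2 * n. \<bar>a (real j / real n) * gegw l j * poly (geg l j) t\<bar>)"
      unfolding gker_def by (rule sum_abs)
    also have "\<dots> \<le> S n" unfolding S_def
    proof (intro sum_mono)
      fix j
      have "\<bar>a (real j / real n) * gegw l j * poly (geg l j) t\<bar> = (\<bar>a (real j / real n)\<bar> * gegw l j) * \<bar>poly (geg l j) t\<bar>"
        using gegw_pos[OF l, of j] by (simp add: abs_mult)
      also have "\<dots> \<le> (\<bar>a (real j / real n)\<bar> * gegw l j) * 1"
        using gegw_pos[OF l, of j] g1 t by (intro mult_left_mono) auto
      finally show "\<bar>a (real j / real n) * gegw l j * poly (geg l j) t\<bar> \<le> \<bar>a (real j / real n)\<bar> * gegw l j" by simp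
    qed
    also have "S n \<le> (\<Sum>n<M. S n)" using n S0 by (intro member_le_sum) auto
    finally have "\<bar>gker a l n t\<bar> \<le> (\<Sum>n<M. S n)" .
    then have "(real n ^ 2 * (1 - t)) ^ m * \<bar>gker a l n t\<bar> \<le> (real M ^ 2 * 2) ^ m * (\<Sum>n<M. S n)"
      using t n by (intro mult_mono power_mono) (auto intro!: sum_nonneg S0)
    also have "\<dots> \<le> \<dots> * real n powr (2 * l + 1)"
    proof -
      have 1: "1 \<le> real n powr (2 * l + 1)" using n l by (intro ge_one_powr_ge_zero) auto
      have 2: "0 \<le> (real M ^ 2 * 2) ^ m * (\<Sum>n<M. S n)" by (intro mult_nonneg_nonneg sum_nonneg S0) auto
      show ?thesis using mult_left_mono[OF 1 2] by simp
    qed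
    finally show ?thesis .
  qed
  show ?thesis
  proof (intro exI[of _ "max (C * C' * (real m + 4) powr (2 * l + 1)) ((real M ^ 2 * 2) ^ m * (\<Sum>n<M. S n))"] allI impI)
    fix n :: nat and t :: real assume "n \<ge> 1" "\<bar>t\<bar> \<le> 1"
    then show "(real n ^ 2 * (1 - t)) ^ m * \<bar>gker a l n t\<bar>
      \<le> max (C * C' * (real m + 4) powr (2 * l + 1)) ((real M ^ 2 * 2) ^ m * (\<Sum>n<M. S n)) * real n powr (2 * l + 1)"
      using large[of n t] small[of n t]
      by (cases "n < M") (auto simp: max_mult_distrib_right le_max_iff_disj)
  qed
qed

lemma gker_localized:
  assumes "l \<ge> 1/2" "admissible a"
    and "\<And>j t. \<bar>t\<bar> \<le> 1 \<Longrightarrow> \<bar>poly (geg l j) t\<bar> \<le> 1"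
  shows "\<exists>C>0. \<forall>n\<ge>1. \<forall>t. \<bar>t\<bar> \<le> 1 \<longrightarrow> (1 + real n ^ 2 * (1 - t)) ^ m * \<bar>gker a l n t\<bar> \<le> C * real n powr (2 * l + 1)"
proof -
  obtain C0 where C0: "\<And>n t. n \<ge> 1 \<Longrightarrow> \<bar>t\<bar> \<le> 1 \<Longrightarrow> \<bar>gker a l n t\<bar> \<le> C0 * real n powr (2 * l + 1)"
    using gker_power_bound[OF assms, of 0] by auto
  obtain C where C: "\<And>n t. n \<ge> 1 \<Longrightarrow> \<bar>t\<bar> \<le> 1 \<Longrightarrow> (real n ^ 2 * (1 - t)) ^ m * \<bar>gker a l n t\<bar> \<le> C * real n powr (2 * l + 1)"
    using gker_power_bound[OF assms, of m] by auto
  have *: "(1 + z) ^ m \<le> 2 ^ m * (1 + z ^ m)" if "z \<ge> 0" for z :: real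
  proof -
    have "(1 + z) ^ m \<le> (2 * max 1 z) ^ m" using that by (intro power_mono) auto
    also have "\<dots> = 2 ^ m * (max 1 z) ^ m" by (simp add: power_mult_distrib)
    also have "(max 1 z) ^ m \<le> 1 + z ^ m" using that by (auto simp: max_def)
    finally show ?thesis by simp
  qed
  show ?thesis
  proof (intro exI[of _ "max 1 (2 ^ m * (C0 + C))"] conjI allI impI)
    fix n :: nat and t :: real assume nt: "n \<ge> 1" "\<bar>t\<bar> \<le> 1"
    have "(1 + real n ^ 2 * (1 - t)) ^ m * \<bar>gker a l n t\<bar> \<le> 2 ^ m * (1 + (real n ^ 2 * (1 - t)) ^ m) * \<bar>gker a l n t\<bar>"
      using nt by (intro mult_right_mono *) auto
    also have "\<dots> = 2 ^ m * (\<bar>gker a l n t\<bar> + (real n ^ 2 * (1 - t)) ^ m * \<bar>gker a l n t\<bar>)"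
      by (simp add: algebra_simps)
    also have "\<dots> \<le> 2 ^ m * (C0 * real n powr (2 * l + 1) + C * real n powr (2 * l + 1))"
      using C0[OF nt] C[OF nt] by (intro mult_left_mono add_mono) auto
    also have "\<dots> = 2 ^ m * (C0 + C) * real n powr (2 * l + 1)" by (simp add: algebra_simps)
    also have "\<dots> \<le> max 1 (2 ^ m * (C0 + C)) * real n powr (2 * l + 1)"
      by (intro mult_right_mono) auto
    finally show "(1 + real n ^ 2 * (1 - t)) ^ m * \<bar>gker a l n t\<bar> \<le> max 1 (2 ^ m * (C0 + C)) * real n powr (2 * l + 1)" .
  qed auto
qed

section \<open>Moments of the ball weight\<close>

lemma powser_zero_imp_zero:
  fixes c :: "nat \<Rightarrow> real"
  assumes "\<And>t. (\<lambda>n. c n * t ^ n) sums 0"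
  shows "c m = 0"
proof (induction m rule: less_induct)
  case (less m)
  have "(\<lambda>n. c (n + m) * t ^ n) sums 0" if "t \<noteq> 0" for t
  proof -
    have "(\<lambda>n. c (n + m) * t ^ (n + m)) sums (0 - (\<Sum>n<m. c n * t ^ n))"
      using assms[of t] by (subst sums_iff_shift') simp
    then have "(\<lambda>n. c (n + m) * t ^ (n + m)) sums 0" using less by simp
    from sums_mult[OF this, of "1 / t ^ m"] show ?thesis
      using that by (simp add: power_add field_simps)
  qed
  then have "((\<lambda>t::real. 0) \<longlongrightarrow> c (0 + m)) (at 0)"
    by (intro powser_limit_0_strong[of 1 "\<lambda>n. c (n + m)"]) auto
  then show ?case by (simp add: tendsto_const_iff)
qed

lemma gauss_mass:
  "(\<integral>\<^sup>+y. ennreal (exp (- (norm y)\<^sup>2)) \<partial>(lborel :: (real ^ 'd) measure)) = ennreal (sqrt pi ^ CARD('d))"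
proof -
  have "has_bochner_integral lborel (\<lambda>x::real. exp (- x\<^sup>2)) (2 *\<^sub>R (sqrt pi / 2))"
    using gaussian_moment_0 by (intro has_bochner_integral_even_function) simp_all
  then have 1: "(\<integral>\<^sup>+x. ennreal (exp (- x\<^sup>2)) \<partial>(lborel :: real measure)) = ennreal (sqrt pi)"
    by (subst nn_integral_eq_integral) (auto simp: has_bochner_integral_iff)
  have "(\<integral>\<^sup>+y. ennreal (exp (- (norm y)\<^sup>2)) \<partial>(lborel :: (real ^ 'd) measure))
      = (\<integral>\<^sup>+y. (\<Prod>b\<in>Basis. ennreal (exp (- (y \<bullet> b)\<^sup>2))) \<partial>(lborel :: (real ^ 'd) measure))"
  proof (rule nn_integral_cong)
    fix y :: "real ^ 'd"
    have "(norm y)\<^sup>2 = (\<Sum>b\<in>Basis. (y \<bullet> b)\<^sup>2)"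
      by (simp only: power2_norm_eq_inner, subst euclidean_inner) (simp add: power2_eq_square)
    then show "ennreal (exp (- (norm y)\<^sup>2)) = (\<Prod>b\<in>Basis. ennreal (exp (- (y \<bullet> b)\<^sup>2)))"
      by (simp add: prod_ennreal exp_sum[symmetric] sum_negf)
  qed
  also have "\<dots> = (\<Prod>b\<in>(Basis :: (real ^ 'd) set). ennreal (sqrt pi))"
    by (subst nn_integral_lborel_prod[where f="\<lambda>b x. ennreal (exp (- x\<^sup>2))"]) (auto simp: 1)
  also have "\<dots> = ennreal (sqrt pi ^ CARD('d))"
    by (simp add: ennreal_power)
  finally show ?thesis .
qed

lemma gauss_exp:
  fixes \<xi> :: "real ^ 'd"
  shows "(\<integral>\<^sup>+y. ennreal (exp (2 * t * (\<xi> \<bullet> y) - (norm y)\<^sup>2)) \<partial>lborel)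
    = ennreal (sqrt pi ^ CARD('d) * exp (t\<^sup>2 * (norm \<xi>)\<^sup>2))"
proof -
  have "(\<integral>\<^sup>+y. ennreal (exp (- (norm y)\<^sup>2)) \<partial>(lborel :: (real ^ 'd) measure))
      = (\<integral>\<^sup>+y. ennreal (exp (- (norm y)\<^sup>2)) \<partial>(distr lborel borel ((+) (- t *\<^sub>R \<xi>))))"
    by (simp only: lborel_distr_plus)
  also have "\<dots> = (\<integral>\<^sup>+y. ennreal (exp (- (norm (y - t *\<^sub>R \<xi>))\<^sup>2)) \<partial>lborel)"
    by (subst nn_integral_distr) auto
  also have "\<dots> = (\<integral>\<^sup>+y. ennreal (exp (- (t\<^sup>2 * (norm \<xi>)\<^sup>2))) * ennreal (exp (2 * t * (\<xi> \<bullet> y) - (norm y)\<^sup>2)) \<partial>lborel)"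
  proof (rule nn_integral_cong)
    fix y
    have "(norm (y - t *\<^sub>R \<xi>))\<^sup>2 = (norm y)\<^sup>2 - 2 * t * (\<xi> \<bullet> y) + t\<^sup>2 * (norm \<xi>)\<^sup>2"
      unfolding power2_norm_eq_inner by (simp add: inner_diff_left inner_diff_right inner_commute power2_eq_square algebra_simps)
    then show "ennreal (exp (- (norm (y - t *\<^sub>R \<xi>))\<^sup>2)) = ennreal (exp (- (t\<^sup>2 * (norm \<xi>)\<^sup>2))) * ennreal (exp (2 * t * (\<xi> \<bullet> y) - (norm y)\<^sup>2))"
      by (simp add: ennreal_mult[symmetric] exp_add[symmetric])
  qed
  also have "\<dots> = ennreal (exp (- (t\<^sup>2 * (norm \<xi>)\<^sup>2))) * (\<integral>\<^sup>+y. ennreal (exp (2 * t * (\<xi> \<bullet> y) - (norm y)\<^sup>2)) \<partial>lborel)"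
    by (rule nn_integral_cmult) auto
  finally have "ennreal (exp (t\<^sup>2 * (norm \<xi>)\<^sup>2)) * ennreal (sqrt pi ^ CARD('d))
    = ennreal (exp (t\<^sup>2 * (norm \<xi>)\<^sup>2)) * (ennreal (exp (- (t\<^sup>2 * (norm \<xi>)\<^sup>2))) * (\<integral>\<^sup>+y. ennreal (exp (2 * t * (\<xi> \<bullet> y) - (norm y)\<^sup>2)) \<partial>lborel))"
    by (simp add: gauss_mass)
  also have "\<dots> = (\<integral>\<^sup>+y. ennreal (exp (2 * t * (\<xi> \<bullet> y) - (norm y)\<^sup>2)) \<partial>lborel)"
    by (simp add: mult.assoc[symmetric] ennreal_mult[symmetric] exp_add[symmetric])
  finally show ?thesis by (simp add: ennreal_mult mult.commute)
qed

text \<open>A generating function of the even Gaussian moments. With \<open>cosh\<close> in place of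
  \<open>exp\<close> the power series has nonnegative terms, so it can be integrated term by term
  without an integrability argument.\<close>

lemma gauss_cosh:
  fixes \<xi> :: "real ^ 'd"
  shows "(\<integral>\<^sup>+y. ennreal (cosh (2 * t * (\<xi> \<bullet> y)) * exp (- (norm y)\<^sup>2)) \<partial>lborel)
    = ennreal (sqrt pi ^ CARD('d) * exp (t\<^sup>2 * (norm \<xi>)\<^sup>2))"
proof -
  let ?r = "sqrt pi ^ CARD('d) * exp (t\<^sup>2 * (norm \<xi>)\<^sup>2)"
  have "(\<integral>\<^sup>+y. ennreal (cosh (2 * t * (\<xi> \<bullet> y)) * exp (- (norm y)\<^sup>2)) \<partial>lborel)
     = (\<integral>\<^sup>+y. ennreal (1/2) * (ennreal (exp (2 * t * (\<xi> \<bullet> y) - (norm y)\<^sup>2)) + ennreal (exp (2 * (-t) * (\<xi> \<bullet> y) - (norm y)\<^sup>2))) \<partial>lborel)"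
  proof (rule nn_integral_cong)
    fix y
    have "cosh (2 * t * (\<xi> \<bullet> y)) * exp (- (norm y)\<^sup>2)
      = (1/2) * (exp (2 * t * (\<xi> \<bullet> y) - (norm y)\<^sup>2) + exp (2 * (-t) * (\<xi> \<bullet> y) - (norm y)\<^sup>2))"
      by (simp add: cosh_def exp_diff exp_minus field_simps)
    then show "ennreal (cosh (2 * t * (\<xi> \<bullet> y)) * exp (- (norm y)\<^sup>2))
     = ennreal (1/2) * (ennreal (exp (2 * t * (\<xi> \<bullet> y) - (norm y)\<^sup>2)) + ennreal (exp (2 * (-t) * (\<xi> \<bullet> y) - (norm y)\<^sup>2)))"
      by (simp only: ennreal_mult ennreal_plus exp_ge_zero add_nonneg_nonneg zero_le_divide_1_iff zero_le_numeral)
  qed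
  also have "\<dots> = ennreal (1/2) * (ennreal ?r + ennreal ?r)"
    by (subst nn_integral_cmult, simp, subst nn_integral_add) (simp_all only: gauss_exp, auto)
  also have "\<dots> = ennreal ?r"
  proof -
    have "ennreal (1/2) * (ennreal r + ennreal r) = ennreal r" if "r \<ge> 0" for r
    proof -
      have "ennreal r + ennreal r = ennreal (r + r)" using that by (intro ennreal_plus[symmetric])
      moreover have "ennreal (1/2) * ennreal (r + r) = ennreal ((1/2) * (r + r))"
        using that by (intro ennreal_mult[symmetric]) auto
      moreover have "(1/2) * (r + r) = r" by simp
      ultimately show ?thesis by metis
    qed
    then show ?thesis by simp
  qed
  finally show ?thesis .
qed

text \<open>Two expansions of the same function of \<open>t\<close>, one from
  \<open>gauss_cosh\<close> and one from the exponential series, have equal coefficients.\<close>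

lemma gauss_moment:
  fixes \<xi> :: "real ^ 'd"
  shows "(\<integral>\<^sup>+y. ennreal ((\<xi> \<bullet> y) ^ (2 * l) * exp (- (norm y)\<^sup>2)) \<partial>lborel)
    = ennreal (sqrt pi ^ CARD('d) * norm \<xi> ^ (2 * l) * pochhammer (1/2) l)"
proof -
  define G where "G N = (\<integral>\<^sup>+y. ennreal ((\<xi> \<bullet> y) ^ N * exp (- (norm y)\<^sup>2)) \<partial>(lborel :: (real ^ 'd) measure))" for N
  define P where "P = sqrt pi ^ CARD('d)"
  have ser: "(\<Sum>N. if even N then ennreal ((2 * t) ^ N / fact N) * G N else 0) = ennreal (P * exp (t\<^sup>2 * (norm \<xi>)\<^sup>2))" for t
  proof -
    define F where "F N y = (if even N then ((2 * t) ^ N / fact N) * ((\<xi> \<bullet> y) ^ N * exp (- (norm y)\<^sup>2)) else 0)" for N y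
    have Fnn: "F N y \<ge> 0" for N y
      unfolding F_def by (auto intro!: mult_nonneg_nonneg divide_nonneg_nonneg zero_le_even_power)
    have [measurable]: "F N \<in> borel_measurable borel" for N unfolding F_def by measurable
    have Fs: "(\<lambda>N. F N y) sums (cosh (2 * t * (\<xi> \<bullet> y)) * exp (- (norm y)\<^sup>2))" for y
    proof -
      have "(\<lambda>N. (if even N then (2 * t * (\<xi> \<bullet> y)) ^ N /\<^sub>R fact N else 0) * exp (- (norm y)\<^sup>2))
          sums (cosh (2 * t * (\<xi> \<bullet> y)) * exp (- (norm y)\<^sup>2))"
        by (intro sums_mult2 cosh_converges)
      moreover have "(if even N then (2 * t * (\<xi> \<bullet> y)) ^ N /\<^sub>R fact N else 0) * exp (- (norm y)\<^sup>2) = F N y" for N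
        by (simp add: F_def power_mult_distrib field_simps)
      ultimately show ?thesis by simp
    qed
    have "ennreal (P * exp (t\<^sup>2 * (norm \<xi>)\<^sup>2)) = (\<integral>\<^sup>+y. (\<Sum>N. ennreal (F N y)) \<partial>lborel)"
      unfolding P_def gauss_cosh[symmetric]
      by (intro nn_integral_cong suminf_ennreal_eq[symmetric] Fnn Fs)
    also have "\<dots> = (\<Sum>N. \<integral>\<^sup>+y. ennreal (F N y) \<partial>lborel)"
      by (rule nn_integral_suminf) auto
    also have "\<dots> = (\<Sum>N. if even N then ennreal ((2 * t) ^ N / fact N) * G N else 0)"
    proof (rule suminf_cong)
      fix N
      show "(\<integral>\<^sup>+y. ennreal (F N y) \<partial>lborel) = (if even N then ennreal ((2 * t) ^ N / fact N) * G N else 0)"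
      proof (cases "even N")
        case True
        have "(\<integral>\<^sup>+y. ennreal (F N y) \<partial>lborel) = (\<integral>\<^sup>+y. ennreal ((2 * t) ^ N / fact N) * ennreal ((\<xi> \<bullet> y) ^ N * exp (- (norm y)\<^sup>2)) \<partial>lborel)"
          unfolding F_def if_P[OF True]
          by (intro nn_integral_cong ennreal_mult) (use True in \<open>auto intro!: mult_nonneg_nonneg divide_nonneg_nonneg simp: zero_le_even_power\<close>)
        also have "\<dots> = ennreal ((2 * t) ^ N / fact N) * G N"
          unfolding G_def by (rule nn_integral_cmult) auto
        finally show ?thesis using True by simp
      qed (simp add: F_def)
    qed
    finally show ?thesis by simp
  qed
  \<comment> \<open>Finiteness has to come before passing to real numbers with
    \<open>enn2real\<close>: a single term is bounded by the finite sum at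
    \<open>t = 1\<close>.\<close>
  have fin: "G N < \<infinity>" if "even N" for N
  proof -
    have "ennreal (2 ^ N / fact N) * G N \<le> (\<Sum>N. if even N then ennreal ((2 * 1) ^ N / fact N) * G N else 0)"
      using sum_le_suminf[of "\<lambda>N. if even N then ennreal ((2 * 1) ^ N / fact N) * G N else 0" "{N}"] that by auto
    also have "\<dots> < \<infinity>" unfolding ser by simp
    finally show ?thesis by (auto simp: ennreal_mult_less_top)
  qed
  define c where "c N = (if even N then 2 ^ N / fact N * enn2real (G N) else 0)" for N
  define b where "b N = (if even N then P * norm \<xi> ^ N / fact (N div 2) else 0)" for N
  have cs: "(\<lambda>N. c N * t ^ N) sums (P * exp (t\<^sup>2 * (norm \<xi>)\<^sup>2))" for t
  proof -
    have cnn: "c N * t ^ N \<ge> 0" for N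
      unfolding c_def by (auto intro!: mult_nonneg_nonneg zero_le_even_power)
    have "(if even N then ennreal ((2 * t) ^ N / fact N) * G N else 0) = ennreal (c N * t ^ N)" for N
    proof (cases "even N")
      case True
      then obtain g where g: "G N = ennreal g" "g \<ge> 0" using fin[OF True] by (cases "G N") auto
      show ?thesis using True g
        by (simp add: c_def ennreal_mult'[symmetric] power_mult_distrib ac_simps zero_le_even_power)
    qed (simp add: c_def)
    then have s: "(\<Sum>N. ennreal (c N * t ^ N)) = ennreal (P * exp (t\<^sup>2 * (norm \<xi>)\<^sup>2))" using ser[of t] by simp
    then have "summable (\<lambda>N. c N * t ^ N)"
      by (intro summable_suminf_not_top cnn) simp
    then show ?thesis
      using s suminf_ennreal2[OF cnn] suminf_nonneg[OF _ cnn]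
      by (simp add: sums_iff P_def)
  qed
  have bs: "(\<lambda>N. b N * t ^ N) sums (P * exp (t\<^sup>2 * (norm \<xi>)\<^sup>2))" for t
  proof -
    have "(\<lambda>n. P * ((t\<^sup>2 * (norm \<xi>)\<^sup>2) ^ n /\<^sub>R fact n)) sums (P * exp (t\<^sup>2 * (norm \<xi>)\<^sup>2))"
      by (intro sums_mult exp_converges)
    also have "(\<lambda>n. P * ((t\<^sup>2 * (norm \<xi>)\<^sup>2) ^ n /\<^sub>R fact n)) = (\<lambda>n. b (2 * n) * t ^ (2 * n))"
      by (auto simp: b_def power_mult_distrib power_mult[symmetric] field_simps fun_eq_iff)
    finally have 1: "(\<lambda>n. b (2 * n) * t ^ (2 * n)) sums (P * exp (t\<^sup>2 * (norm \<xi>)\<^sup>2))" .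
    have "strict_mono (\<lambda>n::nat. 2 * n)" by (simp add: strict_mono_def)
    moreover have "b n * t ^ n = 0" if "n \<notin> range (\<lambda>n::nat. 2 * n)" for n
      using that by (auto simp: b_def image_iff elim!: evenE)
    ultimately show ?thesis using sums_mono_reindex[of "\<lambda>n::nat. 2 * n" "\<lambda>N. b N * t ^ N"] 1 by simp
  qed
  have "c N - b N = 0" for N
  proof (rule powser_zero_imp_zero[of "\<lambda>N. c N - b N"])
    fix t show "(\<lambda>N. (c N - b N) * t ^ N) sums 0"
      using sums_diff[OF cs[of t] bs[of t]] by (simp add: left_diff_distrib)
  qed
  from this[of "2 * l"] have "2 ^ (2 * l) / fact (2 * l) * enn2real (G (2 * l)) = P * norm \<xi> ^ (2 * l) / fact l"
    by (simp add: c_def b_def)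
  then have "enn2real (G (2 * l)) = P * norm \<xi> ^ (2 * l) * (fact (2 * l) / (2 ^ (2 * l) * fact l))"
    by (simp add: field_simps)
  also have "fact (2 * l) / (2 ^ (2 * l) * fact l) = pochhammer (1/2 :: real) l"
    by (simp add: fact_double[of l])
  finally have "G (2 * l) = ennreal (P * norm \<xi> ^ (2 * l) * pochhammer (1/2) l)"
    using fin[of "2 * l"] ennreal_enn2real[of "G (2 * l)"] by simp
  then show ?thesis by (simp add: G_def P_def)
qed


text \<open>A substitute for polar coordinates: integrate \<open>(\<xi> \<bullet> y) ^ (2 * l) * (r
  - |y|^2) powr \<nu> * exp (-r)\<close> over the region \<open>|y|^2 < r\<close> in both orders.
  Integrating over \<open>r\<close> first leaves a Gaussian moment times
  \<open>Gamma (\<nu> + 1)\<close>; integrating over \<open>y\<close> first, after scaling by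
  \<open>sqrt r\<close>, leaves the ball integral times a Gamma value.\<close>

lemma ball_power_moment:
  fixes \<xi> :: "real ^ 'd"
  assumes "\<nu> > -1"
  shows "(\<integral>\<^sup>+y. ennreal (indicator (cball 0 1) y * ((\<xi> \<bullet> y) ^ (2 * l) * (1 - (norm y)\<^sup>2) powr \<nu>)) \<partial>lborel)
    = ennreal (sqrt pi ^ CARD('d) * norm \<xi> ^ (2 * l) * pochhammer (1/2) l
        * (Gamma (\<nu> + 1) / Gamma (real l + \<nu> + CARD('d) / 2 + 1)))"
proof -
  define J where "J = (\<integral>\<^sup>+y. ennreal (indicator (cball 0 1) y * ((\<xi> \<bullet> y) ^ (2 * l) * (1 - (norm y)\<^sup>2) powr \<nu>)) \<partial>lborel)"
  \<comment> \<open>\<open>s - 1\<close> collects \<open>l\<close> from the power,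
    \<open>\<nu>\<close> from the weight and half the dimension from the change of
    variables.\<close>
  define s where "s = real l + \<nu> + CARD('d) / 2 + 1"
  define g where "g r y = indicator {(norm y)\<^sup>2<..} r * ((\<xi> \<bullet> y) ^ (2 * l) * (r - (norm y)\<^sup>2) powr \<nu> * exp (- r))" for r y
  have "real CARD('d) > 0" by simp
  then have s: "s > 0" using assms of_nat_0_le_iff[of l] unfolding s_def by linarith
  have g_alt: "g = (\<lambda>r y. (if (norm y)\<^sup>2 < r then (\<xi> \<bullet> y) ^ (2 * l) * (r - (norm y)\<^sup>2) powr \<nu> * exp (- r) else 0))"
    by (auto simp: g_def fun_eq_iff)
  have gm: "(\<lambda>(r, y). ennreal (g r y)) \<in> borel_measurable (lborel \<Otimes>\<^sub>M lborel)"
    unfolding g_alt by measurable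
  have A: "(\<integral>\<^sup>+r. ennreal (g r y) \<partial>lborel) = ennreal ((\<xi> \<bullet> y) ^ (2 * l) * exp (- (norm y)\<^sup>2)) * ennreal (Gamma (\<nu> + 1))" for y
  proof -
    have "(\<integral>\<^sup>+r. ennreal (g r y) \<partial>lborel) = ennreal \<bar>1\<bar> * (\<integral>\<^sup>+r. ennreal (g ((norm y)\<^sup>2 + 1 * r) y) \<partial>lborel)"
      by (rule nn_integral_real_affine) (auto simp: g_alt)
    also have "\<dots> = (\<integral>\<^sup>+r. ennreal ((\<xi> \<bullet> y) ^ (2 * l) * exp (- (norm y)\<^sup>2)) * ennreal (indicator {0..} r * r powr (\<nu> + 1 - 1) / exp r) \<partial>lborel)"
      unfolding abs_one ennreal_1 mult_1
    proof (rule nn_integral_cong)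
      fix r
      have "g ((norm y)\<^sup>2 + r) y = ((\<xi> \<bullet> y) ^ (2 * l) * exp (- (norm y)\<^sup>2)) * (indicator {0..} r * r powr (\<nu> + 1 - 1) / exp r)"
        by (auto simp: g_alt exp_diff exp_minus field_simps indicator_def)
      then show "ennreal (g ((norm y)\<^sup>2 + r) y) = ennreal ((\<xi> \<bullet> y) ^ (2 * l) * exp (- (norm y)\<^sup>2)) * ennreal (indicator {0..} r * r powr (\<nu> + 1 - 1) / exp r)"
        by (simp only: ennreal_mult) (rule ennreal_mult, auto intro!: mult_nonneg_nonneg)
    qed
    also have "\<dots> = ennreal ((\<xi> \<bullet> y) ^ (2 * l) * exp (- (norm y)\<^sup>2)) * ennreal (Gamma (\<nu> + 1))"
      using assms by (subst nn_integral_cmult) (auto simp: Gamma_conv_nn_integral_real)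
    finally show ?thesis .
  qed
  have B: "(\<integral>\<^sup>+y. ennreal (g r y) \<partial>lborel) = ennreal (indicator {0..} r * r powr (s - 1) / exp r) * J" for r
  proof (cases "r > 0")
    case False
    have "\<not> (norm y)\<^sup>2 < r" for y :: "real ^ 'd" using False by (smt (verit) zero_le_power2)
    then have "g r y = 0" for y by (simp add: g_alt)
    then show ?thesis using False by (auto simp: indicator_def)
  next
    case True
    have "(\<integral>\<^sup>+y. ennreal (g r y) \<partial>lborel)
       = (\<integral>\<^sup>+y. ennreal (g r y) \<partial>(density (distr lborel borel (\<lambda>x. 0 + sqrt r *\<^sub>R x)) (\<lambda>_. \<bar>sqrt r\<bar> ^ DIM(real ^ 'd))))"
      using True by (subst lborel_affine[of "sqrt r" 0]) auto
    also have "\<dots> = (\<integral>\<^sup>+y. ennreal (\<bar>sqrt r\<bar> ^ CARD('d)) * ennreal (g r (sqrt r *\<^sub>R y)) \<partial>lborel)"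
      by (subst nn_integral_density, (simp add: g_alt)+, subst nn_integral_distr) (auto simp: g_alt)
    also have "\<dots> = (\<integral>\<^sup>+y. ennreal (r powr (s - 1) / exp r) * ennreal (indicator (cball 0 1) y * ((\<xi> \<bullet> y) ^ (2 * l) * (1 - (norm y)\<^sup>2) powr \<nu>)) \<partial>lborel)"
    proof (rule nn_integral_cong)
      fix y :: "real ^ 'd"
      have n: "(norm (sqrt r *\<^sub>R y))\<^sup>2 = r * (norm y)\<^sup>2" using True by (simp add: power_mult_distrib)
      have "\<bar>sqrt r\<bar> ^ CARD('d) * g r (sqrt r *\<^sub>R y)
        = r powr (s - 1) / exp r * (indicator (cball 0 1) y * ((\<xi> \<bullet> y) ^ (2 * l) * (1 - (norm y)\<^sup>2) powr \<nu>))"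
      proof (cases "norm y < 1")
        case y: True
        then have y2: "(norm y)\<^sup>2 < 1" by (simp add: power_less_one_iff abs_square_less_1)
        have "r - r * (norm y)\<^sup>2 = r * (1 - (norm y)\<^sup>2)" by (simp add: algebra_simps)
        then have p1: "(r - r * (norm y)\<^sup>2) powr \<nu> = r powr \<nu> * (1 - (norm y)\<^sup>2) powr \<nu>"
          using True y2 by (simp add: powr_mult)
        have p2: "\<bar>sqrt r\<bar> ^ CARD('d) = r powr (CARD('d) / 2)"
          using True by (simp add: powr_half_sqrt[symmetric] powr_realpow[symmetric] powr_powr)
        have p3: "(\<xi> \<bullet> sqrt r *\<^sub>R y) ^ (2 * l) = r powr l * (\<xi> \<bullet> y) ^ (2 * l)"
          using True by (simp add: power_mult_distrib power_mult powr_realpow)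
        have p4: "r powr (s - 1) = r powr (CARD('d) / 2) * (r powr l * r powr \<nu>)"
          by (simp add: s_def powr_add[symmetric] algebra_simps)
        show ?thesis unfolding g_alt n p1 p3 p2 p4
          using True y y2 by (simp add: p1 exp_minus field_simps)
      next
        case y: False
        then have "1 \<le> (norm y)\<^sup>2" by simp
        then have "\<not> r * (norm y)\<^sup>2 < r" using True by simp
        then have "g r (sqrt r *\<^sub>R y) = 0" unfolding g_alt n by simp
        moreover have "indicator (cball 0 1) y * (1 - (norm y)\<^sup>2) powr \<nu> = 0"
          using y by (auto simp: indicator_def)
        ultimately show ?thesis by auto
      qed
      then show "ennreal (\<bar>sqrt r\<bar> ^ CARD('d)) * ennreal (g r (sqrt r *\<^sub>R y))
        = ennreal (r powr (s - 1) / exp r) * ennreal (indicator (cball 0 1) y * ((\<xi> \<bullet> y) ^ (2 * l) * (1 - (norm y)\<^sup>2) powr \<nu>))"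
        by (simp only: ennreal_mult'[symmetric] zero_le_power abs_ge_zero divide_nonneg_nonneg powr_ge_zero exp_ge_zero)
    qed
    also have "\<dots> = ennreal (r powr (s - 1) / exp r) * J"
      unfolding J_def by (rule nn_integral_cmult) (auto simp: indicator_def[abs_def])
    finally show ?thesis using True by (simp add: indicator_def)
  qed
  have "ennreal (sqrt pi ^ CARD('d) * norm \<xi> ^ (2 * l) * pochhammer (1/2) l) * ennreal (Gamma (\<nu> + 1))
     = (\<integral>\<^sup>+y. \<integral>\<^sup>+r. ennreal (g r y) \<partial>lborel \<partial>lborel)"
    unfolding A by (subst nn_integral_multc) (auto simp: gauss_moment)
  also have "\<dots> = (\<integral>\<^sup>+r. \<integral>\<^sup>+y. ennreal (g r y) \<partial>lborel \<partial>lborel)"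
    using lborel_pair.Fubini'[of "\<lambda>r y. ennreal (g r y)"] gm by simp
  also have "\<dots> = ennreal (Gamma s) * J"
    unfolding B using s by (subst nn_integral_multc) (auto simp: Gamma_conv_nn_integral_real)
  finally have e: "ennreal (sqrt pi ^ CARD('d) * norm \<xi> ^ (2 * l) * pochhammer (1/2) l) * ennreal (Gamma (\<nu> + 1)) = ennreal (Gamma s) * J" .
  have Gp: "Gamma s > 0" "Gamma (\<nu> + 1) > 0" using s assms by (auto intro!: Gamma_real_pos)
  have "J = ennreal (1 / Gamma s) * (ennreal (Gamma s) * J)"
    using Gp by (simp add: mult.assoc[symmetric] ennreal_mult'[symmetric])
  also have "\<dots> = ennreal (sqrt pi ^ CARD('d) * norm \<xi> ^ (2 * l) * pochhammer (1/2) l * (Gamma (\<nu> + 1) / Gamma s))"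
    unfolding e[symmetric] using Gp
    by (simp add: ennreal_mult'[symmetric] ennreal_mult''[symmetric] mult_ac pochhammer_nonneg)
  finally show ?thesis unfolding J_def s_def .
qed

section \<open>The normalised ball measure\<close>

definition ball_density :: "real \<Rightarrow> real ^ 'd \<Rightarrow> real"
  where "ball_density \<mu> y = ball_const TYPE('d) \<mu> * (indicator (cball 0 1) y * ball_weight \<mu> y)"

definition ball_measure :: "real \<Rightarrow> (real ^ 'd) measure"
  where "ball_measure \<mu> = density lebesgue (\<lambda>y. ennreal (ball_density \<mu> y))"

lemma ball_weight_nonneg: "ball_weight \<mu> y \<ge> 0"
  by (simp add: ball_weight_def)

lemma ball_weight_measurable [measurable]: "ball_weight \<mu> \<in> borel_measurable borel"
  unfolding ball_weight_def[abs_def] by measurable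

text \<open>On the sphere both sides are 0 because \<open>0 powr a = 0\<close> for every exponent;
  this includes \<open>k = 0\<close>.\<close>

lemma ball_weight_power:
  "(1 - (norm y)\<^sup>2) ^ k * ball_weight \<mu> y = (1 - (norm y)\<^sup>2) powr (\<mu> - 1/2 + real k)" if "norm y \<le> 1"
proof (cases "norm y = 1")
  case False
  then have "(norm y)\<^sup>2 < 1" using that by (simp add: abs_square_less_1)
  then show ?thesis by (simp add: ball_weight_def powr_add powr_realpow)
qed (auto simp: ball_weight_def)

lemma ball_weight_moment:
  fixes \<xi> :: "real ^ 'd"
  assumes "\<mu> \<ge> 0"
  shows "has_bochner_integral lborel (\<lambda>y. indicator (cball 0 1) y * ((\<xi> \<bullet> y) ^ (2 * l) * (1 - (norm y)\<^sup>2) ^ k * ball_weight \<mu> y))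
     (sqrt pi ^ CARD('d) * norm \<xi> ^ (2 * l) * pochhammer (1/2) l
        * (Gamma (\<mu> + 1/2 + real k) / Gamma (\<mu> + (CARD('d) + 1) / 2 + real (k + l))))"
proof (rule has_bochner_integral_nn_integral)
  have "0 < \<mu> + (CARD('d) + 1) / 2 + real (k + l)"
  proof -
    have "real (CARD('d) + 1) / 2 > 0" "real (k + l) \<ge> 0" by simp_all
    then show ?thesis using assms by linarith
  qed
  moreover have "0 < \<mu> + 1/2 + real k"
  proof -
    have "real k \<ge> 0" by simp
    then show ?thesis using assms by linarith
  qed
  ultimately show "0 \<le> sqrt pi ^ CARD('d) * norm \<xi> ^ (2 * l) * pochhammer (1/2) l
        * (Gamma (\<mu> + 1/2 + real k) / Gamma (\<mu> + (CARD('d) + 1) / 2 + real (k + l)))"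
    by (intro mult_nonneg_nonneg divide_nonneg_nonneg less_imp_le[OF Gamma_real_pos] pochhammer_nonneg) auto
  have e: "indicator (cball 0 1) y * ((\<xi> \<bullet> y) ^ (2 * l) * (1 - (norm y)\<^sup>2) ^ k * ball_weight \<mu> y)
     = indicator (cball 0 1) y * ((\<xi> \<bullet> y) ^ (2 * l) * (1 - (norm y)\<^sup>2) powr (\<mu> - 1/2 + real k))" for y :: "real ^ 'd"
    using ball_weight_power[of y k \<mu>] by (auto simp: indicator_def mult.assoc)
  have g: "\<mu> - 1/2 + real k + 1 = \<mu> + 1/2 + real k"
    "real l + (\<mu> - 1/2 + real k) + CARD('d) / 2 + 1 = \<mu> + (CARD('d) + 1) / 2 + real (k + l)"
    by (simp_all add: field_simps)
  have "\<mu> - 1/2 + real k > -1" using assms by (smt (verit) of_nat_0_le_iff field_sum_of_halves)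
  from ball_power_moment[OF this, of \<xi> l]
  show "(\<integral>\<^sup>+y. ennreal (indicator (cball 0 1) y * ((\<xi> \<bullet> y) ^ (2 * l) * (1 - (norm y)\<^sup>2) ^ k * ball_weight \<mu> y)) \<partial>lborel)
    = ennreal (sqrt pi ^ CARD('d) * norm \<xi> ^ (2 * l) * pochhammer (1/2) l
        * (Gamma (\<mu> + 1/2 + real k) / Gamma (\<mu> + (CARD('d) + 1) / 2 + real (k + l))))"
    unfolding e g .
qed (auto intro!: AE_I2 mult_nonneg_nonneg simp: indicator_def power_le_one ball_weight_nonneg)

lemma ball_const_eq:
  assumes "\<mu> \<ge> 0"
  shows "ball_const TYPE('d::finite) \<mu>
    = Gamma (\<mu> + (CARD('d) + 1) / 2) / (sqrt pi ^ CARD('d) * Gamma (\<mu> + 1/2))"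
proof -
  have "(LINT x:(cball 0 1 :: (real ^ 'd) set)|lebesgue. ball_weight \<mu> x)
      = (LINT x|lborel. indicator (cball 0 1 :: (real ^ 'd) set) x * ball_weight \<mu> x)"
    unfolding set_lebesgue_integral_def real_scaleR_def
    by (intro integral_completion) (auto intro!: borel_measurable_times borel_measurable_indicator)
  also have "\<dots> = sqrt pi ^ CARD('d) * (Gamma (\<mu> + 1/2) / Gamma (\<mu> + (CARD('d) + 1) / 2))"
    using has_bochner_integral_integral_eq[OF ball_weight_moment[OF assms, of "0 :: real ^ 'd" 0 0]] by simp
  finally show ?thesis by (simp add: ball_const_def)
qed

lemma ball_const_pos: "\<mu> \<ge> 0 \<Longrightarrow> ball_const TYPE('d::finite) \<mu> > 0"
proof -
  assume "\<mu> \<ge> 0"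
  then have "0 < \<mu> + (CARD('d) + 1) / 2" "0 < \<mu> + 1/2" by (auto intro!: add_nonneg_pos)
  then show ?thesis using \<open>\<mu> \<ge> 0\<close> by (subst ball_const_eq) (auto intro!: divide_pos_pos mult_pos_pos)
qed

lemma ball_density_nonneg: "\<mu> \<ge> 0 \<Longrightarrow> ball_density \<mu> (y :: real ^ 'd) \<ge> 0"
  unfolding ball_density_def using ball_const_pos[of \<mu>, where 'd='d]
  by (intro mult_nonneg_nonneg ball_weight_nonneg) auto

lemma ball_density_measurable [measurable]: "ball_density \<mu> \<in> borel_measurable borel"
  unfolding ball_density_def[abs_def]
  by (intro borel_measurable_times borel_measurable_const borel_measurable_indicator ball_weight_measurable) auto

lemma sets_ball_measure [simp, measurable_cong]: "sets (ball_measure \<mu>) = sets lebesgue"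
  by (simp add: ball_measure_def)

lemma integrable_ball_measure:
  fixes f :: "real ^ 'd \<Rightarrow> real"
  assumes "\<mu> \<ge> 0" "f \<in> borel_measurable lebesgue"
  shows "integrable (ball_measure \<mu>) f \<longleftrightarrow> integrable lebesgue (\<lambda>y. ball_density \<mu> y * f y)"
  unfolding ball_measure_def using assms
  by (subst integrable_density) (auto simp: ball_density_nonneg measurable_completion)

lemma integral_ball_measure:
  fixes f :: "real ^ 'd \<Rightarrow> real"
  assumes "\<mu> \<ge> 0" "f \<in> borel_measurable lebesgue"
  shows "integral\<^sup>L (ball_measure \<mu>) f = integral\<^sup>L lebesgue (\<lambda>y. ball_density \<mu> y * f y)"
  unfolding ball_measure_def using assms
  by (subst integral_density) (auto simp: ball_density_nonneg measurable_completion)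

text \<open>After normalisation the quotients of Gamma values become Pochhammer symbols. The base
  \<open>\<mu> + (CARD('d) + 1) / 2\<close> is the Gegenbauer index plus one.\<close>

lemma ball_measure_moment:
  fixes \<xi> :: "real ^ 'd"
  assumes "\<mu> \<ge> 0"
  shows "has_bochner_integral (ball_measure \<mu>) (\<lambda>y. (\<xi> \<bullet> y) ^ (2 * l) * (1 - (norm y)\<^sup>2) ^ k)
     (norm \<xi> ^ (2 * l) * (pochhammer (1/2) l * pochhammer (\<mu> + 1/2) k / pochhammer (\<mu> + (CARD('d) + 1) / 2) (k + l)))"
proof -
  let ?f = "\<lambda>y. (\<xi> \<bullet> y) ^ (2 * l) * (1 - (norm y)\<^sup>2) ^ k"
  let ?c = "ball_const TYPE('d) \<mu>"
  let ?M = "sqrt pi ^ CARD('d) * norm \<xi> ^ (2 * l) * pochhammer (1/2) l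
        * (Gamma (\<mu> + 1/2 + real k) / Gamma (\<mu> + (CARD('d) + 1) / 2 + real (k + l)))"
  define A where "A = \<mu> + 1/2"
  define B where "B = \<mu> + (CARD('d) + 1) / 2"
  have p: "A > 0" "B > 0" using assms by (auto simp: A_def B_def intro!: add_nonneg_pos)
  have "has_bochner_integral lborel (\<lambda>y. ?c * (indicator (cball 0 1) y * (?f y * ball_weight \<mu> y))) (?c * ?M)"
    by (intro has_bochner_integral_mult_right ball_weight_moment assms)
  also have "(\<lambda>y. ?c * (indicator (cball 0 1) y * (?f y * ball_weight \<mu> y))) = (\<lambda>y. ball_density \<mu> y * ?f y)"
    by (auto simp: ball_density_def)
  finally have 1: "integrable lborel (\<lambda>y. ball_density \<mu> y * ?f y)" "integral\<^sup>L lborel (\<lambda>y. ball_density \<mu> y * ?f y) = ?c * ?M"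
    by (auto simp: has_bochner_integral_iff)
  have m: "?f \<in> borel_measurable borel" by measurable
  have "integrable (ball_measure \<mu>) ?f"
    using 1 m assms by (subst integrable_ball_measure) (auto simp: measurable_completion integrable_completion)
  moreover have "integral\<^sup>L (ball_measure \<mu>) ?f = ?c * ?M"
    using 1 m assms by (subst integral_ball_measure) (auto simp: measurable_completion integral_completion)
  moreover have "?c * ?M = norm \<xi> ^ (2 * l) * (pochhammer (1/2) l * pochhammer A k / pochhammer B (k + l))"
  proof -
    have pA: "pochhammer A k = Gamma (A + real k) / Gamma A"
      using p by (intro pochhammer_Gamma) (auto elim!: nonpos_Ints_cases)
    have pB: "pochhammer B (k + l) = Gamma (B + real (k + l)) / Gamma B"
      using p by (intro pochhammer_Gamma) (auto elim!: nonpos_Ints_cases)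
    have "Gamma (A + real k) > 0" "Gamma A > 0" "Gamma (B + real (k + l)) > 0" "Gamma B > 0"
      using p by (auto intro!: Gamma_real_pos add_pos_nonneg simp del: of_nat_add)
    then show ?thesis
      unfolding ball_const_eq[OF assms] A_def[symmetric] B_def[symmetric] pA pB by (simp add: field_simps)
  qed
  ultimately show ?thesis by (auto simp: has_bochner_integral_iff A_def B_def)
qed

lemma prob_space_ball_measure: "\<mu> \<ge> 0 \<Longrightarrow> prob_space (ball_measure \<mu> :: (real ^ 'd) measure)"
proof -
  assume mu: "\<mu> \<ge> 0"
  have i: "has_bochner_integral (ball_measure \<mu> :: (real ^ 'd) measure) (\<lambda>y. 1 :: real) 1"
    using ball_measure_moment[OF mu, of "0 :: real ^ 'd" 0 0] by simp
  then have "emeasure (ball_measure \<mu>) (space (ball_measure \<mu> :: (real ^ 'd) measure)) = 1"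
    using nn_integral_eq_integral[of "ball_measure \<mu> :: (real ^ 'd) measure" "\<lambda>_. 1"]
    by (auto simp: has_bochner_integral_iff)
  then show ?thesis by (rule prob_spaceI)
qed

lemma AE_ball_measure: "\<mu> \<ge> 0 \<Longrightarrow> AE y in ball_measure \<mu>. norm (y :: real ^ 'd) \<le> 1"
  unfolding ball_measure_def
  by (subst AE_density) (auto intro!: AE_I2 simp: ball_density_def indicator_def measurable_completion split: if_splits)

lemma integrable_ball_continuous:
  fixes f :: "real ^ 'd \<Rightarrow> real"
  assumes "\<mu> \<ge> 0" "continuous_on UNIV f"
  shows "integrable (ball_measure \<mu>) f"
proof -
  interpret prob_space "ball_measure \<mu> :: (real ^ 'd) measure" by (rule prob_space_ball_measure[OF assms(1)])
  have "compact (f ` cball 0 1)"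
    by (rule compact_continuous_image[OF continuous_on_subset[OF assms(2)]]) auto
  then obtain B where B: "\<And>x. x \<in> cball 0 1 \<Longrightarrow> norm (f x) \<le> B"
    using compact_imp_bounded bounded_iff by (metis imageI)
  have fm: "f \<in> borel_measurable (ball_measure \<mu>)"
  proof -
    have "f \<in> borel_measurable borel" using assms(2) by (rule borel_measurable_continuous_onI)
    then show ?thesis by (simp add: measurable_completion cong: measurable_cong_sets)
  qed
  show ?thesis
    by (rule integrable_const_bound[where B=B]) (use AE_ball_measure[OF assms(1), where 'd='d] B fm in auto)
qed

lemma ball_measure_odd:
  fixes f :: "real ^ 'd \<Rightarrow> real"
  assumes "\<mu> \<ge> 0" "continuous_on UNIV f" "\<And>y. f (- y) = - f y"
  shows "integral\<^sup>L (ball_measure \<mu>) f = 0"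
proof -
  have fm[measurable]: "f \<in> borel_measurable borel" using assms(2) by (rule borel_measurable_continuous_onI)
  have "integral\<^sup>L (ball_measure \<mu>) f = integral\<^sup>L lborel (\<lambda>y. ball_density \<mu> y * f y)"
    using fm assms by (subst integral_ball_measure) (auto simp: measurable_completion integral_completion)
  also have "lborel = distr lborel borel (uminus :: real ^ 'd \<Rightarrow> real ^ 'd)"
    by (subst lborel_affine[of "-1" 0]) (auto simp: density_1 one_ennreal_def[symmetric])
  also have "integral\<^sup>L \<dots> (\<lambda>y. ball_density \<mu> y * f y) = integral\<^sup>L lborel (\<lambda>y. - (ball_density \<mu> y * f y))"
    by (subst integral_distr) (auto simp: ball_density_def ball_weight_def indicator_def assms(3) intro!: Bochner_Integration.integral_cong)
  also have "\<dots> = - integral\<^sup>L lborel (\<lambda>y. ball_density \<mu> y * f y)" by simp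
  also have "integral\<^sup>L lborel (\<lambda>y. ball_density \<mu> y * f y) = integral\<^sup>L (ball_measure \<mu>) f"
    using fm assms by (subst integral_ball_measure) (auto simp: measurable_completion integral_completion)
  finally show ?thesis by simp
qed

section \<open>Gegenbauer polynomials of two correlated variables\<close>

text \<open>Multiplication by the variable removes the exceptional point. The moment conditions
  below are given for \<open>t \<noteq> 0\<close> only.\<close>

lemma poly_eq_iff_nonzero:
  fixes p q :: "real poly"
  assumes "\<And>t. t \<noteq> 0 \<Longrightarrow> poly p t = poly q t"
  shows "p = q"
proof -
  have "poly ([:0, 1:] * p) t = poly ([:0, 1:] * q) t" for t
    using assms[of t] by (cases "t = 0") auto
  then have "[:0, 1:] * p = [:0, 1:] * q" by (simp only: poly_eq_poly_eq_iff[symmetric]) auto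
  then show ?thesis by simp
qed

lemma pderiv_geg_rec:
  assumes "l > 0"
  shows "(real j + 2 * l) * poly (pderiv (geg l (Suc j))) t
    = 2 * (real j + l) * (poly (geg l j) t + t * poly (pderiv (geg l j)) t) - real j * poly (pderiv (geg l (j - 1))) t"
proof -
  have e: "smult (real j + 2 * l) (geg l (Suc j)) = smult (2 * (real j + l)) ([:0, 1:] * geg l j) - smult (real j) (geg l (j - 1))"
    using geg_rec[OF assms, of j] by (simp add: poly_eq_poly_eq_iff[symmetric] fun_eq_iff mult.assoc)
  have "poly (pderiv (smult (real j + 2 * l) (geg l (Suc j)))) t
     = poly (pderiv (smult (2 * (real j + l)) ([:0, 1:] * geg l j) - smult (real j) (geg l (j - 1)))) t"
    unfolding e ..
  then show ?thesis
    by (simp add: pderiv_smult pderiv_diff pderiv_mult pderiv_pCons algebra_simps del: mult_pCons_left)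
qed

text \<open>The differentiated recurrence expresses the derivative by those at the two preceding
  indices. At the older one the claim is first rewritten by the recurrence into a raising relation,
  \<open>u * D k = (k + 2 * l) * (t * R k - R (Suc k))\<close>, after which the step is pure
  elimination.\<close>

lemma geg_deriv_lower:
  assumes "l > 0"
  shows "(1 - t\<^sup>2) * poly (pderiv (geg l j)) t = real j * (poly (geg l (j - 1)) t - t * poly (geg l j) t)"
proof (induction j rule: less_induct)
  case (less j)
  show ?case
  proof (cases j)
    case (Suc i)
    define R where "R = (\<lambda>j. poly (geg l j) t)"
    define D where "D = (\<lambda>j. poly (pderiv (geg l j)) t)"
    define u where "u = 1 - t\<^sup>2"
    define x where "x = real i"
    have x0: "x + 2 * l \<noteq> 0" using assms by (simp add: x_def add_nonneg_eq_0_iff)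
    have rec: "(x + 2 * l) * R (Suc i) = 2 * (x + l) * t * R i - x * R (i - 1)"
      using geg_rec[OF assms, of i t] by (simp add: R_def x_def)
    have drec: "(x + 2 * l) * D (Suc i) = 2 * (x + l) * (R i + t * D i) - x * D (i - 1)"
      using pderiv_geg_rec[OF assms, of i t] by (simp add: R_def D_def x_def)
    have S1: "u * D i = x * (R (i - 1) - t * R i)"
      using less[of i] Suc by (simp add: R_def D_def u_def x_def)
    \<comment> \<open>The factor \<open>x\<close> is kept because for \<open>i = 0\<close> the index
      \<open>i - 1\<close> truncates to 0.\<close>
    have S2: "x * (u * D (i - 1)) = x * ((x - 1 + 2 * l) * (t * R (i - 1) - R i))"
    proof (cases i)
      case (Suc k)
      have "u * D k = real k * (R (k - 1) - t * R k)"
        using less[of k] Suc \<open>j = Suc i\<close> by (simp add: R_def D_def u_def)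
      moreover have "(real k + 2 * l) * R (Suc k) = 2 * (real k + l) * t * R k - real k * R (k - 1)"
        using geg_rec[OF assms, of k t] by (simp add: R_def)
      ultimately have "u * D k = (real k + 2 * l) * (t * R k - R (Suc k))" by (simp add: algebra_simps)
      then show ?thesis using Suc by (simp add: x_def)
    qed (simp add: x_def)
    have "(x + 2 * l) * (u * D (Suc i)) = (x + 2 * l) * ((x + 1) * (R i - t * R (Suc i)))"
      using rec drec S1 S2 unfolding u_def by algebra
    then have "u * D (Suc i) = (x + 1) * (R i - t * R (Suc i))" using x0 by simp
    then show ?thesis using Suc by (simp add: R_def D_def u_def x_def add.commute)
  qed simp
qed

text \<open>Differentiating the lowering relation and eliminating with the raising relation gives
  the equation multiplied by \<open>1 - t^2\<close>; this factor is cancelled in the polynomial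
  ring.\<close>

lemma geg_ode:
  assumes "l > 0"
  shows "[:1, 0, -1:] * pderiv (pderiv (geg l j)) - [:0, 2 * l + 1:] * pderiv (geg l j) + smult (real j * (real j + 2 * l)) (geg l j) = 0"
    (is "?O = 0")
proof (cases j)
  case (Suc i)
  have "[:1, 0, -1:] * ?O = 0"
  proof (rule poly_eq_iff_nonzero)
    fix t :: real
    define R where "R = (\<lambda>j. poly (geg l j) t)"
    define D where "D = (\<lambda>j. poly (pderiv (geg l j)) t)"
    define DD where "DD = poly (pderiv (pderiv (geg l j))) t"
    define u where "u = 1 - t\<^sup>2"
    define x where "x = real i"
    have "[:1, 0, -1:] * pderiv (geg l j) = smult (real j) (geg l (j - 1) - [:0, 1:] * geg l j)"
      using geg_deriv_lower[OF assms, of _ j]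
      by (simp add: poly_eq_poly_eq_iff[symmetric] fun_eq_iff power2_eq_square algebra_simps)
    then have "poly (pderiv ([:1, 0, -1:] * pderiv (geg l j))) t = poly (pderiv (smult (real j) (geg l (j - 1) - [:0, 1:] * geg l j))) t"
      by simp
    then have d: "u * DD - 2 * t * D j = (x + 1) * (D i - R j - t * D j)"
      unfolding pderiv_mult pderiv_smult pderiv_diff
      by (simp add: pderiv_pCons algebra_simps power2_eq_square Suc R_def D_def DD_def u_def x_def)
    have S1: "u * D j = (x + 1) * (R i - t * R j)"
      using geg_deriv_lower[OF assms, of t j] Suc by (simp add: R_def D_def u_def x_def add.commute)
    have S2: "u * D i = (x + 2 * l) * (t * R i - R j)"
    proof -
      have "u * D i = x * (R (i - 1) - t * R i)"
        using geg_deriv_lower[OF assms, of t i] by (simp add: R_def D_def u_def x_def)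
      moreover have "(x + 2 * l) * R j = 2 * (x + l) * t * R i - x * R (i - 1)"
        using geg_rec[OF assms, of i t] Suc by (simp add: R_def x_def)
      ultimately show ?thesis by (simp add: algebra_simps)
    qed
    have "u * (u * DD - (2 * l + 1) * t * D j + (x + 1) * (x + 1 + 2 * l) * R j) = 0"
      using d S1 S2 unfolding u_def by algebra
    then show "poly ([:1, 0, -1:] * ?O) t = poly 0 t"
      by (simp add: Suc R_def D_def DD_def u_def x_def power2_eq_square algebra_simps)
  qed
  then have "[:1, 0, -1 :: real:] = 0 \<or> ?O = 0" by (simp only: mult_eq_0_iff)
  then show ?thesis by simp
qed simp

text \<open>The Gegenbauer operator maps the power \<open>i\<close> to \<open>i * (i - 1)\<close>
  times the power \<open>i - 2\<close> minus \<open>i * (i + 2 * l)\<close> times itself. In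
  coefficient form the eigenvalue equation can be applied to moments, where there is no function to
  differentiate.\<close>

lemma coeff_geg_ode:
  assumes "l > 0"
  shows "real (i + 2) * real (i + 1) * coeff (geg l j) (i + 2) - real i * (real i + 2 * l) * coeff (geg l j) i
    = - (real j * (real j + 2 * l)) * coeff (geg l j) i"
proof -
  have "coeff ([:1, 0, -1:] * pderiv (pderiv (geg l j)) - [:0, 2 * l + 1:] * pderiv (geg l j) + smult (real j * (real j + 2 * l)) (geg l j)) i = 0"
    unfolding geg_ode[OF assms] by simp
  then show ?thesis
    by (cases i; cases "i - 1") (auto simp: coeff_pderiv algebra_simps coeff_pCons split: nat.splits)
qed

lemma geg_basis:
  assumes "l > 0" "degree p \<le> m"
  shows "\<exists>c. p = (\<Sum>i\<le>m. smult (c i) (geg l i))"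
  using assms(2)
proof (induction m arbitrary: p)
  case 0
  then have "p = [:coeff p 0:]" by (simp add: degree_0_id)
  then show ?case by (intro exI[of _ "\<lambda>_. coeff p 0"]) (simp add: one_pCons)
next
  case (Suc m)
  have lead: "coeff (geg l j) j > 0" for j
    using assms(1)
  proof (induction l j rule: geg.induct)
    case (3 l j)
    have "coeff (geg l j) (Suc (Suc j)) = 0" using degree_geg[of l j] by (intro coeff_eq_0) auto
    then show ?case using 3 by (auto intro!: divide_pos_pos mult_pos_pos add_nonneg_pos)
  qed auto
  define a where "a = coeff p (Suc m) / coeff (geg l (Suc m)) (Suc m)"
  have "degree (p - smult a (geg l (Suc m))) \<le> Suc m"
    using Suc.prems degree_geg[of l "Suc m"] by (intro degree_diff_le order.trans[OF degree_smult_le])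
  moreover have "coeff (p - smult a (geg l (Suc m))) (Suc m) = 0"
    using lead[of "Suc m"] by (simp add: a_def)
  ultimately have "coeff (p - smult a (geg l (Suc m))) i = 0" if "i > m" for i
  proof (cases "i = Suc m")
    case False
    then have "degree (p - smult a (geg l (Suc m))) < i"
      using \<open>degree (p - smult a (geg l (Suc m))) \<le> Suc m\<close> that by linarith
    then show ?thesis by (rule coeff_eq_0)
  qed simp
  then have "degree (p - smult a (geg l (Suc m))) \<le> m"
    by (intro degree_le) blast
  then obtain c where "p - smult a (geg l (Suc m)) = (\<Sum>i\<le>m. smult (c i) (geg l i))"
    using Suc.IH by blast
  then have "p = (\<Sum>i\<le>Suc m. smult ((c(Suc m := a)) i) (geg l i))"
    by (simp add: diff_eq_eq)
  then show ?case by blast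
qed

text \<open>The moments of the probability density proportional to
  \<open>(1 - t^2) powr (l - 1/2)\<close> on \<open>[-1, 1]\<close>, the orthogonality weight of
  \<open>geg l\<close>.\<close>

definition mom :: "real \<Rightarrow> nat \<Rightarrow> real"
  where "mom l N = (if even N then pochhammer (1/2) (N div 2) / pochhammer (l + 1) (N div 2) else 0)"

text \<open>\<open>F p q\<close> is to behave like the mean of \<open>X^p * Y^q\<close>, where
  \<open>X\<close> and \<open>Y\<close> are the components of a rotation invariant vector along unit
  vectors with inner product \<open>\<rho>\<close>. The left side is then the mean of
  \<open>(X + t * Y)^N\<close>, and \<open>1 + 2 * t * \<rho> + t^2\<close> is the squared length of
  the combined direction. No range is prescribed for \<open>\<rho>\<close>. Leaving out
  \<open>t = 0\<close> makes the condition symmetric under replacing \<open>t\<close> by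
  \<open>1 / t\<close>.\<close>

definition pair_moments :: "real \<Rightarrow> real \<Rightarrow> (nat \<Rightarrow> nat \<Rightarrow> real) \<Rightarrow> bool"
  where "pair_moments l \<rho> F \<longleftrightarrow> (\<forall>N t. t \<noteq> 0 \<longrightarrow>
    (\<Sum>q\<le>N. real (N choose q) * t ^ q * F (N - q) q) = mom l N * (1 + 2 * t * \<rho> + t\<^sup>2) ^ (N div 2))"

lemma pair_moments_sym:
  assumes "pair_moments l \<rho> F"
  shows "pair_moments l \<rho> (\<lambda>p q. F q p)"
  unfolding pair_moments_def
proof (intro allI impI)
  fix N and t :: real assume t: "t \<noteq> 0"
  have "(\<Sum>q\<le>N. real (N choose q) * t ^ q * F q (N - q)) = (\<Sum>q\<le>N. real (N choose q) * t ^ (N - q) * F (N - q) q)"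
    by (rule sum.reindex_bij_witness[of _ "\<lambda>q. N - q" "\<lambda>q. N - q"]) (auto simp: binomial_symmetric[symmetric])
  also have "\<dots> = t ^ N * (\<Sum>q\<le>N. real (N choose q) * (1 / t) ^ q * F (N - q) q)"
    unfolding sum_distrib_left using t by (intro sum.cong) (simp_all add: power_diff power_one_over)
  also have "(\<Sum>q\<le>N. real (N choose q) * (1 / t) ^ q * F (N - q) q) = mom l N * (1 + 2 * (1 / t) * \<rho> + (1 / t)\<^sup>2) ^ (N div 2)"
    using assms[unfolded pair_moments_def, rule_format, of "1 / t" N] t by simp
  also have "t ^ N * (mom l N * (1 + 2 * (1 / t) * \<rho> + (1 / t)\<^sup>2) ^ (N div 2)) = mom l N * (1 + 2 * t * \<rho> + t\<^sup>2) ^ (N div 2)"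
  proof (cases "even N")
    case True
    then have 1: "t ^ N = (t\<^sup>2) ^ (N div 2)" by (simp add: power_mult[symmetric])
    have 2: "t\<^sup>2 * (1 + 2 * (1 / t) * \<rho> + (1 / t)\<^sup>2) = 1 + 2 * t * \<rho> + t\<^sup>2"
      using t by (simp add: field_simps power2_eq_square)
    have 3: "(t\<^sup>2) ^ k * (m * Y ^ k) = m * (t\<^sup>2 * Y) ^ k" for m Y :: real and k
      by (simp add: power_mult_distrib)
    show ?thesis unfolding 1 3 2 ..
  qed (simp add: mom_def)
  finally show "(\<Sum>q\<le>N. real (N choose q) * t ^ q * F q (N - q)) = mom l N * (1 + 2 * t * \<rho> + t\<^sup>2) ^ (N div 2)" .
qed

lemma mom_Suc_Suc:
  assumes "l > 0"
  shows "(real N + 2 + 2 * l) * mom l (Suc (Suc N)) = (real N + 1) * mom l N"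
proof (cases "even N")
  case True
  then obtain n where n: "N = 2 * n" by (elim evenE)
  have p: "pochhammer (l + 1) n > 0" using assms by (intro pochhammer_pos) auto
  have s: "l + 1 + real n \<noteq> 0" using assms by (simp add: add_nonneg_eq_0_iff)
  have "mom l (Suc (Suc N)) = mom l N * ((1/2 + real n) / (l + 1 + real n))"
    by (simp add: mom_def n pochhammer_Suc)
  moreover have "(2 * s) * (M * (x / s)) = 2 * x * M" if "s \<noteq> 0" for s x M :: real
    using that by simp
  moreover have "real N + 2 + 2 * l = 2 * (l + 1 + real n)" "real N + 1 = 2 * (1/2 + real n)"
    by (simp_all add: n)
  ultimately show ?thesis using s by metis
qed (simp add: mom_def)

text \<open>A discrete integration by parts. For even \<open>N\<close> the generating polynomial of
  total degree \<open>N + 2\<close> is a multiple of a power of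
  \<open>1 + 2 * t * \<rho> + t^2\<close>, so its derivative in \<open>t\<close> is a multiple of
  \<open>\<rho> + t\<close> times the generating polynomial of degree \<open>N\<close>; for odd
  \<open>N\<close> both vanish. The claim compares coefficients.\<close>

lemma pair_moments_rec_right:
  assumes "l > 0" "pair_moments l \<rho> F"
  shows "(real p + real q + 1 + 2 * l) * F p (Suc q) = real q * F p (q - 1) + real p * \<rho> * F (p - 1) q"
proof -
  define PF where "PF N = (\<Sum>q\<le>N. monom (real (N choose q) * F (N - q) q) q)" for N
  have PF: "PF N = smult (mom l N) ([:1, 2 * \<rho>, 1:] ^ (N div 2))" for N
  proof (rule poly_eq_iff_nonzero)
    fix t :: real assume t: "t \<noteq> 0"
    have "poly (PF N) t = (\<Sum>q\<le>N. real (N choose q) * t ^ q * F (N - q) q)"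
      by (simp add: PF_def poly_sum poly_monom mult_ac)
    also have "\<dots> = mom l N * (1 + 2 * t * \<rho> + t\<^sup>2) ^ (N div 2)"
      using assms(2) t unfolding pair_moments_def by blast
    finally show "poly (PF N) t = poly (smult (mom l N) ([:1, 2 * \<rho>, 1:] ^ (N div 2))) t"
      by (simp add: poly_power algebra_simps power2_eq_square)
  qed
  have co: "coeff (PF N) q = real (N choose q) * F (N - q) q" for N q
    by (simp add: PF_def coeff_sum if_distrib sum.delta cong: if_cong)
  have der: "smult (real N + 2 + 2 * l) (pderiv (PF (Suc (Suc N)))) = smult ((real N + 2) * (real N + 1)) ([:\<rho>, 1:] * PF N)" for N
  proof (cases "even N")
    case True
    then obtain n where n: "N = 2 * n" by (elim evenE)
    have d: "pderiv [:1, 2 * \<rho>, 1:] = [:2 * \<rho>, 2:]" by (simp add: pderiv_pCons)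
    have "PF (Suc (Suc N)) = smult (mom l (Suc (Suc N))) ([:1, 2 * \<rho>, 1:] ^ Suc n)"
      unfolding PF by (simp add: n)
    then have "pderiv (PF (Suc (Suc N))) = smult (mom l (Suc (Suc N)) * (real n + 1)) ([:1, 2 * \<rho>, 1:] ^ n * [:2 * \<rho>, 2:])"
      by (simp only: pderiv_smult pderiv_power_Suc d mult_smult_left smult_smult of_nat_Suc add.commute)
    also have "[:2 * \<rho>, 2:] = smult 2 [:\<rho>, 1:]" by simp
    finally have pd: "pderiv (PF (Suc (Suc N))) = smult (mom l (Suc (Suc N)) * (real n + 1)) ([:1, 2 * \<rho>, 1:] ^ n * smult 2 [:\<rho>, 1:])" .
    have "smult (real N + 2 + 2 * l) (pderiv (PF (Suc (Suc N))))
      = smult ((real N + 2 + 2 * l) * mom l (Suc (Suc N)) * (real n + 1) * 2) ([:\<rho>, 1:] * [:1, 2 * \<rho>, 1:] ^ n)"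
    proof -
      have "smult a (smult (b * c) (X * smult 2 Y)) = smult (a * b * c * 2) (Y * X)" for a b c :: real and X Y
        by (simp add: mult.commute[of Y X] mult.assoc)
      then show ?thesis unfolding pd by blast
    qed
    also have "(real N + 2 + 2 * l) * mom l (Suc (Suc N)) * (real n + 1) * 2 = (real N + 2) * (real N + 1) * mom l N"
      unfolding mom_Suc_Suc[OF assms(1)] by (simp add: n algebra_simps)
    finally show ?thesis unfolding PF by (simp only: n mult_smult_right smult_smult nonzero_mult_div_cancel_left zero_neq_numeral[symmetric] not_False_eq_True)
  qed (simp add: PF mom_def)
  show ?thesis
  proof (cases "p + q")
    \<comment> \<open>Here the claim is that a first moment vanishes.\<close>
    case 0
    have "PF 1 = 0" by (simp add: PF mom_def)
    then have "coeff (PF 1) 1 = 0" by simp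
    then show ?thesis using 0 by (simp add: co)
  next
    case (Suc N)
    have c: "coeff (smult (real N + 2 + 2 * l) (pderiv (PF (Suc (Suc N))))) q = coeff (smult ((real N + 2) * (real N + 1)) ([:\<rho>, 1:] * PF N)) q"
      unfolding der ..
    have Nq: "Suc N - q = p" "N - q = p - 1" "q \<le> Suc N" using Suc by auto
    have b1: "real (Suc q) * real (Suc (Suc N) choose Suc q) = (real N + 2) * real (Suc N choose q)"
      using arg_cong[OF Suc_times_binomial[of q "Suc N"], of real]
      by (simp only: of_nat_mult of_nat_Suc) (simp add: add.commute del: binomial_Suc_Suc)
    have b2: "(real N + 1) * real (N choose q) = real p * real (Suc N choose q)"
    proof -
      have "real (p * (Suc N choose q)) = real (Suc N * (N choose q))"
        using binomial_absorb_comp[of "Suc N" q] Nq by (simp del: binomial_Suc_Suc)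
      then show ?thesis by (simp only: of_nat_mult of_nat_Suc) (simp add: add.commute del: binomial_Suc_Suc)
    qed
    have b3: "(real N + 1) * real (N choose (q - 1)) = real q * real (Suc N choose q)" if "q > 0"
    proof -
      have "real (q * (Suc N choose q)) = real (Suc N * (N choose (q - 1)))"
        using binomial_absorption[of "q - 1" "Suc N"] that by (simp del: binomial_Suc_Suc)
      then show ?thesis by (simp only: of_nat_mult of_nat_Suc) (simp add: add.commute del: binomial_Suc_Suc)
    qed
    have b0: "real (Suc N choose q) > 0" using Nq by simp
    have L: "coeff (smult (real N + 2 + 2 * l) (pderiv (PF (Suc (Suc N))))) q
       = (real N + 2 + 2 * l) * ((real N + 2) * real (Suc N choose q)) * F p (Suc q)"
      using Nq b1 by (simp add: coeff_pderiv co del: binomial_Suc_Suc)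
    have Rr: "coeff (smult ((real N + 2) * (real N + 1)) ([:\<rho>, 1:] * PF N)) q
       = (real N + 2) * real (Suc N choose q) * (real p * \<rho> * F (p - 1) q + real q * F p (q - 1))"
    proof (cases q)
      case 0
      then show ?thesis using b2 Nq by (simp add: co algebra_simps del: binomial_Suc_Suc)
    next
      case (Suc r)
      have "N - r = p" using Nq Suc by auto
      have "coeff (smult ((real N + 2) * (real N + 1)) ([:\<rho>, 1:] * PF N)) q
        = (real N + 2) * (\<rho> * F (p - 1) q * ((real N + 1) * real (N choose q)) + F p r * ((real N + 1) * real (N choose r)))"
        using Suc \<open>N - r = p\<close> Nq by (simp add: co algebra_simps del: binomial_Suc_Suc)
      also have "\<dots> = (real N + 2) * (\<rho> * F (p - 1) q * (real p * real (Suc N choose q)) + F p r * (real q * real (Suc N choose q)))"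
        using b2 b3 Suc by simp
      finally show ?thesis using Suc by (simp add: algebra_simps del: binomial_Suc_Suc)
    qed
    have "(real N + 2) * real (Suc N choose q) * ((real N + 2 + 2 * l) * F p (Suc q))
       = (real N + 2) * real (Suc N choose q) * (real p * \<rho> * F (p - 1) q + real q * F p (q - 1))"
      using c unfolding L Rr by (simp add: mult_ac del: binomial_Suc_Suc)
    moreover have "(real N + 2) * real (Suc N choose q) \<noteq> 0" using b0 by (simp del: binomial_Suc_Suc)
    ultimately have "(real N + 2 + 2 * l) * F p (Suc q) = real p * \<rho> * F (p - 1) q + real q * F p (q - 1)"
      by (metis mult_left_cancel)
    moreover have "real p + real q + 1 = real N + 2" using Suc by (simp flip: of_nat_add)
    ultimately show ?thesis by (simp add: add_ac)
  qed
qed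

text \<open>By the recursion each side equals
  \<open>p * q * (F p q - \<rho> * F (p - 1) (q - 1))\<close>, which is symmetric in the two
  variables. This is self-adjointness of the Gegenbauer operator at the level of moments. Truncation
  in \<open>p - 2\<close> is harmless since \<open>p * (p - 1)\<close> vanishes for
  \<open>p < 2\<close>.\<close>

lemma pair_moments_symmetric_op:
  assumes "l > 0" "pair_moments l \<rho> F"
  shows "real p * (real p - 1) * F (p - 2) q - real p * (real p + 2 * l) * F p q
    = real q * (real q - 1) * F p (q - 2) - real q * (real q + 2 * l) * F p q"
proof -
  have *: "real p * (real p - 1) * F (p - 2) q - real p * (real p + 2 * l) * F p q
    = real p * real q * F p q - real p * real q * \<rho> * F (p - 1) (q - 1)"
    if "pair_moments l \<rho> F" for F p q
  proof (cases p)
    case (Suc r)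
    have "(real r + real q + 1 + 2 * l) * F (Suc r) q = real r * F (r - 1) q + real q * \<rho> * F r (q - 1)"
      using pair_moments_rec_right[OF assms(1) pair_moments_sym[OF that], of q r] by (simp add: add_ac)
    then have "real p * ((real r + real q + 1 + 2 * l) * F (Suc r) q) = real p * (real r * F (r - 1) q + real q * \<rho> * F r (q - 1))"
      by simp
    then show ?thesis using Suc by (simp add: algebra_simps)
  qed simp
  show ?thesis
    using *[OF assms(2), of p q] *[OF pair_moments_sym[OF assms(2)], of q p] by (simp add: mult_ac)
qed

lemma sum_shift2:
  fixes a c :: "nat \<Rightarrow> real"
  assumes "a (Suc M) = 0" "a (Suc (Suc M)) = 0"
  shows "(\<Sum>p\<le>M. a p * (real p * (real p - 1) * c (p - 2))) = (\<Sum>p\<le>M. real (p + 2) * real (p + 1) * a (p + 2) * c p)"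
proof -
  have "(\<Sum>p\<le>M. a p * (real p * (real p - 1) * c (p - 2))) = (\<Sum>p\<le>Suc (Suc M). a p * (real p * (real p - 1) * c (p - 2)))"
    using assms by simp
  also have "\<dots> = (\<Sum>p\<le>M. real (p + 2) * real (p + 1) * a (p + 2) * c p)"
    unfolding sum.atMost_Suc_shift by (simp add: mult_ac)
  finally show ?thesis .
qed

text \<open>The usual argument for eigenfunctions of a symmetric operator: moving the operator from
  one variable to the other exchanges the eigenvalues \<open>-i * (i + 2 * l)\<close> and
  \<open>-j * (j + 2 * l)\<close>, whose difference has the factors \<open>i - j\<close> and
  \<open>i + j + 2 * l\<close>.\<close>

lemma geg_pair_orthogonal:
  assumes l: "l > 0" and F: "pair_moments l \<rho> F" and "i \<noteq> j"
  shows "(\<Sum>p\<le>i. \<Sum>q\<le>j. coeff (geg l i) p * coeff (geg l j) q * F p q) = 0"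
proof -
  define M where "M = i + j"
  define a where "a = coeff (geg l i)"
  define b where "b = coeff (geg l j)"
  have a0: "a p = 0" if "p > i" for p unfolding a_def using degree_geg[of l i] that by (intro coeff_eq_0) auto
  have b0: "b p = 0" if "p > j" for p unfolding b_def using degree_geg[of l j] that by (intro coeff_eq_0) auto
  define S where "S = (\<Sum>p\<le>M. \<Sum>q\<le>M. a p * b q * F p q)"
  have step: "(\<Sum>p\<le>M. c p * (real p * (real p - 1) * G (p - 2) - real p * (real p + 2 * l) * G p))
      = - (real m * (real m + 2 * l)) * (\<Sum>p\<le>M. c p * G p)"
    if "c = coeff (geg l m)" "m \<le> M" for c m and G :: "nat \<Rightarrow> real"
  proof -
    have c0: "c p = 0" if "p > M" for p
      unfolding \<open>c = _\<close> using degree_geg[of l m] \<open>m \<le> M\<close> that by (intro coeff_eq_0) auto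
    have "(\<Sum>p\<le>M. c p * (real p * (real p - 1) * G (p - 2) - real p * (real p + 2 * l) * G p))
      = (\<Sum>p\<le>M. c p * (real p * (real p - 1) * G (p - 2))) - (\<Sum>p\<le>M. c p * (real p * (real p + 2 * l) * G p))"
      by (simp add: right_diff_distrib sum_subtractf)
    also have "\<dots> = (\<Sum>p\<le>M. (real (p + 2) * real (p + 1) * c (p + 2) - real p * (real p + 2 * l) * c p) * G p)"
      unfolding sum_shift2[of c M G, OF c0 c0, simplified] sum_subtractf[symmetric]
      by (intro sum.cong) (simp_all add: algebra_simps)
    also have "\<dots> = - (real m * (real m + 2 * l)) * (\<Sum>p\<le>M. c p * G p)"
      unfolding \<open>c = _\<close> coeff_geg_ode[OF l] by (simp add: sum_distrib_left mult_ac)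
    finally show ?thesis .
  qed
  have "- (real i * (real i + 2 * l)) * S = (\<Sum>q\<le>M. b q * (- (real i * (real i + 2 * l)) * (\<Sum>p\<le>M. a p * F p q)))"
    unfolding S_def by (subst sum.swap) (simp add: sum_distrib_left sum_negf mult_ac)
  also have "\<dots> = (\<Sum>q\<le>M. b q * (\<Sum>p\<le>M. a p * (real p * (real p - 1) * F (p - 2) q - real p * (real p + 2 * l) * F p q)))"
    by (subst step[OF a_def]) (auto simp: M_def)
  also have "\<dots> = (\<Sum>p\<le>M. a p * (\<Sum>q\<le>M. b q * (real q * (real q - 1) * F p (q - 2) - real q * (real q + 2 * l) * F p q)))"
    unfolding pair_moments_symmetric_op[OF l F] sum_distrib_left
    by (subst sum.swap) (simp add: mult_ac)
  also have "\<dots> = (\<Sum>p\<le>M. a p * (- (real j * (real j + 2 * l)) * (\<Sum>q\<le>M. b q * F p q)))"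
    by (subst step[OF b_def]) (auto simp: M_def)
  also have "\<dots> = - (real j * (real j + 2 * l)) * S"
    unfolding S_def by (simp add: sum_distrib_left sum_negf mult_ac)
  finally have "(real i * (real i + 2 * l) - real j * (real j + 2 * l)) * S = 0" by (simp add: algebra_simps)
  moreover have "real i * (real i + 2 * l) - real j * (real j + 2 * l) = (real i - real j) * (real i + real j + 2 * l)"
    by (simp add: algebra_simps)
  moreover have "real i + real j + 2 * l \<noteq> 0" using l by (simp add: add_nonneg_eq_0_iff)
  ultimately have "S = 0" using \<open>i \<noteq> j\<close> by simp
  moreover have "S = (\<Sum>p\<le>i. \<Sum>q\<le>j. a p * b q * F p q)"
    unfolding S_def
  proof (rule sum.mono_neutral_cong_right)
    fix p
    show "(\<Sum>q\<le>M. a p * b q * F p q) = (\<Sum>q\<le>j. a p * b q * F p q)"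
      by (rule sum.mono_neutral_right) (auto simp: M_def b0)
  qed (auto simp: M_def a0)
  ultimately show ?thesis by (simp add: a_def b_def)
qed

text \<open>The recursion for pair moments, solved as a polynomial in \<open>\<rho>\<close>.
  Recursing on the second index keeps the degree at most \<open>q\<close>, the bound by which the
  reproducing integral is identified later.\<close>

fun pmpoly :: "real \<Rightarrow> nat \<Rightarrow> nat \<Rightarrow> real poly" where
  "pmpoly l p 0 = [:mom l p:]"
| "pmpoly l p (Suc 0) = smult (real p / (real p + 1 + 2 * l)) ([:0, 1:] * pmpoly l (p - 1) 0)"
| "pmpoly l p (Suc (Suc q)) = smult (1 / (real p + real q + 2 + 2 * l))
     (smult (real q + 1) (pmpoly l p q) + smult (real p) ([:0, 1:] * pmpoly l (p - 1) (Suc q)))"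

lemma pair_moments_poly:
  assumes "l > 0" "pair_moments l \<rho> F"
  shows "F p q = poly (pmpoly l p q) \<rho>"
  using assms
proof (induction l p q rule: pmpoly.induct)
  case (1 l p)
  have "(\<Sum>q\<le>p. real (p choose q) * t ^ q * F (p - q) q) = mom l p * (1 + 2 * t * \<rho> + t\<^sup>2) ^ (p div 2)" if "t \<noteq> 0" for t
    using 1 that unfolding pair_moments_def by blast
  then have "(\<Sum>q\<le>p. monom (real (p choose q) * F (p - q) q) q) = smult (mom l p) ([:1, 2 * \<rho>, 1:] ^ (p div 2))"
    by (intro poly_eq_iff_nonzero) (simp add: poly_sum poly_monom mult_ac poly_power power2_eq_square algebra_simps)
  then have "poly (\<Sum>q\<le>p. monom (real (p choose q) * F (p - q) q) q) 0 = poly (smult (mom l p) ([:1, 2 * \<rho>, 1:] ^ (p div 2))) 0"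
    by simp
  then show ?case by (simp add: poly_0_coeff_0 coeff_sum coeff_0_power if_distrib sum.delta cong: if_cong)
next
  case (2 l p)
  have "real p + 1 + 2 * l > 0" using 2 by (intro add_nonneg_pos) auto
  then show ?case using pair_moments_rec_right[OF 2(2,3), of p 0] 2 by (simp add: field_simps)
next
  case (3 l p q)
  have "real p + real q + 2 + 2 * l > 0" using 3 by (intro add_nonneg_pos) auto
  then show ?case using pair_moments_rec_right[OF 3(3,4), of p "Suc q"] 3 by (simp add: field_simps)
qed

lemma degree_pmpoly: "degree (pmpoly l p q) \<le> q"
proof (induction l p q rule: pmpoly.induct)
  case (2 l p)
  then show ?case by (simp add: order.trans[OF degree_smult_le])
next
  case (3 l p q)
  have "degree ([:0, 1:] * pmpoly l (p - 1) (Suc q)) \<le> Suc (Suc q)"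
    using 3(2) degree_pCons_le[of 0 "pmpoly l (p - 1) (Suc q)"] by simp
  then have "degree (smult (real q + 1) (pmpoly l p q) + smult (real p) ([:0, 1:] * pmpoly l (p - 1) (Suc q))) \<le> Suc (Suc q)"
    using 3(1) by (intro degree_add_le order.trans[OF degree_smult_le]) auto
  then show ?case by (auto intro: order.trans[OF degree_smult_le])
qed simp

section \<open>Polynomials and separable kernels\<close>

lemma finite_multi_index: "finite {\<alpha> :: 'd::finite \<Rightarrow> nat. (\<Sum>i\<in>UNIV. \<alpha> i) \<le> n}"
proof (rule finite_subset)
  show "{\<alpha> :: 'd \<Rightarrow> nat. (\<Sum>i\<in>UNIV. \<alpha> i) \<le> n} \<subseteq> PiE UNIV (\<lambda>_. {..n})"
  proof
    fix \<alpha> :: "'d \<Rightarrow> nat" assume "\<alpha> \<in> {\<alpha>. (\<Sum>i\<in>UNIV. \<alpha> i) \<le> n}"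
    moreover have "\<alpha> i \<le> (\<Sum>i\<in>UNIV. \<alpha> i)" for i by (rule member_le_sum) auto
    ultimately show "\<alpha> \<in> PiE UNIV (\<lambda>_. {..n})" by (auto intro: order.trans)
  qed
qed (auto intro: finite_PiE)

lemma poly_space_monom: "(\<Sum>i\<in>UNIV. \<alpha> i) \<le> n \<Longrightarrow> (\<lambda>x :: real ^ 'd. \<Prod>i\<in>UNIV. (x $ i) ^ \<alpha> i) \<in> poly_space n"
  unfolding poly_space_def
  by (intro CollectI exI[of _ "\<lambda>\<beta>. if \<beta> = \<alpha> then 1 else 0"] ext)
    (simp add: if_distrib[of "\<lambda>u. u * _"] sum.delta finite_multi_index cong: if_cong)

lemma poly_space_add: "p \<in> poly_space n \<Longrightarrow> q \<in> poly_space n \<Longrightarrow> (\<lambda>x. p x + q x) \<in> poly_space n"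
proof -
  assume "p \<in> poly_space n" "q \<in> poly_space n"
  then obtain c c' where "p = (\<lambda>x. \<Sum>\<alpha> | (\<Sum>i\<in>UNIV. \<alpha> i) \<le> n. c \<alpha> * (\<Prod>i\<in>UNIV. (x $ i) ^ \<alpha> i))"
    "q = (\<lambda>x. \<Sum>\<alpha> | (\<Sum>i\<in>UNIV. \<alpha> i) \<le> n. c' \<alpha> * (\<Prod>i\<in>UNIV. (x $ i) ^ \<alpha> i))"
    unfolding poly_space_def by blast
  then show ?thesis unfolding poly_space_def
    by (intro CollectI exI[of _ "\<lambda>\<alpha>. c \<alpha> + c' \<alpha>"]) (simp add: distrib_right sum.distrib)
qed

lemma poly_space_scale: "p \<in> poly_space n \<Longrightarrow> (\<lambda>x. a * p x) \<in> poly_space n"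
proof -
  assume "p \<in> poly_space n"
  then obtain c where "p = (\<lambda>x. \<Sum>\<alpha> | (\<Sum>i\<in>UNIV. \<alpha> i) \<le> n. c \<alpha> * (\<Prod>i\<in>UNIV. (x $ i) ^ \<alpha> i))"
    unfolding poly_space_def by blast
  then show ?thesis unfolding poly_space_def
    by (intro CollectI exI[of _ "\<lambda>\<alpha>. a * c \<alpha>"]) (simp add: sum_distrib_left mult.assoc)
qed

lemma poly_space_induct [consumes 1, case_names monom add scale]:
  fixes p :: "real ^ 'd \<Rightarrow> real"
  assumes "p \<in> poly_space n"
    and monom: "\<And>\<alpha>. (\<Sum>i\<in>UNIV. \<alpha> i) \<le> n \<Longrightarrow> P (\<lambda>x. \<Prod>i\<in>UNIV. (x $ i) ^ \<alpha> i)"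
    and add: "\<And>p q. P p \<Longrightarrow> P q \<Longrightarrow> P (\<lambda>x. p x + q x)"
    and scale: "\<And>a p. P p \<Longrightarrow> P (\<lambda>x. a * p x)"
  shows "P p"
proof -
  obtain c where p: "p = (\<lambda>x. \<Sum>\<alpha> | (\<Sum>i\<in>UNIV. \<alpha> i) \<le> n. c \<alpha> * (\<Prod>i\<in>UNIV. (x $ i) ^ \<alpha> i))"
    using assms(1) unfolding poly_space_def by blast
  have zero: "P (\<lambda>x. 0)" using scale[OF monom[of "\<lambda>_. 0"], of 0] by simp
  have "P (\<lambda>x. \<Sum>\<alpha>\<in>A. c \<alpha> * (\<Prod>i\<in>UNIV. (x $ i) ^ \<alpha> i))"
    if "finite A" "A \<subseteq> {\<alpha>. (\<Sum>i\<in>UNIV. \<alpha> i) \<le> n}" for A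
    using that
  proof (induction A)
    case (insert \<alpha> A)
    have "P (\<lambda>x. c \<alpha> * (\<Prod>i\<in>UNIV. (x $ i) ^ \<alpha> i) + (\<Sum>\<alpha>\<in>A. c \<alpha> * (\<Prod>i\<in>UNIV. (x $ i) ^ \<alpha> i)))"
      using insert by (intro add scale monom) auto
    then show ?case using insert by simp
  qed (simp add: zero)
  from this[OF finite_multi_index] show ?thesis unfolding p by blast
qed

lemma poly_space_mono: "p \<in> poly_space m \<Longrightarrow> m \<le> n \<Longrightarrow> p \<in> poly_space n"
  by (induction p rule: poly_space_induct) (auto intro: poly_space_monom poly_space_add poly_space_scale)

lemma poly_space_mult:
  assumes "p \<in> poly_space m" "q \<in> poly_space n"
  shows "(\<lambda>x. p x * q x) \<in> poly_space (m + n)"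
  using assms(1)
proof (induction p rule: poly_space_induct)
  case (monom \<alpha>)
  show ?case using assms(2)
  proof (induction q rule: poly_space_induct)
    case (monom \<beta>)
    have "(\<lambda>x. \<Prod>i\<in>UNIV. (x $ i) ^ (\<alpha> i + \<beta> i)) \<in> poly_space (m + n)"
      using \<open>(\<Sum>i\<in>UNIV. \<alpha> i) \<le> m\<close> monom by (intro poly_space_monom) (simp add: sum.distrib)
    then show ?case by (simp add: power_add prod.distrib)
  next
    case (add p q)
    from poly_space_add[OF this] show ?case by (simp add: distrib_left)
  next
    case (scale a p)
    from poly_space_scale[OF this, of a] show ?case by (simp add: mult.left_commute)
  qed
next
  case (add p q)
  from poly_space_add[OF this] show ?case by (simp add: distrib_right)
next
  case (scale a p)
  from poly_space_scale[OF this, of a] show ?case by (simp add: mult.assoc)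
qed

lemma poly_space_const: "(\<lambda>x. c) \<in> poly_space n"
  using poly_space_scale[OF poly_space_monom[of "\<lambda>_. 0" n], of c] by simp

lemma poly_space_sum: "(\<And>i. i \<in> I \<Longrightarrow> p i \<in> poly_space n) \<Longrightarrow> (\<lambda>x. \<Sum>i\<in>I. p i x) \<in> poly_space n"
  by (induction I rule: infinite_finite_induct) (auto intro: poly_space_add poly_space_const)

lemma poly_space_power: "p \<in> poly_space m \<Longrightarrow> (\<lambda>x. p x ^ k) \<in> poly_space (m * k)"
proof (induction k)
  case (Suc k)
  then show ?case using poly_space_mult[of p m "\<lambda>x. p x ^ k" "m * k"] by simp
qed (simp add: poly_space_const)

lemma poly_space_coord: "(\<lambda>x :: real ^ 'd. x $ i) \<in> poly_space 1"
proof -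
  have "(\<lambda>x :: real ^ 'd. \<Prod>j\<in>UNIV. (x $ j) ^ (if j = i then 1 else 0)) \<in> poly_space 1"
    by (rule poly_space_monom) simp
  moreover have "(\<Prod>j\<in>UNIV. (x $ j) ^ (if j = i then 1 else 0)) = x $ i" for x :: "real ^ 'd"
    by (simp add: if_distrib prod.delta cong: if_cong)
  ultimately show ?thesis by simp
qed

lemma poly_space_norm: "(\<lambda>x :: real ^ 'd. 1 - (norm x)\<^sup>2) \<in> poly_space 2"
proof -
  have "(\<lambda>x :: real ^ 'd. 1 + (-1) * (\<Sum>i\<in>UNIV. (x $ i) ^ 2)) \<in> poly_space 2"
    using poly_space_power[OF poly_space_coord, where k=2]
    by (intro poly_space_add poly_space_const poly_space_scale poly_space_sum) simp
  moreover have "(norm x)\<^sup>2 = (\<Sum>i\<in>UNIV. (x $ i) ^ 2)" for x :: "real ^ 'd"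
    unfolding power2_norm_eq_inner inner_vec_def by (simp add: power2_eq_square)
  ultimately show ?thesis by simp
qed

lemma poly_space_real_polynomial: "p \<in> poly_space n \<Longrightarrow> real_polynomial_function (p :: real ^ 'd \<Rightarrow> real)"
proof (induction p rule: poly_space_induct)
  case (monom \<alpha>)
  show ?case
    by (intro real_polynomial_function_prod real_polynomial_function_power real_polynomial_function.intros(1)
        bounded_linear_vec_nth) simp
qed (auto intro: real_polynomial_function.intros)

lemma poly_space_continuous: "p \<in> poly_space n \<Longrightarrow> continuous_on S (p :: real ^ 'd \<Rightarrow> real)"
  using poly_space_real_polynomial continuous_on_polymonial_function real_polynomial_function_eq by blast

text \<open>Kernels of finite rank. Integrating them in one variable is a finite sum, so product
  measures and joint integrability never have to be considered.\<close>

inductive sep :: "nat \<Rightarrow> (real ^ 'd \<Rightarrow> real ^ 'd \<Rightarrow> real) \<Rightarrow> bool" for n where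
  sep_base: "p \<in> poly_space n \<Longrightarrow> q \<in> poly_space n \<Longrightarrow> sep n (\<lambda>x y. p x * q y)"
| sep_add: "sep n K \<Longrightarrow> sep n L \<Longrightarrow> sep n (\<lambda>x y. K x y + L x y)"

lemma sep_scale: "sep n K \<Longrightarrow> sep n (\<lambda>x y. c * K x y)"
proof (induction rule: sep.induct)
  case (sep_base p q)
  from sep.sep_base[OF poly_space_scale[OF this(1), of c] this(2)] show ?case by (simp add: mult.assoc)
next
  case (sep_add K L)
  from sep.sep_add[OF sep_add(3,4)] show ?case by (simp add: distrib_left)
qed

lemma sep_zero: "sep n (\<lambda>x y. 0)"
  using sep_base[OF poly_space_const[of 0] poly_space_const[of 0]] by simp

lemma sep_sum: "(\<And>i. i \<in> I \<Longrightarrow> sep n (K i)) \<Longrightarrow> sep n (\<lambda>x y. \<Sum>i\<in>I. K i x y)"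
  by (induction I rule: infinite_finite_induct) (auto intro: sep_add sep_zero)

lemma sep_mono: "sep m K \<Longrightarrow> m \<le> n \<Longrightarrow> sep n K"
  by (induction rule: sep.induct) (auto intro: sep.intros poly_space_mono)

lemma sep_mult: "sep m K \<Longrightarrow> sep n L \<Longrightarrow> sep (m + n) (\<lambda>x y. K x y * L x y)"
proof (induction rule: sep.induct)
  case (sep_base p q)
  note pq = sep_base(1,2)
  show ?case using sep_base(3)
  proof (induction rule: sep.induct)
    case (sep_base p' q')
    from sep.sep_base[OF poly_space_mult[OF pq(1) sep_base(1)] poly_space_mult[OF pq(2) sep_base(2)]]
    show ?case by (simp add: mult_ac)
  next
    case (sep_add K L)
    from sep.sep_add[OF sep_add(3,4)] show ?case by (simp add: distrib_left)
  qed
next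
  case (sep_add K L)
  from sep.sep_add[OF sep_add(3,4)] sep_add(5) show ?case by (simp add: distrib_right)
qed

lemma sep_power: "sep m K \<Longrightarrow> sep (m * k) (\<lambda>x y. K x y ^ k)"
proof (induction k)
  case 0
  then show ?case using sep_base[OF poly_space_const[of 1] poly_space_const[of 1]] by simp
next
  case (Suc k)
  then show ?case using sep_mult[of m K "m * k" "\<lambda>x y. K x y ^ k"] by simp
qed

lemma sep_inner: "sep 1 (\<lambda>x y :: real ^ 'd. x \<bullet> y)"
  unfolding inner_vec_def inner_real_def by (intro sep_sum sep_base poly_space_coord)

lemma sep_section: "sep n K \<Longrightarrow> (\<lambda>y. K x y) \<in> poly_space n" "sep n K \<Longrightarrow> (\<lambda>x. K x y) \<in> poly_space n"
proof -
  show "sep n K \<Longrightarrow> (\<lambda>y. K x y) \<in> poly_space n"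
    by (induction rule: sep.induct) (auto intro: poly_space_scale poly_space_add)
  show "sep n K \<Longrightarrow> (\<lambda>x. K x y) \<in> poly_space n"
  proof (induction rule: sep.induct)
    case (sep_base p q)
    from poly_space_scale[OF sep_base(1), of "q y"] show ?case by (simp add: mult.commute)
  qed (auto intro: poly_space_add)
qed

lemma sep_real_polynomial: "sep n K \<Longrightarrow> real_polynomial_function (\<lambda>z. K (fst z) (snd z))"
proof (induction rule: sep.induct)
  case (sep_base p q)
  have lin: "polynomial_function (fst :: (real ^ 'd) \<times> (real ^ 'd) \<Rightarrow> real ^ 'd)"
    "polynomial_function (snd :: (real ^ 'd) \<times> (real ^ 'd) \<Rightarrow> real ^ 'd)"
    by (auto intro!: polynomial_function_bounded_linear bounded_linear_fst bounded_linear_snd)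
  note real_polynomial_function_compose[OF lin(1) poly_space_real_polynomial[OF sep_base(1)]]
    real_polynomial_function_compose[OF lin(2) poly_space_real_polynomial[OF sep_base(2)]]
  from real_polynomial_function.intros(4)[OF this] show ?case by (simp add: o_def)
qed (auto intro: real_polynomial_function.intros)

lemma integral_mult_middle: "integral\<^sup>L M (\<lambda>y. f y * (c * q y)) = c * integral\<^sup>L M (\<lambda>y. f y * q y)" for c :: real
proof -
  have "(\<lambda>y. f y * (c * q y)) = (\<lambda>y. c * (f y * q y))" by (simp add: mult_ac fun_eq_iff)
  then show ?thesis by simp
qed

lemma integral_sep_poly_space:
  fixes f :: "real ^ 'd \<Rightarrow> real"
  assumes "sep n K" "\<And>q. q \<in> poly_space n \<Longrightarrow> integrable M (\<lambda>y. f y * q y)"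
  shows "(\<lambda>x. integral\<^sup>L M (\<lambda>y. f y * K x y)) \<in> poly_space n"
  using assms(1)
proof (induction rule: sep.induct)
  case (sep_base p q)
  have "(\<lambda>x. integral\<^sup>L M (\<lambda>y. f y * q y) * p x) \<in> poly_space n"
    by (intro poly_space_scale sep_base)
  also have "(\<lambda>x. integral\<^sup>L M (\<lambda>y. f y * q y) * p x) = (\<lambda>x. integral\<^sup>L M (\<lambda>y. f y * (p x * q y)))"
    by (simp only: integral_mult_middle) (simp only: mult.commute)
  finally show ?case .
next
  case (sep_add K L)
  from poly_space_add[OF sep_add(3,4)] show ?case
    by (simp add: distrib_left assms(2) sep_section(1)[OF sep_add(1)] sep_section(1)[OF sep_add(2)])
qed

text \<open>For a product kernel both sides factor into the same one-variable integrals. Hence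
  integrability of \<open>f\<close> and \<open>g\<close> against polynomials suffices, and
  \<open>f\<close> can later be any square integrable function.\<close>

lemma integral_sep_swap:
  fixes f g :: "real ^ 'd \<Rightarrow> real"
  assumes "sep n K" and f: "\<And>q. q \<in> poly_space n \<Longrightarrow> integrable M (\<lambda>y. f y * q y)"
    and g: "\<And>q. q \<in> poly_space n \<Longrightarrow> integrable M (\<lambda>y. g y * q y)"
  shows "integral\<^sup>L M (\<lambda>x. g x * integral\<^sup>L M (\<lambda>y. f y * K x y)) = integral\<^sup>L M (\<lambda>y. f y * integral\<^sup>L M (\<lambda>x. g x * K x y))"
  using assms(1)
proof (induction rule: sep.induct)
  case (sep_base p q)
  have A: "integral\<^sup>L M (\<lambda>y. f y * (p x * q y)) = p x * integral\<^sup>L M (\<lambda>y. f y * q y)" for x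
    by (rule integral_mult_middle)
  have B: "integral\<^sup>L M (\<lambda>x. g x * (p x * q y)) = q y * integral\<^sup>L M (\<lambda>x. g x * p x)" for y
    by (subst mult.commute[of "p _"]) (rule integral_mult_middle)
  show ?case unfolding A B
    by (simp only: mult.assoc[symmetric] integral_mult_left_zero) (simp only: mult.commute)
next
  case (sep_add K L)
  have sec: "(\<lambda>x. K x y) \<in> poly_space n" "(\<lambda>y. K x y) \<in> poly_space n" "(\<lambda>x. L x y) \<in> poly_space n" "(\<lambda>y. L x y) \<in> poly_space n" for x y
    using sep_section sep_add(1,2) by auto
  have swap: "sep n (\<lambda>x y. K' y x)" if "sep n K'" for K' :: "real ^ 'd \<Rightarrow> real ^ 'd \<Rightarrow> real"
    using that
  proof (induction rule: sep.induct)
    case (sep_base p q)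
    from sep.sep_base[OF this(2,1)] show ?case by (simp add: mult.commute)
  qed (rule sep.sep_add)
  have 1: "(\<lambda>x. integral\<^sup>L M (\<lambda>y. f y * K x y)) \<in> poly_space n" "(\<lambda>x. integral\<^sup>L M (\<lambda>y. f y * L x y)) \<in> poly_space n"
    using integral_sep_poly_space f sep_add(1,2) by blast+
  have 2: "(\<lambda>y. integral\<^sup>L M (\<lambda>x. g x * K x y)) \<in> poly_space n" "(\<lambda>y. integral\<^sup>L M (\<lambda>x. g x * L x y)) \<in> poly_space n"
    using integral_sep_poly_space[OF swap[OF sep_add(1)]] integral_sep_poly_space[OF swap[OF sep_add(2)]] g by blast+
  show ?case using sep_add(3,4) by (simp add: distrib_left f g sec 1 2)
qed

text \<open>On the line through \<open>a\<close> and \<open>x\<close> this is a polynomial in one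
  variable with infinitely many zeros near \<open>a\<close>.\<close>

lemma real_polynomial_zero_ball:
  fixes p :: "'a::euclidean_space \<Rightarrow> real"
  assumes "real_polynomial_function p" "e > 0" "\<And>x. x \<in> ball a e \<Longrightarrow> p x = 0"
  shows "p x = 0"
proof -
  define h where "h = (\<lambda>t::real. a + t *\<^sub>R (x - a))"
  have "polynomial_function h" unfolding h_def
    by (intro polynomial_function_add polynomial_function_const polynomial_function_bounded_linear bounded_linear_scaleR_left)
  then have "real_polynomial_function (p \<circ> h)" using assms(1) by (rule real_polynomial_function_compose)
  then obtain c n where cn: "p \<circ> h = (\<lambda>t. \<Sum>i\<le>n. c i * t ^ i)"
    by (auto simp: real_polynomial_function_iff_sum)
  define d where "d = e / (1 + norm (x - a))"
  have d: "d > 0" using assms(2) by (auto simp: d_def intro!: divide_pos_pos add_pos_nonneg)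
  have "(\<Sum>i\<le>n. c i * t ^ i) = 0" if "t \<in> {0<..<d}" for t
  proof -
    have "norm (t *\<^sub>R (x - a)) \<le> t * (1 + norm (x - a))" 
    proof -
      have "norm (t *\<^sub>R (x - a)) = t * norm (x - a)" using that by simp
      then show ?thesis using that by (simp add: distrib_left)
    qed
    also have "\<dots> < d * (1 + norm (x - a))" using that by (intro mult_strict_right_mono) (auto intro: add_pos_nonneg)
    also have "d * (1 + norm (x - a)) = e" by (simp add: d_def add_nonneg_eq_0_iff)
    finally have "h t \<in> ball a e" by (simp add: h_def dist_norm)
    then show ?thesis using assms(3) cn by (metis comp_apply)
  qed
  then have "{0<..<d} \<subseteq> {t. (\<Sum>i\<le>n. c i * t ^ i) = 0}" by auto
  moreover have "infinite {0<..<d}" using d by simp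
  ultimately have "infinite {t. (\<Sum>i\<le>n. c i * t ^ i) = 0}" using finite_subset by blast
  then have "\<forall>i\<le>n. c i = 0" using polyfun_finite_roots[of c n] by blast
  then have "(p \<circ> h) 1 = 0" unfolding cn by simp
  then show ?thesis by (simp add: h_def)
qed

section \<open>The reproducing kernel\<close>

text \<open>The mean of \<open>u ^ (2 * k)\<close> for the density proportional to
  \<open>(1 - u^2) powr (\<mu> - 1)\<close> on \<open>[-1, 1]\<close>. For \<open>\<mu> = 0\<close>
  the value is 1, as for point masses at \<open>u = 1\<close> and \<open>u = -1\<close>.\<close>

definition umom :: "real \<Rightarrow> nat \<Rightarrow> real"
  where "umom \<mu> k = pochhammer (1/2) k / pochhammer (\<mu> + 1/2) k"

text \<open>Formally the mean of \<open>(A + u * sqrt C) ^ N\<close> over \<open>u\<close>, in which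
  odd powers of \<open>u\<close> cancel. Written with moments it is a polynomial in \<open>A\<close>
  and \<open>C\<close> and makes sense for \<open>C < 0\<close>, which occurs at points outside the
  ball.\<close>

definition avg :: "real \<Rightarrow> nat \<Rightarrow> real \<Rightarrow> real \<Rightarrow> real"
  where "avg \<mu> N A C = (\<Sum>k\<le>N. real (N choose (2 * k)) * umom \<mu> k * A ^ (N - 2 * k) * C ^ k)"

lemma choose_swap: "real (N choose a) * real ((N - a) choose b) = real (N choose b) * real ((N - b) choose a)"
proof (cases "a + b \<le> N")
  case True
  have e: "N - a - b = N - b - a" by simp
  have "real (N choose a) * real ((N - a) choose b) = fact N / (fact a * fact b * fact (N - a - b))"
    using True by (simp add: binomial_fact)
  moreover have "real (N choose b) * real ((N - b) choose a) = fact N / (fact a * fact b * fact (N - a - b))"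
    unfolding e using True by (simp add: binomial_fact)
  ultimately show ?thesis by simp
next
  case False
  have *: "real (N choose a) * real ((N - a) choose b) = 0" if "\<not> a + b \<le> N" for a b
    using that by (cases "a \<le> N") (auto simp: binomial_eq_0)
  have "\<not> b + a \<le> N" using False by simp
  with *[OF False] *[of b a] show ?thesis by metis
qed

text \<open>The binomial theorem under the formal mean. Two expansions are exchanged by
  \<open>choose_swap\<close>, after all sums have been extended to the common range up to
  \<open>N\<close> by vanishing binomial coefficients.\<close>

lemma avg_polarize:
  "avg \<mu> N (A + t * T) C = (\<Sum>q\<le>N. real (N choose q) * t ^ q * (avg \<mu> (N - q) A C * T ^ q))"
proof -
  have ext: "(\<Sum>q\<le>m. real (m choose q) * g q) = (\<Sum>q\<le>N. real (m choose q) * g q)" if "m \<le> N" for m and g :: "nat \<Rightarrow> real"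
    by (rule sum.mono_neutral_left) (use that in \<open>auto simp: binomial_eq_0\<close>)
  have ext2: "(\<Sum>k\<le>m. real (m choose (2 * k)) * g k) = (\<Sum>k\<le>N. real (m choose (2 * k)) * g k)" if "m \<le> N" for m and g :: "nat \<Rightarrow> real"
    by (rule sum.mono_neutral_left) (use that in \<open>auto simp: binomial_eq_0\<close>)
  have b: "(A + t * T) ^ m = (\<Sum>q\<le>N. real (m choose q) * ((t * T) ^ q * A ^ (m - q)))" if "m \<le> N" for m
    using binomial_ring[of "t * T" A m] ext[OF that, of "\<lambda>q. (t * T) ^ q * A ^ (m - q)"] by (simp add: add.commute mult.assoc)
  have "avg \<mu> N (A + t * T) C = (\<Sum>k\<le>N. \<Sum>q\<le>N. real (N choose (2 * k)) * real ((N - 2 * k) choose q) * (umom \<mu> k * (t * T) ^ q * A ^ (N - 2 * k - q) * C ^ k))"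
    unfolding avg_def b[OF diff_le_self] by (simp add: sum_distrib_left sum_distrib_right mult_ac)
  also have "\<dots> = (\<Sum>k\<le>N. \<Sum>q\<le>N. real (N choose q) * real ((N - q) choose (2 * k)) * (umom \<mu> k * (t * T) ^ q * A ^ (N - q - 2 * k) * C ^ k))"
    unfolding choose_swap[of N "2 * _"] by (simp add: add.commute)
  also have "\<dots> = (\<Sum>q\<le>N. \<Sum>k\<le>N. real (N choose q) * real ((N - q) choose (2 * k)) * (umom \<mu> k * (t * T) ^ q * A ^ (N - q - 2 * k) * C ^ k))"
    by (rule sum.swap)
  also have "\<dots> = (\<Sum>q\<le>N. real (N choose q) * t ^ q * ((\<Sum>k\<le>N. real ((N - q) choose (2 * k)) * (umom \<mu> k * A ^ (N - q - 2 * k) * C ^ k)) * T ^ q))"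
    by (simp add: sum_distrib_left sum_distrib_right power_mult_distrib mult_ac)
  also have "\<dots> = (\<Sum>q\<le>N. real (N choose q) * t ^ q * (avg \<mu> (N - q) A C * T ^ q))"
    unfolding ext2[OF diff_le_self, symmetric] by (simp add: avg_def mult.assoc)
  finally show ?thesis .
qed

lemma avg_zero: "avg \<mu> N A 0 = A ^ N"
proof -
  have "avg \<mu> N A 0 = (\<Sum>k\<in>{0}. real (N choose (2 * k)) * umom \<mu> k * A ^ (N - 2 * k) * 0 ^ k)"
    unfolding avg_def by (rule sum.mono_neutral_right) auto
  then show ?thesis by (simp add: umom_def)
qed

lemma continuous_on_avg [continuous_intros]:
  "continuous_on S f \<Longrightarrow> continuous_on S g \<Longrightarrow> continuous_on S (\<lambda>y. avg \<mu> N (f y) (g y))"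
  unfolding avg_def by (intro continuous_intros)

text \<open>Both sides equal \<open>fact (2 * n) / (4 ^ n * fact k * fact (n - k))\<close>.\<close>

lemma choose_half:
  assumes "k \<le> n"
  shows "real (2 * n choose (2 * k)) * pochhammer (1/2) k * pochhammer (1/2) (n - k) = real (n choose k) * pochhammer (1/2) n"
proof -
  have h: "pochhammer (1/2 :: real) m = fact (2 * m) / (2 ^ (2 * m) * fact m)" for m
    by (simp add: fact_double[of m])
  have "real (2 * n choose (2 * k)) = fact (2 * n) / (fact (2 * k) * fact (2 * (n - k)))"
    using assms by (simp add: binomial_fact diff_mult_distrib2)
  moreover have "real (n choose k) = fact n / (fact k * fact (n - k))"
    using assms by (simp add: binomial_fact)
  moreover have "(2::real) ^ (2 * n) = 2 ^ (2 * k) * 2 ^ (2 * (n - k))"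
    using assms by (simp add: power_add[symmetric])
  ultimately show ?thesis unfolding h by (simp add: field_simps)
qed

text \<open>Formally the mean over \<open>u\<close> of \<open>poly g\<close> at
  \<open>x \<bullet> y + u * s_x * s_y\<close>, taken separately on each power.\<close>

definition pker :: "real \<Rightarrow> real poly \<Rightarrow> real ^ 'd \<Rightarrow> real ^ 'd \<Rightarrow> real"
  where "pker \<mu> g x y = (\<Sum>p\<le>degree g. coeff g p * avg \<mu> p (x \<bullet> y) ((1 - (norm x)\<^sup>2) * (1 - (norm y)\<^sup>2)))"

lemma pker_commute: "pker \<mu> g x y = pker \<mu> g y x"
  by (simp add: pker_def inner_commute mult.commute)

text \<open>On the sphere \<open>s_x = 0\<close> and nothing is averaged. Ridge polynomials are
  therefore kernel sections themselves, so their orthogonality is a special case of that of the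
  kernels.\<close>

lemma pker_unit: "norm x = 1 \<Longrightarrow> pker \<mu> g x y = poly g (x \<bullet> y)"
  by (simp add: pker_def avg_zero poly_altdef)

lemma continuous_on_pker [continuous_intros]: "continuous_on S (pker \<mu> g x)"
  unfolding pker_def[abs_def] by (intro continuous_intros)

lemma sep_pker:
  assumes "degree g \<le> n"
  shows "sep n (pker \<mu> g :: real ^ 'd \<Rightarrow> _)"
  unfolding pker_def[abs_def] avg_def
proof (intro sep_sum sep_scale)
  fix p k assume p: "p \<in> {..degree g}"
  show "sep n (\<lambda>x y :: real ^ 'd. real (p choose (2 * k)) * umom \<mu> k * (x \<bullet> y) ^ (p - 2 * k)
      * ((1 - (norm x)\<^sup>2) * (1 - (norm y)\<^sup>2)) ^ k)"
  proof (cases "2 * k \<le> p")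
    case True
    have "sep (1 * (p - 2 * k) + 2 * k) (\<lambda>x y :: real ^ 'd. (x \<bullet> y) ^ (p - 2 * k) * ((1 - (norm x)\<^sup>2) * (1 - (norm y)\<^sup>2)) ^ k)"
      by (intro sep_mult sep_power sep_inner sep_base poly_space_norm)
    from sep_scale[OF sep_mono[OF this, of n], of "real (p choose (2 * k)) * umom \<mu> k"]
    show ?thesis using True p assms by (simp add: mult.assoc)
  next
    case False
    then show ?thesis by (simp add: binomial_eq_0 sep_zero)
  qed
qed

section \<open>Averaged Gegenbauer kernels under the ball measure\<close>

locale ball_setting =
  fixes \<mu> l :: real and dim_type :: "'d::finite itself"
  assumes mu: "\<mu> \<ge> 0" and dim: "CARD('d) > 1" and l_eq: "l = \<mu> + (real CARD('d) - 1) / 2"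
begin

abbreviation E :: "(real ^ 'd \<Rightarrow> real) \<Rightarrow> real"
  where "E f \<equiv> integral\<^sup>L (ball_measure \<mu>) f"

lemma l_half: "l \<ge> 1/2"
proof -
  have "1/2 \<le> m + (c - 1) / 2" if "c \<ge> 2" "m \<ge> 0" for c m :: real
    using that by (simp add: field_simps)
  then show ?thesis unfolding l_eq using dim mu by auto
qed

lemma l_pos: "l > 0" using l_half by simp

lemma integrable_continuous: "continuous_on UNIV f \<Longrightarrow> integrable (ball_measure \<mu>) (f :: real ^ 'd \<Rightarrow> real)"
  using integrable_ball_continuous mu by blast

text \<open>Rotation invariance in \<open>d + 1\<close> dimensions: only the squared length of the
  direction \<open>(\<xi>, sqrt c)\<close> enters. The factor
  \<open>pochhammer (\<mu> + 1/2) k\<close> of the ball moments cancels the denominator of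
  \<open>umom\<close>, and \<open>choose_half\<close> turns the rest into a binomial sum. The sign
  of \<open>c\<close> is free.\<close>

lemma E_avg:
  fixes \<xi> :: "real ^ 'd"
  shows "E (\<lambda>y. avg \<mu> N (\<xi> \<bullet> y) (c * (1 - (norm y)\<^sup>2))) = mom l N * ((norm \<xi>)\<^sup>2 + c) ^ (N div 2)"
proof (cases "even N")
  case False
  have "E (\<lambda>y. avg \<mu> N (\<xi> \<bullet> y) (c * (1 - (norm y)\<^sup>2))) = 0"
  proof (rule ball_measure_odd[OF mu])
    show "continuous_on UNIV (\<lambda>y. avg \<mu> N (\<xi> \<bullet> y) (c * (1 - (norm y)\<^sup>2)))" by (intro continuous_intros)
    fix y
    have "real (N choose (2 * k)) * umom \<mu> k * (- (\<xi> \<bullet> y)) ^ (N - 2 * k) * C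
        = - (real (N choose (2 * k)) * umom \<mu> k * (\<xi> \<bullet> y) ^ (N - 2 * k) * C)" for k C
      using False by (cases "2 * k \<le> N") (auto simp: power_minus_odd binomial_eq_0)
    then show "avg \<mu> N (\<xi> \<bullet> - y) (c * (1 - (norm (- y))\<^sup>2)) = - avg \<mu> N (\<xi> \<bullet> y) (c * (1 - (norm y)\<^sup>2))"
      by (simp add: avg_def sum_negf)
  qed
  then show ?thesis using False by (simp add: mom_def)
next
  case True
  then obtain n where N: "N = 2 * n" by (elim evenE)
  have l1: "\<mu> + real (CARD('d) + 1) / 2 = l + 1" using l_eq by (simp add: field_simps)
  have pA: "pochhammer (\<mu> + 1/2) k > 0" for k using mu by (intro pochhammer_pos) auto
  have "avg \<mu> N A C = (\<Sum>k\<le>n. real (N choose (2 * k)) * umom \<mu> k * A ^ (N - 2 * k) * C ^ k)" for A C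
    unfolding avg_def by (rule sum.mono_neutral_right) (auto simp: N binomial_eq_0)
  then have "E (\<lambda>y. avg \<mu> N (\<xi> \<bullet> y) (c * (1 - (norm y)\<^sup>2)))
     = E (\<lambda>y. \<Sum>k\<le>n. real (N choose (2 * k)) * umom \<mu> k * c ^ k * ((\<xi> \<bullet> y) ^ (2 * (n - k)) * (1 - (norm y)\<^sup>2) ^ k))"
    by (simp add: N power_mult_distrib diff_mult_distrib diff_mult_distrib2 mult_ac)
  also have "\<dots> = (\<Sum>k\<le>n. real (N choose (2 * k)) * umom \<mu> k * c ^ k * E (\<lambda>y. (\<xi> \<bullet> y) ^ (2 * (n - k)) * (1 - (norm y)\<^sup>2) ^ k))"
    by (subst Bochner_Integration.integral_sum) (auto intro!: integrable_continuous continuous_intros)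
  also have "\<dots> = (\<Sum>k\<le>n. pochhammer (1/2) n / pochhammer (l + 1) n * (real (n choose k) * c ^ k * ((norm \<xi>)\<^sup>2) ^ (n - k)))"
  proof (rule sum.cong)
    fix k assume k: "k \<in> {..n}"
    have m: "E (\<lambda>y. (\<xi> \<bullet> y) ^ (2 * (n - k)) * (1 - (norm y)\<^sup>2) ^ k)
       = norm \<xi> ^ (2 * (n - k)) * (pochhammer (1/2) (n - k) * pochhammer (\<mu> + 1/2) k / pochhammer (l + 1) n)"
      using has_bochner_integral_integral_eq[OF ball_measure_moment[OF mu, of \<xi> "n - k" k]] k unfolding l1 by simp
    have pw: "norm \<xi> ^ (2 * (n - k)) = ((norm \<xi>)\<^sup>2) ^ (n - k)" by (rule power_mult)
    have "real (N choose (2 * k)) * umom \<mu> k * c ^ k * E (\<lambda>y. (\<xi> \<bullet> y) ^ (2 * (n - k)) * (1 - (norm y)\<^sup>2) ^ k)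
       = (real (N choose (2 * k)) * pochhammer (1/2) k * pochhammer (1/2) (n - k)) / pochhammer (l + 1) n * (c ^ k * ((norm \<xi>)\<^sup>2) ^ (n - k))"
      unfolding m pw umom_def using pA[of k] by (simp add: mult_ac)
    also have "real (N choose (2 * k)) * pochhammer (1/2) k * pochhammer (1/2) (n - k) = real (n choose k) * pochhammer (1/2) n"
      unfolding N using k by (intro choose_half) auto
    finally show "real (N choose (2 * k)) * umom \<mu> k * c ^ k * E (\<lambda>y. (\<xi> \<bullet> y) ^ (2 * (n - k)) * (1 - (norm y)\<^sup>2) ^ k)
      = pochhammer (1/2) n / pochhammer (l + 1) n * (real (n choose k) * c ^ k * ((norm \<xi>)\<^sup>2) ^ (n - k))"
      by simp
  qed simp
  also have "\<dots> = pochhammer (1/2) n / pochhammer (l + 1) n * (c + (norm \<xi>)\<^sup>2) ^ n"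
    unfolding binomial_ring sum_distrib_left by simp
  finally show ?thesis by (simp add: N mom_def add.commute)
qed

definition kmom :: "real ^ 'd \<Rightarrow> real ^ 'd \<Rightarrow> nat \<Rightarrow> nat \<Rightarrow> real"
  where "kmom x \<omega> p q = E (\<lambda>y. avg \<mu> p (x \<bullet> y) ((1 - (norm x)\<^sup>2) * (1 - (norm y)\<^sup>2)) * (\<omega> \<bullet> y) ^ q)"

text \<open>The two directions are the lift \<open>(x, s_x)\<close> and
  \<open>(\<omega>, 0)\<close>. Adding \<open>1 - |x|^2\<close> gives the first one squared length 1
  for every \<open>x\<close>, inside the ball or not.\<close>

lemma pair_moments_kmom:
  assumes "norm \<omega> = 1"
  shows "pair_moments l (x \<bullet> \<omega>) (kmom x \<omega>)"
  unfolding pair_moments_def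
proof (intro allI impI)
  fix N and t :: real
  define C where "C = 1 - (norm x)\<^sup>2"
  have "(\<Sum>q\<le>N. real (N choose q) * t ^ q * kmom x \<omega> (N - q) q)
     = E (\<lambda>y. \<Sum>q\<le>N. real (N choose q) * t ^ q * (avg \<mu> (N - q) (x \<bullet> y) (C * (1 - (norm y)\<^sup>2)) * (\<omega> \<bullet> y) ^ q))"
    unfolding kmom_def C_def[symmetric]
    by (subst Bochner_Integration.integral_sum) (auto intro!: integrable_continuous continuous_intros)
  also have "\<dots> = E (\<lambda>y. avg \<mu> N ((x + t *\<^sub>R \<omega>) \<bullet> y) (C * (1 - (norm y)\<^sup>2)))"
    unfolding avg_polarize[symmetric] by (simp add: inner_add_left)
  also have "\<dots> = mom l N * ((norm (x + t *\<^sub>R \<omega>))\<^sup>2 + C) ^ (N div 2)" by (rule E_avg)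
  also have "(norm (x + t *\<^sub>R \<omega>))\<^sup>2 + C = 1 + 2 * t * (x \<bullet> \<omega>) + t\<^sup>2"
  proof -
    have "\<omega> \<bullet> \<omega> = 1" using assms by (simp add: norm_eq_1)
    then show ?thesis unfolding C_def power2_norm_eq_inner
      by (simp add: inner_add_left inner_add_right inner_commute power2_eq_square)
  qed
  finally show "(\<Sum>q\<le>N. real (N choose q) * t ^ q * kmom x \<omega> (N - q) q) = mom l N * (1 + 2 * t * (x \<bullet> \<omega>) + t\<^sup>2) ^ (N div 2)" .
qed

lemma E_pker_poly:
  assumes "degree g \<le> i" "degree h \<le> j"
  shows "E (\<lambda>y. pker \<mu> g x y * poly h (\<omega> \<bullet> y)) = (\<Sum>p\<le>i. \<Sum>q\<le>j. coeff g p * coeff h q * kmom x \<omega> p q)"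
proof -
  have pk: "pker \<mu> g x y = (\<Sum>p\<le>i. coeff g p * avg \<mu> p (x \<bullet> y) ((1 - (norm x)\<^sup>2) * (1 - (norm y)\<^sup>2)))" for y
    unfolding pker_def by (rule sum.mono_neutral_left) (use assms in \<open>auto simp: coeff_eq_0\<close>)
  have ph: "poly h t = (\<Sum>q\<le>j. coeff h q * t ^ q)" for t
    unfolding poly_altdef by (rule sum.mono_neutral_left) (use assms in \<open>auto simp: coeff_eq_0\<close>)
  have "E (\<lambda>y. pker \<mu> g x y * poly h (\<omega> \<bullet> y))
     = E (\<lambda>y. \<Sum>p\<le>i. \<Sum>q\<le>j. coeff g p * coeff h q * (avg \<mu> p (x \<bullet> y) ((1 - (norm x)\<^sup>2) * (1 - (norm y)\<^sup>2)) * (\<omega> \<bullet> y) ^ q))"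
    unfolding pk ph sum_product by (simp add: mult_ac)
  also have "\<dots> = (\<Sum>p\<le>i. E (\<lambda>y. \<Sum>q\<le>j. coeff g p * coeff h q * (avg \<mu> p (x \<bullet> y) ((1 - (norm x)\<^sup>2) * (1 - (norm y)\<^sup>2)) * (\<omega> \<bullet> y) ^ q)))"
    by (intro Bochner_Integration.integral_sum integrable_continuous continuous_intros)
  also have "\<dots> = (\<Sum>p\<le>i. \<Sum>q\<le>j. coeff g p * coeff h q * kmom x \<omega> p q)"
    unfolding kmom_def by (subst Bochner_Integration.integral_sum) (auto intro!: integrable_continuous continuous_intros)
  finally show ?thesis .
qed

lemma geg_orthogonal:
  assumes "norm \<omega> = 1" "i \<noteq> j"
  shows "E (\<lambda>y. pker \<mu> (geg l i) x y * poly (geg l j) (\<omega> \<bullet> y)) = 0"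
  unfolding E_pker_poly[OF degree_geg degree_geg]
  using geg_pair_orthogonal[OF l_pos pair_moments_kmom[OF assms(1)] assms(2)] .

text \<open>The mean of \<open>\<omega> \<bullet> y\<close> times two consecutive polynomials is
  computed twice, applying the recurrence to either of them. Orthogonality leaves one squared norm
  each time, and the ratio is the recursion of \<open>gegw\<close>.\<close>

lemma geg_norm:
  assumes "norm \<omega> = 1"
  shows "E (\<lambda>y. poly (geg l j) (\<omega> \<bullet> y) * poly (geg l j) (\<omega> \<bullet> y)) = 1 / gegw l j"
proof (induction j)
  case 0
  interpret prob_space "ball_measure \<mu> :: (real ^ 'd) measure" by (rule prob_space_ball_measure[OF mu])
  show ?case by (simp add: prob_space)
next
  case (Suc j)
  define R where "R = (\<lambda>j y. poly (geg l j) (\<omega> \<bullet> y))"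
  have orth: "E (\<lambda>y. R i y * R k y) = 0" if "i \<noteq> k" for i k
    using geg_orthogonal[OF assms that, of \<omega>] pker_unit[OF assms] by (simp add: R_def)
  have int: "integrable (ball_measure \<mu>) (\<lambda>y. R i y * R k y)" for i k
    unfolding R_def by (intro integrable_continuous continuous_intros)
  define M where "M = E (\<lambda>y. (\<omega> \<bullet> y) * R j y * R (Suc j) y)"
  have rec: "2 * (real j + l) * ((\<omega> \<bullet> y) * R j y) = (real j + 2 * l) * R (Suc j) y + real j * R (j - 1) y" for j y
    using geg_rec[OF l_pos, of j "\<omega> \<bullet> y"] by (simp add: R_def)
  have "2 * (real j + l) * M = E (\<lambda>y. (2 * (real j + l) * ((\<omega> \<bullet> y) * R j y)) * R (Suc j) y)"
    unfolding M_def by (simp add: mult.assoc)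
  also have "\<dots> = E (\<lambda>y. (real j + 2 * l) * (R (Suc j) y * R (Suc j) y) + real j * (R (j - 1) y * R (Suc j) y))"
    unfolding rec by (simp add: algebra_simps)
  also have "\<dots> = (real j + 2 * l) * E (\<lambda>y. R (Suc j) y * R (Suc j) y)"
    using orth[of "j - 1" "Suc j"] by (simp add: int)
  finally have 1: "2 * (real j + l) * M = (real j + 2 * l) * E (\<lambda>y. R (Suc j) y * R (Suc j) y)" .
  have "2 * (real (Suc j) + l) * M = E (\<lambda>y. (2 * (real (Suc j) + l) * ((\<omega> \<bullet> y) * R (Suc j) y)) * R j y)"
    unfolding M_def integral_mult_right_zero[symmetric]
    by (intro Bochner_Integration.integral_cong) (simp_all add: algebra_simps)
  also have "\<dots> = E (\<lambda>y. (real (Suc j) + 2 * l) * (R (Suc (Suc j)) y * R j y) + real (Suc j) * (R j y * R j y))"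
    unfolding rec by (simp add: algebra_simps)
  also have "\<dots> = real (Suc j) * E (\<lambda>y. R j y * R j y)"
    using orth[of "Suc (Suc j)" j] by (simp add: int)
  finally have 2: "2 * (real (Suc j) + l) * M = real (Suc j) / gegw l j"
    using Suc by (simp add: R_def)
  define X where "X = E (\<lambda>y. R (Suc j) y * R (Suc j) y)"
  have pos: "real j + l > 0" "real j + 1 + l > 0" "real j + 2 * l > 0" "gegw l j > 0"
    using l_pos gegw_pos by (auto intro: add_nonneg_pos)
  have "X = 2 * (real j + l) * M / (real j + 2 * l)" using 1 pos by (simp add: X_def)
  moreover have "M = (real j + 1) / gegw l j / (2 * (real j + 1 + l))"
  proof -
    have nz: "2 * (real j + 1 + l) \<noteq> 0" using pos by simp
    show ?thesis using 2 unfolding nonzero_eq_divide_eq[OF nz] by (simp add: mult_ac add_ac)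
  qed
  moreover have "2 * A * (D / G / (2 * B)) / C = 1 / (G * (C * B) / (A * D))"
    if "A \<noteq> 0" "B \<noteq> 0" "C \<noteq> 0" "D \<noteq> 0" "G \<noteq> 0" for A B C D G :: real
    using that by (simp add: field_simps)
  note this[of "real j + l" "real j + 1 + l" "real j + 2 * l" "real j + 1" "gegw l j"]
  ultimately have "X = 1 / gegw l (Suc j)" using pos by (simp add: add_eq_0_iff2)
  then show ?case by (simp add: X_def R_def)
qed


text \<open>The kernel below is a function of \<open>x \<bullet> \<omega>\<close> only, orthogonal to all \<open>geg l i\<close> with \<open>i < j\<close>;
  this forces it to be a multiple of \<open>geg l j\<close>.\<close>

lemma geg_reproduce:
  assumes \<omega>: "norm \<omega> = 1"
  shows "E (\<lambda>y. pker \<mu> (geg l j) x y * poly (geg l j) (\<omega> \<bullet> y)) = poly (geg l j) (x \<bullet> \<omega>) / gegw l j"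
proof -
  define Q where "Q = (\<Sum>p\<le>j. \<Sum>q\<le>j. smult (coeff (geg l j) p * coeff (geg l j) q) (pmpoly l p q))"
  have Q: "E (\<lambda>y. pker \<mu> (geg l j) x y * poly (geg l j) (\<omega> \<bullet> y)) = poly Q (x \<bullet> \<omega>)" for x
    unfolding E_pker_poly[OF degree_geg degree_geg] Q_def pair_moments_poly[OF l_pos pair_moments_kmom[OF \<omega>]]
    by (simp add: poly_sum)
  have "degree Q \<le> j" unfolding Q_def
    by (intro degree_sum_le finite_atMost order.trans[OF degree_smult_le] order.trans[OF degree_pmpoly]) auto
  then obtain c where c: "Q = (\<Sum>i\<le>j. smult (c i) (geg l i))" using geg_basis[OF l_pos] by blast
  have pQ: "poly Q t = (\<Sum>i\<le>j. c i * poly (geg l i) t)" for t unfolding c by (simp add: poly_sum)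
  have int: "integrable (ball_measure \<mu>) (\<lambda>y. poly (geg l j) (\<omega> \<bullet> y) * q y)" if "q \<in> poly_space n" for j n and q :: "real ^ 'd \<Rightarrow> real"
    by (intro integrable_continuous continuous_intros poly_space_continuous[OF that])
  have orth: "E (\<lambda>y. poly (geg l i) (\<omega> \<bullet> y) * poly (geg l k) (\<omega> \<bullet> y)) = (if i = k then 1 / gegw l i else 0)" for i k
    using geg_orthogonal[OF \<omega>, of i k \<omega>] geg_norm[OF \<omega>, of i] pker_unit[OF \<omega>] by auto
  \<comment> \<open>Testing with \<open>geg l i\<close> extracts the coefficient. After exchanging
    the integrals, \<open>geg l i\<close> stands directly against the kernel of index
    \<open>j\<close>, and orthogonality gives 0.\<close>
  have c0: "c i = 0" if "i < j" for i
  proof -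
    have "E (\<lambda>x. poly (geg l i) (\<omega> \<bullet> x) * poly Q (x \<bullet> \<omega>)) = (\<Sum>k\<le>j. c k * E (\<lambda>x. poly (geg l i) (\<omega> \<bullet> x) * poly (geg l k) (\<omega> \<bullet> x)))"
      unfolding pQ sum_distrib_left
      by (subst Bochner_Integration.integral_sum) (auto intro!: integrable_continuous continuous_intros simp: inner_commute mult.left_commute)
    also have "\<dots> = c i / gegw l i" using that unfolding orth by (simp add: sum.delta if_distrib cong: if_cong)
    finally have 1: "E (\<lambda>x. poly (geg l i) (\<omega> \<bullet> x) * poly Q (x \<bullet> \<omega>)) = c i / gegw l i" .
    have "E (\<lambda>x. poly (geg l i) (\<omega> \<bullet> x) * poly Q (x \<bullet> \<omega>))
      = E (\<lambda>x. poly (geg l i) (\<omega> \<bullet> x) * E (\<lambda>y. poly (geg l j) (\<omega> \<bullet> y) * pker \<mu> (geg l j) x y))"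
      unfolding Q[symmetric] by (simp add: mult.commute)
    also have "\<dots> = E (\<lambda>y. poly (geg l j) (\<omega> \<bullet> y) * E (\<lambda>x. poly (geg l i) (\<omega> \<bullet> x) * pker \<mu> (geg l j) x y))"
      by (rule integral_sep_swap[OF sep_pker[OF degree_geg]]) (rule int, assumption)+
    also have "\<dots> = 0"
    proof -
      have "E (\<lambda>x. poly (geg l i) (\<omega> \<bullet> x) * pker \<mu> (geg l j) x y) = 0" for y
        using geg_orthogonal[OF \<omega>, of j i y] that by (simp add: mult.commute pker_commute[of _ _ y])
      then show ?thesis by simp
    qed
    finally have "c i / gegw l i = 0" unfolding 1 by simp
    then show ?thesis using gegw_pos[OF l_pos, of i] by simp
  qed
  have "poly Q t = c j * poly (geg l j) t" for t
    unfolding pQ using c0 by (subst sum.mono_neutral_right[of _ "{j}"]) auto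
  \<comment> \<open>The remaining factor is fixed by taking \<open>x = \<omega>\<close>, where the
    integral is the squared norm.\<close>
  moreover have "c j = 1 / gegw l j"
  proof -
    have "\<omega> \<bullet> \<omega> = 1" using \<omega> by (simp add: norm_eq_1)
    then have "poly Q 1 = 1 / gegw l j" using Q[of \<omega>] geg_norm[OF \<omega>, of j] pker_unit[OF \<omega>] by simp
    then show ?thesis using calculation[of 1] geg_one[OF l_pos] by simp
  qed
  ultimately show ?thesis using Q by simp
qed

text \<open>In dimension at least two there are unit vectors with inner product \<open>t\<close>.
  The reproducing integral for them is the mean of a product, at most the mean of the half sum of
  squares, and both squares have mean \<open>1 / gegw l j\<close>.\<close>

lemma geg_le_one:
  assumes "\<bar>t\<bar> \<le> 1"
  shows "\<bar>poly (geg l j) t\<bar> \<le> 1"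
proof -
  obtain a b :: 'd where ab: "a \<noteq> b"
    using dim card_le_Suc0_iff_eq[of "UNIV :: 'd set"] by auto
  define \<omega> where "\<omega> = axis a (1::real)"
  define x where "x = t *\<^sub>R axis a (1::real) + sqrt (1 - t\<^sup>2) *\<^sub>R axis b (1::real)"
  have t: "t\<^sup>2 \<le> 1" using assms by (simp add: abs_square_le_1)
  have \<omega>: "norm \<omega> = 1" by (simp add: \<omega>_def)
  have x\<omega>: "x \<bullet> \<omega> = t" using ab by (simp add: x_def \<omega>_def inner_add_left inner_axis_axis)
  have "x \<bullet> x = t\<^sup>2 + (1 - t\<^sup>2)" using ab t
    by (simp add: x_def inner_add_left inner_add_right inner_axis_axis power2_eq_square)
  then have x: "norm x = 1" by (simp add: norm_eq_1)
  have h: "gegw l j > 0" by (rule gegw_pos[OF l_pos])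
  have "\<bar>poly (geg l j) t / gegw l j\<bar> = \<bar>E (\<lambda>y. poly (geg l j) (x \<bullet> y) * poly (geg l j) (\<omega> \<bullet> y))\<bar>"
    using geg_reproduce[OF \<omega>, of j x] pker_unit[OF x] x\<omega> by simp
  also have "\<dots> \<le> E (\<lambda>y. \<bar>poly (geg l j) (x \<bullet> y) * poly (geg l j) (\<omega> \<bullet> y)\<bar>)"
    by (rule integral_abs_bound)
  also have "\<dots> \<le> E (\<lambda>y. (poly (geg l j) (x \<bullet> y) * poly (geg l j) (x \<bullet> y) + poly (geg l j) (\<omega> \<bullet> y) * poly (geg l j) (\<omega> \<bullet> y)) / 2)"
  proof (intro integral_mono integrable_continuous continuous_intros)
    fix y
    have "\<bar>u * v\<bar> \<le> (u * u + v * v) / 2" for u v :: real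
    proof -
      have "0 \<le> (\<bar>u\<bar> - \<bar>v\<bar>)\<^sup>2" by simp
      then show ?thesis by (simp add: power2_diff abs_mult) (simp add: power2_eq_square)
    qed
    then show "\<bar>poly (geg l j) (x \<bullet> y) * poly (geg l j) (\<omega> \<bullet> y)\<bar>
      \<le> (poly (geg l j) (x \<bullet> y) * poly (geg l j) (x \<bullet> y) + poly (geg l j) (\<omega> \<bullet> y) * poly (geg l j) (\<omega> \<bullet> y)) / 2" .
  qed simp_all
  also have "\<dots> = (E (\<lambda>y. poly (geg l j) (x \<bullet> y) * poly (geg l j) (x \<bullet> y)) + E (\<lambda>y. poly (geg l j) (\<omega> \<bullet> y) * poly (geg l j) (\<omega> \<bullet> y))) / 2"
    by (subst Bochner_Integration.integral_add[symmetric]) (auto intro!: integrable_continuous continuous_intros)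
  also have "\<dots> = 1 / gegw l j" unfolding geg_norm[OF x] geg_norm[OF \<omega>] by simp
  finally show ?thesis using h by (simp add: field_simps abs_mult)
qed

section \<open>Reproduction of all polynomials\<close>

definition Pker :: "nat \<Rightarrow> real ^ 'd \<Rightarrow> real ^ 'd \<Rightarrow> real"
  where "Pker j x y = gegw l j * pker \<mu> (geg l j) x y"

lemma sep_Pker: "sep j (Pker j)"
  unfolding Pker_def[abs_def] by (intro sep_scale sep_pker degree_geg)

lemma Pker_commute: "Pker j x y = Pker j y x"
  unfolding Pker_def by (simp add: pker_commute)

lemma continuous_on_Pker [continuous_intros]: "continuous_on S (Pker j x)"
  unfolding Pker_def[abs_def] by (intro continuous_intros)

text \<open>Collects the claims for degree at most \<open>n\<close> in a form closed under linear
  combinations: only the sum over \<open>j \<le> n\<close> is prescribed, not its terms. Continuity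
  provides the integrability needed for additivity.\<close>

definition reproduced :: "nat \<Rightarrow> (real ^ 'd \<Rightarrow> real) \<Rightarrow> bool"
  where "reproduced n q \<longleftrightarrow> continuous_on UNIV q \<and> (\<forall>x. (\<forall>j>n. E (\<lambda>y. Pker j x y * q y) = 0)
     \<and> (\<Sum>j\<le>n. E (\<lambda>y. Pker j x y * q y)) = q x)"

lemma reproduced_scale: "reproduced n q \<Longrightarrow> reproduced n (\<lambda>x. a * q x)"
  unfolding reproduced_def integral_mult_middle by (auto intro!: continuous_intros simp: sum_distrib_left[symmetric])

lemma reproduced_add:
  assumes "reproduced n p" "reproduced n q"
  shows "reproduced n (\<lambda>x. p x + q x)"
proof -
  have "integrable (ball_measure \<mu>) (\<lambda>y. Pker j x y * f y)" if "reproduced n f" for j x f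
    using that unfolding reproduced_def by (intro integrable_continuous continuous_intros) auto
  then have "E (\<lambda>y. Pker j x y * (p y + q y)) = E (\<lambda>y. Pker j x y * p y) + E (\<lambda>y. Pker j x y * q y)" for j x
    using assms by (simp add: distrib_left)
  then show ?thesis using assms unfolding reproduced_def by (simp add: sum.distrib continuous_on_add)
qed

lemma reproduced_sum: "(\<And>i. i \<in> I \<Longrightarrow> reproduced n (p i)) \<Longrightarrow> reproduced n (\<lambda>x. \<Sum>i\<in>I. p i x)"
proof (induction I rule: infinite_finite_induct)
  case (insert i I)
  then show ?case by (simp add: reproduced_add)
qed (simp_all add: reproduced_def)

lemma reproduced_geg:
  assumes "norm \<omega> = 1" "i \<le> n"
  shows "reproduced n (\<lambda>y. poly (geg l i) (\<omega> \<bullet> y))"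
proof -
  have "E (\<lambda>y. Pker j x y * poly (geg l i) (\<omega> \<bullet> y)) = (if j = i then poly (geg l i) (\<omega> \<bullet> x) else 0)" for j x
    using geg_orthogonal[OF assms(1), of j i x] geg_reproduce[OF assms(1), of j x] gegw_pos[OF l_pos, of j]
    by (auto simp: Pker_def mult.assoc inner_commute)
  then show ?thesis using assms(2) by (auto simp: reproduced_def intro!: continuous_intros)
qed

text \<open>A power of a unit ridge is a combination of Gegenbauer ridges in the same direction;
  homogeneity gives arbitrary length.\<close>

lemma reproduced_ridge:
  assumes "m \<le> n"
  shows "reproduced n (\<lambda>y. (\<xi> \<bullet> y) ^ m)"
proof -
  have unit: "reproduced n (\<lambda>y. (\<omega> \<bullet> y) ^ m)" if "norm \<omega> = 1" "m \<le> n" for \<omega> m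
  proof -
    obtain c where c: "monom 1 m = (\<Sum>i\<le>m. smult (c i) (geg l i))"
      using geg_basis[OF l_pos degree_monom_le] by blast
    have "(\<omega> \<bullet> y) ^ m = (\<Sum>i\<le>m. c i * poly (geg l i) (\<omega> \<bullet> y))" for y
      using arg_cong[OF c, of "\<lambda>p. poly p (\<omega> \<bullet> y)"] by (simp add: poly_monom poly_sum)
    then show ?thesis using that by (auto intro!: reproduced_sum reproduced_scale reproduced_geg)
  qed
  show ?thesis
  proof (cases "\<xi> = 0")
    \<comment> \<open>The ridge is the constant \<open>0 ^ m\<close>, equal to 1 for
      \<open>m = 0\<close>. Any unit vector with exponent 0 supplies constants.\<close>
    case True
    have "norm (axis undefined 1 :: real ^ 'd) = 1" by simp
    from reproduced_scale[OF unit[OF this, of 0], of "0 ^ m"] show ?thesis using True by simp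
  next
    case False
    have "(\<xi> \<bullet> y) ^ m = norm \<xi> ^ m * ((\<xi> /\<^sub>R norm \<xi>) \<bullet> y) ^ m" for y
    proof -
      have "\<xi> \<bullet> y = norm \<xi> * ((\<xi> /\<^sub>R norm \<xi>) \<bullet> y)" using False by (simp add: mult.assoc[symmetric])
      then show ?thesis by (metis power_mult_distrib)
    qed
    then show ?thesis using reproduced_scale[OF unit[of "\<xi> /\<^sub>R norm \<xi>" m], of "norm \<xi> ^ m"] False assms by simp
  qed
qed

text \<open>Coefficients are extracted without inverting a Vandermonde matrix: the value at
  \<open>2 * t\<close> minus a power of 2 times the value at \<open>t\<close> loses its top
  coefficient and keeps nonzero multiples of the others.\<close>

lemma reproduced_coeff:
  assumes "\<And>t. reproduced n (\<lambda>y. \<Sum>i\<le>M. t ^ i * v i y)" "i \<le> M"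
  shows "reproduced n (v i)"
  using assms
proof (induction M arbitrary: v i)
  case 0
  from "0.prems"(1)[of 1] "0.prems"(2) show ?case by simp
next
  case (Suc M)
  have low: "reproduced n (v i)" if "i \<le> M" for i
  proof -
    have "reproduced n (\<lambda>y. \<Sum>i\<le>M. t ^ i * ((2 ^ i - 2 ^ Suc M) * v i y))" for t
    proof -
      have "reproduced n (\<lambda>y. (\<Sum>i\<le>Suc M. (2 * t) ^ i * v i y) + (- (2 ^ Suc M)) * (\<Sum>i\<le>Suc M. t ^ i * v i y))"
        by (intro reproduced_add reproduced_scale Suc.prems)
      also have "(\<lambda>y. (\<Sum>i\<le>Suc M. (2 * t) ^ i * v i y) + (- (2 ^ Suc M)) * (\<Sum>i\<le>Suc M. t ^ i * v i y))
        = (\<lambda>y. \<Sum>i\<le>M. t ^ i * ((2 ^ i - 2 ^ Suc M) * v i y))"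
      proof
        fix y
        have "(\<Sum>i\<le>Suc M. (2 * t) ^ i * v i y) + (- (2 ^ Suc M)) * (\<Sum>i\<le>Suc M. t ^ i * v i y)
          = (\<Sum>i\<le>Suc M. (2 * t) ^ i * v i y - 2 ^ Suc M * (t ^ i * v i y))"
          by (simp only: sum_subtractf sum_distrib_left mult_minus_left sum_negf add_uminus_conv_diff)
        also have "\<dots> = (\<Sum>i\<le>Suc M. t ^ i * ((2 ^ i - 2 ^ Suc M) * v i y))"
          by (intro sum.cong) (simp_all add: power_mult_distrib algebra_simps)
        finally show "(\<Sum>i\<le>Suc M. (2 * t) ^ i * v i y) + (- (2 ^ Suc M)) * (\<Sum>i\<le>Suc M. t ^ i * v i y)
          = (\<Sum>i\<le>M. t ^ i * ((2 ^ i - 2 ^ Suc M) * v i y))" by simp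
      qed
      finally show ?thesis .
    qed
    from Suc.IH[OF this that] have r: "reproduced n (\<lambda>y. (2 ^ i - 2 ^ Suc M) * v i y)" .
    have "(2::real) ^ i < 2 ^ Suc M" using that by (intro power_strict_increasing) auto
    then show ?thesis using reproduced_scale[OF r, of "1 / (2 ^ i - 2 ^ Suc M)"] by simp
  qed
  show ?case
  proof (cases "i = Suc M")
    case True
    have "reproduced n (\<lambda>y. (\<Sum>i\<le>Suc M. 1 ^ i * v i y) + (-1) * (\<Sum>i\<le>M. v i y))"
      by (intro reproduced_add reproduced_scale Suc.prems reproduced_sum low) auto
    then show ?thesis using True by simp
  qed (use Suc.prems low in auto)
qed

text \<open>Coordinates are split off a ridge power one at a time: the coefficient of
  \<open>t ^ b\<close> in \<open>((\<xi> + t *\<^sub>R axis i 1) \<bullet> y) ^ (a + b)\<close> is a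
  nonzero multiple of \<open>(\<xi> \<bullet> y) ^ a * (y $ i) ^ b\<close>. For this the direction
  and the exponent must vary in the induction.\<close>

lemma reproduced_monom:
  assumes "a + (\<Sum>i\<in>I. \<alpha> i) \<le> n"
  shows "reproduced n (\<lambda>y. (\<xi> \<bullet> y) ^ a * (\<Prod>i\<in>I. (y $ i) ^ \<alpha> i))"
  using finite[of I] assms
proof (induction I arbitrary: a \<xi> rule: finite_induct)
  case empty
  then show ?case by (simp add: reproduced_ridge)
next
  case (insert i I)
  define b where "b = \<alpha> i"
  define v where "v k y = real ((a + b) choose k) * ((\<xi> \<bullet> y) ^ (a + b - k) * (y $ i) ^ k * (\<Prod>i\<in>I. (y $ i) ^ \<alpha> i))" for k y
  have "reproduced n (\<lambda>y. \<Sum>k\<le>a + b. t ^ k * v k y)" for t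
  proof -
    have "reproduced n (\<lambda>y. ((\<xi> + t *\<^sub>R axis i 1) \<bullet> y) ^ (a + b) * (\<Prod>i\<in>I. (y $ i) ^ \<alpha> i))"
      by (rule insert.IH) (use insert in \<open>simp add: b_def add.assoc\<close>)
    moreover have "((\<xi> + t *\<^sub>R axis i 1) \<bullet> y) ^ (a + b) * (\<Prod>i\<in>I. (y $ i) ^ \<alpha> i) = (\<Sum>k\<le>a + b. t ^ k * v k y)" for y
    proof -
      have "((\<xi> + t *\<^sub>R axis i 1) \<bullet> y) ^ (a + b) = (t * y $ i + \<xi> \<bullet> y) ^ (a + b)"
        by (simp add: inner_add_left inner_axis' add.commute)
      then show ?thesis unfolding binomial_ring v_def by (simp add: sum_distrib_right sum_distrib_left power_mult_distrib mult_ac)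
    qed
    ultimately show ?thesis by simp
  qed
  from reproduced_coeff[OF this, of b]
  have "reproduced n (v b)" by simp
  moreover have "real ((a + b) choose b) \<noteq> 0" by simp
  ultimately have "reproduced n (\<lambda>y. 1 / real ((a + b) choose b) * v b y)" by (intro reproduced_scale)
  moreover have "1 / real ((a + b) choose b) * v b y = (\<xi> \<bullet> y) ^ a * (\<Prod>i\<in>insert i I. (y $ i) ^ \<alpha> i)" for y
    using insert(1,2) by (simp add: v_def b_def mult.assoc)
  ultimately show ?case by simp
qed

lemma reproduced_poly_space: "q \<in> poly_space n \<Longrightarrow> reproduced n q"
proof (induction q rule: poly_space_induct)
  case (monom \<alpha>)
  from reproduced_monom[of 0 \<alpha> UNIV n 0] monom show ?case by simp
qed (auto intro: reproduced_add reproduced_scale)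

lemma Pker_low: "q \<in> poly_space n \<Longrightarrow> n < j \<Longrightarrow> E (\<lambda>y. Pker j x y * q y) = 0"
  using reproduced_poly_space unfolding reproduced_def by blast

lemma Pker_sum: "q \<in> poly_space n \<Longrightarrow> (\<Sum>j\<le>n. E (\<lambda>y. Pker j x y * q y)) = q x"
  using reproduced_poly_space unfolding reproduced_def by blast

end

section \<open>Identification with the projection kernel\<close>

lemma real_polynomial_poly_space:
  assumes "real_polynomial_function (p :: real ^ 'd \<Rightarrow> real)"
  shows "\<exists>n. p \<in> poly_space n"
  using assms
proof (induction p rule: real_polynomial_function.induct)
  case (linear f)
  interpret bounded_linear f by (rule linear)
  have "f x = (\<Sum>i\<in>UNIV. f (axis i 1) * x $ i)" for x
  proof -
    have "f x = f (\<Sum>i\<in>UNIV. x $ i *\<^sub>R axis i 1)" by (simp add: basis_expansion scalar_mult_eq_scaleR[symmetric])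
    then show ?thesis by (simp add: sum scaleR mult.commute)
  qed
  then have "f = (\<lambda>x. \<Sum>i\<in>UNIV. f (axis i 1) * x $ i)" by blast
  moreover have "(\<lambda>x. \<Sum>i\<in>UNIV. f (axis i 1) * x $ i) \<in> poly_space 1"
    by (intro poly_space_sum poly_space_scale poly_space_coord)
  ultimately show ?case by metis
next
  case (const c)
  show ?case using poly_space_const by blast
next
  case (add f g)
  then obtain m n where "f \<in> poly_space m" "g \<in> poly_space n" by blast
  then have "(\<lambda>x. f x + g x) \<in> poly_space (max m n)"
    by (intro poly_space_add) (auto elim: poly_space_mono)
  then show ?case by blast
next
  case (mult f g)
  then show ?case using poly_space_mult by blast
qed

context ball_setting
begin

text \<open>Members of \<open>ball_L2\<close> are measurable on the ball only, and
  \<open>ball_inner\<close> sees nothing else; \<open>v\<close> is a globally measurable stand-in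
  for \<open>u\<close>.\<close>

lemma ball_inner_eq_E:
  fixes u v q :: "real ^ 'd \<Rightarrow> real"
  assumes "v \<in> borel_measurable lebesgue" "continuous_on UNIV q" "\<And>y. norm y \<le> 1 \<Longrightarrow> v y = u y"
  shows "ball_const TYPE('d) \<mu> * ball_inner \<mu> u q = E (\<lambda>y. v y * q y)"
proof -
  have "q \<in> borel_measurable borel" using assms(2) by (rule borel_measurable_continuous_onI)
  then have q: "q \<in> borel_measurable lebesgue" by (simp add: measurable_completion)
  have "E (\<lambda>y. v y * q y) = integral\<^sup>L lebesgue (\<lambda>y. ball_density \<mu> y * (v y * q y))"
    using assms(1) q by (intro integral_ball_measure mu borel_measurable_times)
  also have "(\<lambda>y. ball_density \<mu> y * (v y * q y)) = (\<lambda>y. ball_const TYPE('d) \<mu> * (indicator (cball 0 1) y *\<^sub>R (u y * q y * ball_weight \<mu> y)))"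
    using assms(3) by (auto simp: ball_density_def indicator_def fun_eq_iff)
  finally show ?thesis by (simp add: ball_inner_def set_lebesgue_integral_def)
qed

lemma ball_inner_poly:
  assumes "continuous_on UNIV p" "continuous_on UNIV q"
  shows "ball_const TYPE('d) \<mu> * ball_inner \<mu> p q = E (\<lambda>y. p y * q y)"
proof -
  have "p \<in> borel_measurable borel" using assms(1) by (rule borel_measurable_continuous_onI)
  then show ?thesis using assms by (intro ball_inner_eq_E) (auto simp: measurable_completion)
qed

lemma orth_poly_space_iff:
  "p \<in> orth_poly_space \<mu> n \<longleftrightarrow> p \<in> poly_space n \<and> (\<forall>m<n. \<forall>q\<in>poly_space m. E (\<lambda>y. p y * q y) = 0)"
proof -
  have "ball_inner \<mu> p q = 0 \<longleftrightarrow> E (\<lambda>y. p y * q y) = 0" if "p \<in> poly_space n" "q \<in> poly_space m" for q m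
    using ball_inner_poly[OF poly_space_continuous[OF that(1)] poly_space_continuous[OF that(2)]]
      ball_const_pos[OF mu, where 'd='d] by auto
  then show ?thesis unfolding orth_poly_space_def by blast
qed

lemma Pker_orth: "Pker n x \<in> orth_poly_space \<mu> n"
  unfolding orth_poly_space_iff using sep_section(1)[OF sep_Pker] Pker_low by blast

text \<open>Sections of \<open>Pker j\<close> with \<open>j < n\<close> are polynomials of lower
  degree, so orthogonality of \<open>h\<close> removes all but the last term of the sum that
  reproduces it.\<close>

lemma Pker_reproduce:
  assumes "h \<in> orth_poly_space \<mu> n"
  shows "E (\<lambda>y. Pker n x y * h y) = h x"
proof -
  have h: "h \<in> poly_space n" using assms by (simp add: orth_poly_space_iff)
  have "E (\<lambda>y. Pker j x y * h y) = 0" if "j < n" for j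
  proof -
    have "E (\<lambda>y. h y * Pker j x y) = 0"
      using assms that sep_section(1)[OF sep_Pker] unfolding orth_poly_space_iff by blast
    then show ?thesis by (simp add: mult.commute)
  qed
  then have "(\<Sum>j\<le>n. E (\<lambda>y. Pker j x y * h y)) = E (\<lambda>y. Pker n x y * h y)"
    by (subst sum.mono_neutral_right[of _ "{n}"]) auto
  then show ?thesis using Pker_sum[OF h] by simp
qed

definition restr :: "(real ^ 'd \<Rightarrow> real) \<Rightarrow> real ^ 'd \<Rightarrow> real"
  where "restr f y = indicator (cball 0 1) y * f y"

lemma
  assumes "f \<in> ball_L2 \<mu>"
  shows restr_measurable: "restr f \<in> borel_measurable lebesgue"
    and restr_integrable: "continuous_on UNIV q \<Longrightarrow> integrable (ball_measure \<mu>) (\<lambda>y. restr f y * q y)"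
proof -
  show fm: "restr f \<in> borel_measurable lebesgue"
    using assms unfolding ball_L2_def set_borel_measurable_def restr_def[abs_def] by simp
  assume q: "continuous_on UNIV q"
  then have "q \<in> borel_measurable borel" by (rule borel_measurable_continuous_onI)
  then have qm: "q \<in> borel_measurable lebesgue" by (simp add: measurable_completion)
  have "integrable lebesgue (\<lambda>y. ball_const TYPE('d) \<mu> * (indicator (cball 0 1) y *\<^sub>R ((f y)\<^sup>2 * ball_weight \<mu> y)))"
    using assms unfolding ball_L2_def set_integrable_def by (intro integrable_mult_right) auto
  also have "(\<lambda>y. ball_const TYPE('d) \<mu> * (indicator (cball 0 1) y *\<^sub>R ((f y)\<^sup>2 * ball_weight \<mu> y))) = (\<lambda>y. ball_density \<mu> y * (restr f y)\<^sup>2)"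
    by (auto simp: restr_def ball_density_def indicator_def fun_eq_iff)
  finally have f2: "integrable (ball_measure \<mu>) (\<lambda>y. (restr f y)\<^sup>2)"
    using fm by (subst integrable_ball_measure[OF mu]) auto
  have q2: "integrable (ball_measure \<mu>) (\<lambda>y. (q y)\<^sup>2)"
    using q by (intro integrable_continuous continuous_intros)
  show "integrable (ball_measure \<mu>) (\<lambda>y. restr f y * q y)"
  proof (rule Bochner_Integration.integrable_bound[OF Bochner_Integration.integrable_add[OF f2 q2]])
    show "(\<lambda>y. restr f y * q y) \<in> borel_measurable (ball_measure \<mu>)"
      using fm qm by (simp cong: measurable_cong_sets)
    have "\<bar>u * v\<bar> \<le> u\<^sup>2 + v\<^sup>2" for u v :: real
    proof -
      have "0 \<le> (\<bar>u\<bar> - \<bar>v\<bar>)\<^sup>2" "0 \<le> \<bar>u\<bar> * \<bar>v\<bar>" by simp_all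
      then show ?thesis unfolding power2_diff abs_mult power2_abs by linarith
    qed
    then show "AE y in ball_measure \<mu>. norm (restr f y * q y) \<le> norm ((restr f y)\<^sup>2 + (q y)\<^sup>2)"
      by (intro AE_I2) (simp add: abs_of_nonneg)
  qed
qed

lemma continuous_ball_L2:
  assumes "continuous_on UNIV (f :: real ^ 'd \<Rightarrow> real)"
  shows "f \<in> ball_L2 \<mu>"
proof -
  have "f \<in> borel_measurable borel" using assms by (rule borel_measurable_continuous_onI)
  then have fm: "f \<in> borel_measurable lebesgue" by (simp add: measurable_completion)
  have "integrable (ball_measure \<mu>) (\<lambda>y. (f y)\<^sup>2)"
    using assms by (intro integrable_continuous continuous_intros)
  then have "integrable lebesgue (\<lambda>y. ball_density \<mu> y * (f y)\<^sup>2)"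
    using fm by (subst (asm) integrable_ball_measure[OF mu]) auto
  then have "integrable lebesgue (\<lambda>y. (1 / ball_const TYPE('d) \<mu>) * (ball_density \<mu> y * (f y)\<^sup>2))"
    by (rule integrable_mult_right)
  also have "(\<lambda>y. (1 / ball_const TYPE('d) \<mu>) * (ball_density \<mu> y * (f y)\<^sup>2)) = (\<lambda>y. indicator (cball 0 1) y *\<^sub>R ((f y)\<^sup>2 * ball_weight \<mu> y))"
    using ball_const_pos[OF mu, where 'd='d] by (auto simp: ball_density_def indicator_def fun_eq_iff)
  finally have "set_integrable lebesgue (cball 0 1) (\<lambda>x. (f x)\<^sup>2 * ball_weight \<mu> x)"
    unfolding set_integrable_def .
  moreover have "set_borel_measurable lebesgue (cball 0 1) f"
    unfolding set_borel_measurable_def by (intro borel_measurable_scaleR borel_measurable_indicator fm) auto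
  ultimately show ?thesis by (simp add: ball_L2_def)
qed

text \<open>Exchanging integrals moves \<open>Pker n\<close> from \<open>f\<close> to the test
  polynomial: it then annihilates lower degrees and reproduces members of
  \<open>orth_poly_space\<close>, which gives both defining properties. For uniqueness the test
  function is the section \<open>Pker n x\<close>, against which any candidate takes its value at
  \<open>x\<close>.\<close>

lemma orth_proj_eq:
  assumes f: "f \<in> ball_L2 \<mu>"
  shows "orth_proj \<mu> n f = (\<lambda>x. E (\<lambda>y. restr f y * Pker n x y))"
proof -
  define G where "G = (\<lambda>x. E (\<lambda>y. restr f y * Pker n x y))"
  let ?c = "ball_const TYPE('d) \<mu>"
  have c: "?c > 0" by (rule ball_const_pos[OF mu])
  have int: "integrable (ball_measure \<mu>) (\<lambda>y. restr f y * q y)" if "q \<in> poly_space m" for q m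
    using that by (intro restr_integrable[OF f] poly_space_continuous)
  have pint: "integrable (ball_measure \<mu>) (\<lambda>y. p y * q y)" if "p \<in> poly_space k" "q \<in> poly_space m" for p q :: "real ^ 'd \<Rightarrow> real" and k m
    using that by (intro integrable_continuous continuous_intros poly_space_continuous)
  have G: "G \<in> poly_space n"
    unfolding G_def by (rule integral_sep_poly_space[OF sep_Pker]) (rule int)
  have Gq: "E (\<lambda>x. G x * q x) = E (\<lambda>y. restr f y * E (\<lambda>x. Pker n y x * q x))" if "q \<in> poly_space m" for q m
  proof -
    have "E (\<lambda>x. q x * G x) = E (\<lambda>y. restr f y * E (\<lambda>x. q x * Pker n x y))"
      unfolding G_def by (rule integral_sep_swap[OF sep_Pker]) (rule int pint[OF that], assumption)+
    moreover have "(\<lambda>x. q x * Pker n x y) = (\<lambda>x. Pker n y x * q x)" for y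
      by (rule ext, subst Pker_commute, rule mult.commute)
    moreover have "(\<lambda>x. G x * q x) = (\<lambda>x. q x * G x)" by (rule ext, rule mult.commute)
    ultimately show ?thesis by simp
  qed
  have GV: "G \<in> orth_poly_space \<mu> n"
    unfolding orth_poly_space_iff using G Gq Pker_low by auto
  have proj: "?c * ball_inner \<mu> (\<lambda>x. f x - g x) h = E (\<lambda>y. restr f y * h y) - E (\<lambda>y. g y * h y)"
    if "g \<in> poly_space n" "h \<in> poly_space n" for g h
  proof -
    have "g \<in> borel_measurable borel"
      using poly_space_continuous[OF that(1)] by (rule borel_measurable_continuous_onI)
    then have "(\<lambda>y. restr f y - g y) \<in> borel_measurable lebesgue"
      using restr_measurable[OF f] by (intro borel_measurable_diff) (auto simp: measurable_completion)
    then have "?c * ball_inner \<mu> (\<lambda>x. f x - g x) h = E (\<lambda>y. (restr f y - g y) * h y)"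
      using poly_space_continuous[OF that(2)] by (intro ball_inner_eq_E) (auto simp: restr_def)
    also have "\<dots> = E (\<lambda>y. restr f y * h y) - E (\<lambda>y. g y * h y)"
      unfolding left_diff_distrib by (intro Bochner_Integration.integral_diff int[OF that(2)] pint[OF that])
    finally show ?thesis .
  qed
  show ?thesis
    unfolding orth_proj_def G_def[symmetric]
  proof (rule the_equality)
    show "G \<in> orth_poly_space \<mu> n \<and> (\<forall>h\<in>orth_poly_space \<mu> n. ball_inner \<mu> (\<lambda>x. f x - G x) h = 0)"
    proof (intro conjI ballI GV)
      fix h :: "real ^ 'd \<Rightarrow> real" assume h: "h \<in> orth_poly_space \<mu> n"
      then have hp: "h \<in> poly_space n" by (simp add: orth_poly_space_iff)
      have "?c * ball_inner \<mu> (\<lambda>x. f x - G x) h = 0"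
        unfolding proj[OF G hp] Gq[OF hp] Pker_reproduce[OF h] by simp
      then show "ball_inner \<mu> (\<lambda>x. f x - G x) h = 0" using c by simp
    qed
  next
    fix g :: "real ^ 'd \<Rightarrow> real" assume g: "g \<in> orth_poly_space \<mu> n \<and> (\<forall>h\<in>orth_poly_space \<mu> n. ball_inner \<mu> (\<lambda>x. f x - g x) h = 0)"
    then have gp: "g \<in> poly_space n" by (simp add: orth_poly_space_iff)
    show "g = G"
    proof
      fix x
      have P: "Pker n x \<in> orth_poly_space \<mu> n" by (rule Pker_orth)
      then have Pp: "Pker n x \<in> poly_space n" by (simp add: orth_poly_space_iff)
      have "E (\<lambda>y. restr f y * Pker n x y) - E (\<lambda>y. g y * Pker n x y) = 0"
        using proj[OF gp Pp] g P by simp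
      then show "g x = G x" using Pker_reproduce[of g n x] g by (simp add: G_def mult.commute)
    qed
  qed
qed

text \<open>For uniqueness, fix \<open>x\<close> in the ball. The difference of two kernels is then
  a polynomial in the second variable, orthogonal to every section \<open>Pker j z\<close>, since
  these are square integrable test functions; reproduction makes it vanish at every
  \<open>z\<close>. The defining formula is silent for \<open>x\<close> outside the ball, where
  vanishing follows because the difference is a polynomial in \<open>x\<close>.\<close>

lemma proj_kernel_eq: "proj_kernel \<mu> n = Pker n"
  unfolding proj_kernel_def
proof (rule the_equality)
  let ?c = "ball_const TYPE('d) \<mu>"
  have eqE: "?c * (LINT y:(cball 0 1)|lebesgue. f y * q y * ball_weight \<mu> y) = E (\<lambda>y. restr f y * q y)"
    if "f \<in> ball_L2 \<mu>" "continuous_on UNIV q" for f q :: "real ^ 'd \<Rightarrow> real"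
    using ball_inner_eq_E[OF restr_measurable[OF that(1)] that(2), of f] by (simp add: restr_def ball_inner_def)
  show "real_polynomial_function (\<lambda>z. Pker n (fst z) (snd z)) \<and>
    (\<forall>f\<in>ball_L2 \<mu>. \<forall>x\<in>cball 0 1. orth_proj \<mu> n f x = ?c * (LINT y:cball 0 1|lebesgue. f y * Pker n x y * ball_weight \<mu> y))"
    using sep_real_polynomial[OF sep_Pker] by (auto simp: eqE orth_proj_eq continuous_on_Pker)
  fix P :: "real ^ 'd \<Rightarrow> real ^ 'd \<Rightarrow> real"
  assume P: "real_polynomial_function (\<lambda>z. P (fst z) (snd z)) \<and>
    (\<forall>f\<in>ball_L2 \<mu>. \<forall>x\<in>cball 0 1. orth_proj \<mu> n f x = ?c * (LINT y:cball 0 1|lebesgue. f y * P x y * ball_weight \<mu> y))"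
  define D where "D x y = P x y - Pker n x y" for x y
  have Dpoly: "real_polynomial_function (\<lambda>z. D (fst z) (snd z))"
    unfolding D_def using P sep_real_polynomial[OF sep_Pker] by (intro real_polynomial_function_diff) auto
  have pf: "polynomial_function (\<lambda>y :: real ^ 'd. (x, y))" "polynomial_function (\<lambda>x :: real ^ 'd. (x, y))" for x y :: "real ^ 'd"
  proof -
    have "(\<lambda>y :: real ^ 'd. (x, y)) = (\<lambda>y. (x, 0) + (0, y))" "(\<lambda>x :: real ^ 'd. (x, y)) = (\<lambda>x. (0, y) + (x, 0))" by (simp_all add: fun_eq_iff)
    moreover have "polynomial_function (\<lambda>y. (x, 0 :: real ^ 'd) + (0 :: real ^ 'd, y))"
      by (intro polynomial_function_add polynomial_function_const polynomial_function_bounded_linear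
          bounded_linear_Pair bounded_linear_zero bounded_linear_ident)
    moreover have "polynomial_function (\<lambda>x. (0 :: real ^ 'd, y) + (x, 0 :: real ^ 'd))"
      by (intro polynomial_function_add polynomial_function_const polynomial_function_bounded_linear
          bounded_linear_Pair bounded_linear_zero bounded_linear_ident)
    ultimately show "polynomial_function (\<lambda>y :: real ^ 'd. (x, y))" "polynomial_function (\<lambda>x :: real ^ 'd. (x, y))" by simp_all
  qed
  have D1: "real_polynomial_function (\<lambda>y. D x y)" for x
    using real_polynomial_function_compose[OF pf(1) Dpoly, of x] by (simp add: o_def)
  have D2: "real_polynomial_function (\<lambda>x. D x y)" for y
    using real_polynomial_function_compose[OF pf(2) Dpoly, of y] by (simp add: o_def)
  have zero: "D x z = 0" if x: "norm x \<le> 1" for x z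
  proof -
    obtain N where N: "D x \<in> poly_space N" using real_polynomial_poly_space[OF D1[of x]] by auto
    have Pc: "continuous_on UNIV (P x)"
    proof -
      have "P x = (\<lambda>y. D x y + Pker n x y)" by (simp add: D_def fun_eq_iff)
      then show ?thesis using poly_space_continuous[OF N] by (simp add: continuous_on_add continuous_on_Pker)
    qed
    have "E (\<lambda>y. Pker j z y * D x y) = 0" for j
    proof -
      have L2: "Pker j z \<in> ball_L2 \<mu>" by (intro continuous_ball_L2 continuous_on_Pker)
      have "E (\<lambda>y. restr (Pker j z) y * P x y) = E (\<lambda>y. restr (Pker j z) y * Pker n x y)"
        using P x L2 orth_proj_eq[OF L2, of n] eqE[OF L2 Pc] by auto
      then have "E (\<lambda>y. restr (Pker j z) y * D x y) = 0"
        unfolding D_def right_diff_distrib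
        by (subst Bochner_Integration.integral_diff) (auto intro!: restr_integrable[OF L2] Pc continuous_on_Pker)
      then have "?c * ball_inner \<mu> (Pker j z) (D x) = 0"
        using ball_inner_eq_E[OF restr_measurable[OF L2] poly_space_continuous[OF N], of "Pker j z"] by (simp add: restr_def)
      then show ?thesis
        using ball_inner_poly[OF continuous_on_Pker poly_space_continuous[OF N]] by simp
    qed
    then show ?thesis using Pker_sum[OF N, of z] by simp
  qed
  have "D x z = 0" for x z
    by (rule real_polynomial_zero_ball[OF D2, of 1 0]) (auto intro!: zero)
  then show "P = Pker n" by (simp add: D_def fun_eq_iff)
qed

end

section \<open>Averaging and the final estimate\<close>

lemma has_bochner_integral_Beta:
  assumes "a > 0" "b > 0"
  shows "has_bochner_integral lborel (\<lambda>w::real. indicator {0..1} w * (w powr (a - 1) * (1 - w) powr (b - 1))) (Beta a b)"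
proof -
  have 1: "set_integrable lborel {0..1} (\<lambda>w. w powr (a - 1) * (1 - w) powr (b - 1))"
    by (rule integrable_Beta[OF assms])
  have "(LBINT w:{0..1}. w powr (a - 1) * (1 - w) powr (b - 1)) = Beta a b"
    using set_borel_integral_eq_integral(2)[OF 1] integral_unique[OF has_integral_Beta_real[OF assms]] by simp
  then show ?thesis using 1 by (simp add: has_bochner_integral_iff set_integrable_def set_lebesgue_integral_def)
qed

text \<open>The integrand is the derivative of \<open>w \<mapsto> (w / (1 + S * w)) powr \<mu> / \<mu>\<close>.\<close>

lemma has_bochner_integral_powr_kernel:
  assumes "\<mu> > 0" "S \<ge> 0"
  shows "has_bochner_integral lborel (\<lambda>w::real. indicator {0..1} w * (w powr (\<mu> - 1) * (1 + S * w) powr (- (\<mu> + 1)))) ((1 + S) powr (- \<mu>) / \<mu>)"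
proof -
  define F where "F w = w powr \<mu> * (1 + S * w) powr (- \<mu>) / \<mu>" for w
  define g where "g w = w powr (\<mu> - 1) * (1 + S * w) powr (- (\<mu> + 1))" for w
  have pos: "1 + S * w > 0" if "w \<ge> 0" for w using that assms by (intro add_pos_nonneg) auto
  have "(g has_integral (F 1 - F 0)) {0..1}"
  proof (rule fundamental_theorem_of_calculus_interior)
    show "continuous_on {0..1} F" unfolding F_def
      using pos assms by (intro continuous_intros continuous_on_powr') (auto, force)
    fix w :: real assume w: "w \<in> {0<..<1}"
    then have p: "1 + S * w > 0" "w > 0" using pos by auto
    have "(F has_real_derivative (\<mu> * w powr (\<mu> - 1) * (1 + S * w) powr (- \<mu>) + w powr \<mu> * (- \<mu> * (1 + S * w) powr (- \<mu> - 1) * S)) / \<mu>) (at w)"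
      unfolding F_def using p assms by (auto intro!: derivative_eq_intros simp: mult_ac)
    also have "(\<mu> * w powr (\<mu> - 1) * (1 + S * w) powr (- \<mu>) + w powr \<mu> * (- \<mu> * (1 + S * w) powr (- \<mu> - 1) * S)) / \<mu> = g w"
    proof -
      have 1: "w powr \<mu> = w powr (\<mu> - 1) * w" using p by (simp add: powr_diff)
      have 2: "(1 + S * w) powr (- \<mu>) = (1 + S * w) powr (- (\<mu> + 1)) * (1 + S * w)"
        using p powr_add[of "1 + S * w" "- (\<mu> + 1)" 1] by simp
      have 3: "- \<mu> - 1 = - (\<mu> + 1)" by simp
      show ?thesis unfolding 1 2 3 g_def using assms by (simp add: algebra_simps add_divide_distrib diff_divide_distrib)
    qed
    finally show "(F has_vector_derivative g w) (at w)" by (simp add: has_real_derivative_iff_has_vector_derivative)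
  qed simp
  moreover have "F 1 - F 0 = (1 + S) powr (- \<mu>) / \<mu>" by (simp add: F_def)
  ultimately have hi: "(g has_integral ((1 + S) powr (- \<mu>) / \<mu>)) {0..1}" by simp
  have g0: "g w \<ge> 0" for w by (simp add: g_def)
  have ai: "g absolutely_integrable_on {0..1}"
    using hi g0 by (intro nonnegative_absolutely_integrable_1) (auto intro: has_integral_integrable)
  have gm: "(\<lambda>w. indicator {0..1} w * g w) \<in> borel_measurable borel"
    unfolding g_def by measurable
  have "integrable lebesgue (\<lambda>w. indicator {0..1} w * g w)"
    using ai by (simp add: set_integrable_def)
  then have "integrable lborel (\<lambda>w. indicator {0..1} w * g w)"
    using gm by (simp add: integrable_completion)
  moreover have "integral\<^sup>L lborel (\<lambda>w. indicator {0..1} w * g w) = (1 + S) powr (- \<mu>) / \<mu>"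
  proof -
    have "(LINT w:{0..1}|lebesgue. g w) = (1 + S) powr (- \<mu>) / \<mu>"
      using set_lebesgue_integral_eq_integral(2)[OF ai] integral_unique[OF hi] by simp
    then show ?thesis using gm by (simp add: set_lebesgue_integral_def integral_completion)
  qed
  ultimately show ?thesis by (simp add: has_bochner_integral_iff g_def)
qed

text \<open>Substituting \<open>u = \<plusminus> sqrt (1 - w)\<close> turns the normalised weight \<open>(1 - u\<^sup>2) powr (\<mu> - 1)\<close> on
  \<open>[-1, 1]\<close> into a Beta density in \<open>w\<close>; for \<open>\<mu> = 0\<close> it degenerates to the point mass at \<open>w = 0\<close>.\<close>

lemma averaging_measure:
  fixes \<mu> :: real
  assumes "\<mu> \<ge> 0"
  obtains \<nu> :: "real measure" and C where "prob_space \<nu>" "sets \<nu> = sets borel" "AE w in \<nu>. 0 \<le> w \<and> w \<le> 1"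
    "\<And>k. integral\<^sup>L \<nu> (\<lambda>w. (1 - w) ^ k) = umom \<mu> k" "C > 0"
    "\<And>S. S \<ge> 0 \<Longrightarrow> integral\<^sup>L \<nu> (\<lambda>w. (1 + S * w) powr (- (\<mu> + 1))) \<le> C * (1 + S) powr (- \<mu>)"
proof (cases "\<mu> = 0")
  case True
  have ret: "integral\<^sup>L (return borel (0::real)) f = f 0" if "f \<in> borel_measurable borel" for f :: "real \<Rightarrow> real"
    using that by (intro integral_return) auto
  show ?thesis
  proof (rule that[of "return borel 0" 1])
    show "AE w in return borel (0::real). 0 \<le> w \<and> w \<le> 1" by (subst AE_return) auto
    show "integral\<^sup>L (return borel (0::real)) (\<lambda>w. (1 - w) ^ k) = umom \<mu> k" for k
    proof -
      have "pochhammer (1/2 :: real) k > 0" by (intro pochhammer_pos) auto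
      then show ?thesis using True by (subst ret) (auto simp: umom_def)
    qed
    show "integral\<^sup>L (return borel (0::real)) (\<lambda>w. (1 + S * w) powr (- (\<mu> + 1))) \<le> 1 * (1 + S) powr (- \<mu>)" if "S \<ge> 0" for S
      using that True by (subst ret) auto
  qed (auto intro: prob_space_return)
next
  case False
  then have mu: "\<mu> > 0" using assms by simp
  define B where "B = Beta \<mu> (1/2)"
  have B: "B > 0" using mu by (auto simp: B_def Beta_def intro!: divide_pos_pos mult_pos_pos Gamma_real_pos)
  define f where "f w = indicator {0..1} w * (w powr (\<mu> - 1) * (1 - w) powr (- 1/2)) / B" for w :: real
  define \<nu> where "\<nu> = density lborel (\<lambda>w. ennreal (f w))"
  have f0: "f w \<ge> 0" for w using B by (simp add: f_def)
  have [measurable]: "f \<in> borel_measurable borel" unfolding f_def by measurable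
  have mom: "has_bochner_integral lborel (\<lambda>w. f w * (1 - w) ^ k) (umom \<mu> k)" for k
  proof -
    have "has_bochner_integral lborel (\<lambda>w::real. (indicator {0..1} w * (w powr (\<mu> - 1) * (1 - w) powr (real k + 1/2 - 1))) / B) (Beta \<mu> (real k + 1/2) / B)"
      using mu by (intro has_bochner_integral_divide_zero has_bochner_integral_Beta) (auto intro: add_nonneg_pos)
    moreover have "(indicator {0..1} w * (w powr (\<mu> - 1) * (1 - w) powr (real k + 1/2 - 1))) / B = f w * (1 - w) ^ k" for w :: real
    \<comment> \<open>At \<open>w = 1\<close> both sides are 0 because
      \<open>0 powr a = 0\<close>.\<close>
    proof (cases "w = 1")
      case False
      have "(1 - w) powr (real k + 1/2 - 1) = (1 - w) powr (- 1/2) * (1 - w) ^ k" if "w \<le> 1"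
        using that False powr_add[of "1 - w" "- 1/2" "real k"] by (simp add: powr_realpow add.commute)
      then show ?thesis by (auto simp: f_def indicator_def)
    qed (simp add: f_def)
    moreover have "Beta \<mu> (real k + 1/2) / B = umom \<mu> k"
    proof -
      have "pochhammer (1/2 :: real) k = Gamma (1/2 + real k) / Gamma (1/2)"
        by (intro pochhammer_Gamma) (auto elim!: nonpos_Ints_cases)
      moreover have "pochhammer (\<mu> + 1/2) k = Gamma (\<mu> + 1/2 + real k) / Gamma (\<mu> + 1/2)"
        using mu by (intro pochhammer_Gamma) (auto elim!: nonpos_Ints_cases)
      moreover have "Gamma \<mu> > 0" "Gamma (\<mu> + 1/2) > 0" "Gamma (\<mu> + 1/2 + real k) > 0" "Gamma (1/2 :: real) > 0"
        using mu by (auto intro!: Gamma_real_pos add_pos_nonneg simp del: Gamma_one_half_real)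
      ultimately show ?thesis unfolding B_def umom_def Beta_def
        by (simp add: add_ac del: Gamma_one_half_real)
    qed
    ultimately show ?thesis by simp
  qed
  have int\<nu>: "integral\<^sup>L \<nu> h = integral\<^sup>L lborel (\<lambda>w. f w * h w)" if "h \<in> borel_measurable borel" for h :: "real \<Rightarrow> real"
    unfolding \<nu>_def using that f0 by (subst integral_density) auto
  define C where "C = sqrt 2 / (\<mu> * B) + 2 powr \<mu>"
  show ?thesis
  proof (rule that[of \<nu> C])
    have "emeasure \<nu> (space \<nu>) = (\<integral>\<^sup>+w. ennreal (f w) \<partial>lborel)"
      unfolding \<nu>_def by (subst emeasure_density) auto
    also have "\<dots> = ennreal (integral\<^sup>L lborel (\<lambda>w. f w * (1 - w) ^ 0))"
      using mom[of 0] f0 by (subst nn_integral_eq_integral) (auto simp: has_bochner_integral_iff)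
    also have "\<dots> = 1" using has_bochner_integral_integral_eq[OF mom[of 0]] by (simp add: umom_def)
    finally show "prob_space \<nu>" by (rule prob_spaceI)
    show "sets \<nu> = sets borel" by (simp add: \<nu>_def)
    show "AE w in \<nu>. 0 \<le> w \<and> w \<le> 1" unfolding \<nu>_def
      by (subst AE_density) (auto simp: f_def indicator_def split: if_splits)
    show "integral\<^sup>L \<nu> (\<lambda>w. (1 - w) ^ k) = umom \<mu> k" for k
      using has_bochner_integral_integral_eq[OF mom[of k]] by (subst int\<nu>) auto
    show "C > 0" using B mu by (auto simp: C_def intro!: add_pos_pos divide_pos_pos)
    fix S :: real assume S: "S \<ge> 0"
    \<comment> \<open>A majorant split at \<open>w = 1/2\<close>. To the left,
      \<open>(1 - w) powr (- 1/2) \<le> sqrt 2\<close> and the explicit integral applies; to the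
      right, \<open>1 + S * w\<close> is at least \<open>1 + S / 2\<close> and the total mass,
      written as the moment of exponent 0, is 1.\<close>
    define G where "G w = (sqrt 2 / B) * (indicator {0..1} w * (w powr (\<mu> - 1) * (1 + S * w) powr (- (\<mu> + 1)))) + (1 + S / 2) powr (- (\<mu> + 1)) * (f w * (1 - w) ^ 0)" for w :: real
    have G: "has_bochner_integral lborel G ((sqrt 2 / B) * ((1 + S) powr (- \<mu>) / \<mu>) + (1 + S / 2) powr (- (\<mu> + 1)) * umom \<mu> 0)"
      unfolding G_def using mu S by (intro has_bochner_integral_add has_bochner_integral_mult_right has_bochner_integral_powr_kernel mom)
    have fG: "f w * (1 + S * w) powr (- (\<mu> + 1)) \<le> G w" for w
    proof (cases "w \<in> {0..1}")
      case True
      then have w: "0 \<le> w" "w \<le> 1" by auto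
      have nn: "(1 + S / 2) powr (- (\<mu> + 1)) * (f w * (1 - w) ^ 0) \<ge> 0"
        "(sqrt 2 / B) * (indicator {0..1} w * (w powr (\<mu> - 1) * (1 + S * w) powr (- (\<mu> + 1)))) \<ge> 0"
        using f0 B by auto
      show ?thesis
      proof (cases "w \<le> 1/2")
        case True
        have "(1 - w) powr (- 1/2) \<le> (1/2) powr (- 1/2)" using True by (intro powr_mono2') auto
        also have "(1/2 :: real) powr (- 1/2) = sqrt 2"
          by (simp add: powr_half_sqrt[symmetric] powr_divide powr_minus_divide)
        finally have "w powr (\<mu> - 1) * (1 - w) powr (- 1/2) / B * (1 + S * w) powr (- (\<mu> + 1)) \<le> w powr (\<mu> - 1) * sqrt 2 / B * (1 + S * w) powr (- (\<mu> + 1))"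
          using B by (intro mult_right_mono divide_right_mono mult_left_mono) auto
        then have "f w * (1 + S * w) powr (- (\<mu> + 1)) \<le> (sqrt 2 / B) * (indicator {0..1} w * (w powr (\<mu> - 1) * (1 + S * w) powr (- (\<mu> + 1))))"
          using w by (simp add: f_def mult_ac)
        then show ?thesis unfolding G_def using nn by linarith
      next
        case False
        have "S * (1/2) \<le> S * w" using False S by (intro mult_left_mono) auto
        then have "(1 + S * w) powr (- (\<mu> + 1)) \<le> (1 + S / 2) powr (- (\<mu> + 1))"
          using S mu by (intro powr_mono2') auto
        then have "f w * (1 + S * w) powr (- (\<mu> + 1)) \<le> f w * (1 + S / 2) powr (- (\<mu> + 1))"
          using f0 by (intro mult_left_mono)
        then show ?thesis unfolding G_def using nn by (simp add: mult.commute)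
      qed
    next
      case False
      then show ?thesis using f0[of w] by (auto simp: f_def G_def indicator_def)
    qed
    have "integrable lborel (\<lambda>w. f w * (1 + S * w) powr (- (\<mu> + 1)))"
      by (rule Bochner_Integration.integrable_bound[of _ G])
        (use G fG f0 in \<open>auto simp: has_bochner_integral_iff abs_of_nonneg intro!: AE_I2 intro: order.trans[OF _ abs_ge_self]\<close>)
    then have "integral\<^sup>L lborel (\<lambda>w. f w * (1 + S * w) powr (- (\<mu> + 1))) \<le> integral\<^sup>L lborel G"
      using G fG by (intro integral_mono) (auto simp: has_bochner_integral_iff)
    also have "\<dots> = sqrt 2 / (\<mu> * B) * (1 + S) powr (- \<mu>) + (1 + S / 2) powr (- (\<mu> + 1))"
      using G by (simp add: has_bochner_integral_iff umom_def mult_ac)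
    \<comment> \<open>One unit of the exponent is given away, and
      \<open>1 + S / 2 \<ge> (1 + S) / 2\<close>; this is the summand \<open>2 powr \<mu>\<close> of
      \<open>C\<close>.\<close>
    also have "(1 + S / 2) powr (- (\<mu> + 1)) \<le> 2 powr \<mu> * (1 + S) powr (- \<mu>)"
    proof -
      have "(1 + S / 2) powr (- (\<mu> + 1)) \<le> (1 + S / 2) powr (- \<mu>)"
        using S by (intro powr_mono) auto
      also have "\<dots> \<le> ((1 + S) / 2) powr (- \<mu>)" using S mu by (intro powr_mono2') auto
      also have "\<dots> = 2 powr \<mu> * (1 + S) powr (- \<mu>)" using S by (simp add: powr_divide powr_minus field_simps)
      finally show ?thesis .
    qed
    finally show "integral\<^sup>L \<nu> (\<lambda>w. (1 + S * w) powr (- (\<mu> + 1))) \<le> C * (1 + S) powr (- \<mu>)"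
      by (subst int\<nu>) (auto simp: C_def distrib_right)
  qed
qed

lemma sum_even_terms: "(\<Sum>i\<le>2 * N. if even i then f i else 0) = (\<Sum>k\<le>N. f (2 * k))" for f :: "nat \<Rightarrow> real"
  by (induction N) auto

lemma binomial_even_part:
  "((A + z) ^ N + (A - z) ^ N) / 2 = (\<Sum>k\<le>N. real (N choose (2 * k)) * A ^ (N - 2 * k) * z ^ (2 * k))" for A z :: real
proof -
  have b: "(A + z) ^ N = (\<Sum>i\<le>2 * N. real (N choose i) * z ^ i * A ^ (N - i))" for z
  proof -
    have "(z + A) ^ N = (\<Sum>i\<le>2 * N. real (N choose i) * z ^ i * A ^ (N - i))"
      unfolding binomial_ring by (rule sum.mono_neutral_left) (auto simp: binomial_eq_0)
    then show ?thesis by (simp add: add.commute)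
  qed
  have "((A + z) ^ N + (A - z) ^ N) / 2 = (\<Sum>i\<le>2 * N. if even i then real (N choose i) * A ^ (N - i) * z ^ i else 0)"
    using b[of z] b[of "- z"]
    by (simp add: sum.distrib[symmetric] sum_divide_distrib) (rule sum.cong, auto simp: field_simps)
  then show ?thesis unfolding sum_even_terms .
qed

text \<open>On \<open>[0, 2]\<close> the bound \<open>sin x \<ge> x - x^3 / 6\<close> together with
  \<open>x^2 \<le> 4\<close> gives \<open>sin x \<ge> x / 3\<close>. With
  \<open>x = \<theta> / 2\<close> the right side is
  \<open>2 * (sin x)^2 \<ge> 2 * (\<theta> / 6)^2\<close>.\<close>

lemma one_minus_cos_ge:
  assumes "0 \<le> \<theta>" "\<theta> \<le> pi"
  shows "\<theta>\<^sup>2 / 18 \<le> 1 - cos \<theta>"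
proof -
  define x where "x = \<theta> / 2"
  have x: "0 \<le> x" "x \<le> 2" using assms pi_less_4 by (auto simp: x_def)
  have "\<bar>sin x - (\<Sum>m<3. sin_coeff m * x ^ m)\<bar> \<le> inverse (fact 3) * \<bar>x\<bar> ^ 3"
    by (rule Maclaurin_sin_bound)
  moreover have "(\<Sum>m<3. sin_coeff m * x ^ m) = x"
    by (simp add: numeral_3_eq_3 sin_coeff_def)
  moreover have "\<bar>x\<bar> ^ 3 = x * x\<^sup>2" using x by (simp add: numeral_3_eq_3 power2_eq_square)
  ultimately have "sin x \<ge> x - x * x\<^sup>2 / 6" by (simp add: fact_numeral abs_if split: if_splits)
  moreover have "x\<^sup>2 \<le> 4" using x power_mono[of x 2 2] by simp
  then have "x * x\<^sup>2 \<le> x * 4" using x by (intro mult_left_mono) auto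
  ultimately have "x / 3 \<le> sin x" by linarith
  then have "(x / 3)\<^sup>2 \<le> (sin x)\<^sup>2" using x by (intro power_mono) auto
  moreover have "cos \<theta> = 1 - 2 * (sin x)\<^sup>2" using cos_double_sin[of x] by (simp add: x_def)
  ultimately show ?thesis by (simp add: x_def power2_eq_square)
qed

lemma one_minus_cos_le: "1 - cos \<theta> \<le> \<theta>\<^sup>2 / 2" for \<theta> :: real
proof -
  have "\<bar>sin (\<theta> / 2)\<bar>\<^sup>2 \<le> \<bar>\<theta> / 2\<bar>\<^sup>2" by (intro power_mono abs_sin_x_le_abs_x) auto
  moreover have "cos \<theta> = 1 - 2 * (sin (\<theta> / 2))\<^sup>2" using cos_double_sin[of "\<theta> / 2"] by simp
  ultimately show ?thesis by (simp add: power2_eq_square)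
qed

context ball_setting
begin

lemma needlet_kernel_eq:
  fixes x y :: "real ^ 'd"
  assumes "admissible a" "n \<ge> 1"
  shows "needlet_kernel a \<mu> n x y = (\<Sum>j\<le>2 * n. a (real j / real n) * gegw l j * pker \<mu> (geg l j) x y)"
proof -
  have "a (real j / real n) = 0" if "j \<notin> {..2 * n}" for j
  proof -
    have "real j / real n > 2" using that assms(2) by (simp add: field_simps flip: of_nat_mult)
    then show ?thesis by (rule admissible_vanish[OF assms(1)])
  qed
  then have "needlet_kernel a \<mu> n x y = (\<Sum>j\<le>2 * n. a (real j / real n) * proj_kernel \<mu> j x y)"
    unfolding needlet_kernel_def by (intro suminf_finite) auto
  then show ?thesis by (simp add: proj_kernel_eq Pker_def mult.assoc)
qed

text \<open>\<open>(x, A)\<close> and \<open>(y, B)\<close> are unit vectors in one more dimension.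
  The two identities used are the squared lengths of their difference and of the sum of
  \<open>(x, A)\<close> with the reflected lift \<open>(y, -B)\<close>.\<close>

lemma unit_lift_bounds:
  fixes x y :: "real ^ 'd" and u :: real
  assumes x: "norm x \<le> 1" and y: "norm y \<le> 1" and u: "\<bar>u\<bar> \<le> 1"
  defines "A \<equiv> sqrt (1 - (norm x)\<^sup>2)" and "B \<equiv> sqrt (1 - (norm y)\<^sup>2)"
  shows "\<bar>x \<bullet> y + u * (A * B)\<bar> \<le> 1" "(A - B)\<^sup>2 \<le> 2 * (1 - (x \<bullet> y + A * B))"
proof -
  have nn: "A \<ge> 0" "B \<ge> 0" using x y by (auto simp: A_def B_def power_le_one)
  have sq: "A\<^sup>2 = 1 - x \<bullet> x" "B\<^sup>2 = 1 - y \<bullet> y"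
    using x y by (simp_all add: A_def B_def power_le_one power2_norm_eq_inner[symmetric])
  have 1: "2 * (1 - (x \<bullet> y + A * B)) = (x - y) \<bullet> (x - y) + (A - B)\<^sup>2"
    using sq by (simp add: inner_diff_left inner_diff_right inner_commute power2_diff)
  have 2: "2 * (1 + (x \<bullet> y - A * B)) = (x + y) \<bullet> (x + y) + (A - B)\<^sup>2"
    using sq by (simp add: inner_add_left inner_add_right inner_commute power2_diff)
  show "(A - B)\<^sup>2 \<le> 2 * (1 - (x \<bullet> y + A * B))" unfolding 1 by simp
  have "\<bar>u * (A * B)\<bar> \<le> A * B" using u nn by (simp add: abs_mult mult_left_le_one_le)
  moreover have "x \<bullet> y + A * B \<le> 1"
  proof -
    have "0 \<le> 2 * (1 - (x \<bullet> y + A * B))" unfolding 1 by simp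
    then show ?thesis by simp
  qed
  moreover have "x \<bullet> y - A * B \<ge> -1"
  proof -
    have "0 \<le> 2 * (1 + (x \<bullet> y - A * B))" unfolding 2 by simp
    then show ?thesis by simp
  qed
  ultimately show "\<bar>x \<bullet> y + u * (A * B)\<bar> \<le> 1" by linarith
qed

text \<open>This realises the formal mean: \<open>u\<close> takes both signs of
  \<open>sqrt (1 - w)\<close>, so odd powers cancel pointwise, and \<open>u^2 = 1 - w\<close> has
  the moments \<open>umom\<close>.\<close>

lemma avg_eq_integral:
  fixes \<nu> :: "real measure"
  assumes "prob_space \<nu>" and sets: "sets \<nu> = sets borel" and AE: "AE w in \<nu>. 0 \<le> w \<and> w \<le> 1"
    and mom: "\<And>k. integral\<^sup>L \<nu> (\<lambda>w. (1 - w) ^ k) = umom \<mu> k"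
  shows "integral\<^sup>L \<nu> (\<lambda>w. ((A + sqrt (1 - w) * z) ^ N + (A - sqrt (1 - w) * z) ^ N) / 2) = avg \<mu> N A (z\<^sup>2)"
proof -
  interpret prob_space \<nu> by fact
  have int: "integrable \<nu> (\<lambda>w. (1 - w) ^ k)" for k
  proof (rule integrable_const_bound[where B=1])
    show "AE w in \<nu>. norm ((1 - w) ^ k) \<le> 1" using AE
      by eventually_elim (auto intro!: power_le_one simp: abs_of_nonneg)
  qed (simp add: sets cong: measurable_cong_sets)
  have "integral\<^sup>L \<nu> (\<lambda>w. ((A + sqrt (1 - w) * z) ^ N + (A - sqrt (1 - w) * z) ^ N) / 2)
    = integral\<^sup>L \<nu> (\<lambda>w. \<Sum>k\<le>N. real (N choose (2 * k)) * A ^ (N - 2 * k) * (z\<^sup>2) ^ k * (1 - w) ^ k)"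
  proof (rule integral_cong_AE)
    show "AE w in \<nu>. ((A + sqrt (1 - w) * z) ^ N + (A - sqrt (1 - w) * z) ^ N) / 2
      = (\<Sum>k\<le>N. real (N choose (2 * k)) * A ^ (N - 2 * k) * (z\<^sup>2) ^ k * (1 - w) ^ k)"
      using AE
    proof eventually_elim
      case (elim w)
      then have "(sqrt (1 - w) * z) ^ (2 * k) = (z\<^sup>2) ^ k * (1 - w) ^ k" for k
        by (simp only: power_mult power_mult_distrib) (simp add: mult.commute)
      then show ?case unfolding binomial_even_part by (simp add: mult.assoc)
    qed
  qed (simp_all add: sets cong: measurable_cong_sets)
  also have "\<dots> = (\<Sum>k\<le>N. real (N choose (2 * k)) * A ^ (N - 2 * k) * (z\<^sup>2) ^ k * umom \<mu> k)"
    using int mom by (subst Bochner_Integration.integral_sum) auto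
  finally show ?thesis by (simp add: avg_def mult_ac)
qed

lemma needlet_kernel_integral:
  fixes x y :: "real ^ 'd" and \<nu> :: "real measure"
  assumes "admissible a" "n \<ge> 1" "norm x \<le> 1" "norm y \<le> 1"
    and "prob_space \<nu>" and sets: "sets \<nu> = sets borel" and AE: "AE w in \<nu>. 0 \<le> w \<and> w \<le> 1"
    and mom: "\<And>k. integral\<^sup>L \<nu> (\<lambda>w. (1 - w) ^ k) = umom \<mu> k"
  defines "z \<equiv> sqrt (1 - (norm x)\<^sup>2) * sqrt (1 - (norm y)\<^sup>2)"
  shows "needlet_kernel a \<mu> n x y
    = integral\<^sup>L \<nu> (\<lambda>w. (gker a l n (x \<bullet> y + sqrt (1 - w) * z) + gker a l n (x \<bullet> y - sqrt (1 - w) * z)) / 2)"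
proof -
  interpret prob_space \<nu> by fact
  have z2: "z\<^sup>2 = (1 - (norm x)\<^sup>2) * (1 - (norm y)\<^sup>2)"
    using assms(3,4) by (simp add: z_def power_mult_distrib power_le_one)
  have int: "integrable \<nu> (\<lambda>w. h (sqrt (1 - w)))" if h: "continuous_on UNIV h" for h :: "real \<Rightarrow> real"
  proof -
    have "compact (h ` {0..1})" by (rule compact_continuous_image[OF continuous_on_subset[OF h]]) auto
    then obtain M where M: "\<And>s. s \<in> {0..1} \<Longrightarrow> norm (h s) \<le> M"
      using compact_imp_bounded bounded_iff by (metis imageI)
    have hm[measurable]: "h \<in> borel_measurable borel" using h by (rule borel_measurable_continuous_onI)
    show ?thesis
    proof (rule integrable_const_bound[where B=M])
      show "AE w in \<nu>. norm (h (sqrt (1 - w))) \<le> M" using AE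
        by eventually_elim (rule M, auto)
      have "(\<lambda>w. h (sqrt (1 - w))) \<in> borel_measurable borel" by measurable
      then show "(\<lambda>w. h (sqrt (1 - w))) \<in> borel_measurable \<nu>" by (simp add: sets cong: measurable_cong_sets)
    qed
  qed
  have intp: "integrable \<nu> (\<lambda>w. (poly g (x \<bullet> y + sqrt (1 - w) * z) + poly g (x \<bullet> y - sqrt (1 - w) * z)) / 2)" for g
    by (rule int[of "\<lambda>s. (poly g (x \<bullet> y + s * z) + poly g (x \<bullet> y - s * z)) / 2"]) (intro continuous_intros, simp)
  have intm: "integrable \<nu> (\<lambda>w. ((x \<bullet> y + sqrt (1 - w) * z) ^ p + (x \<bullet> y - sqrt (1 - w) * z) ^ p) / 2)" for p
    by (rule int[of "\<lambda>s. ((x \<bullet> y + s * z) ^ p + (x \<bullet> y - s * z) ^ p) / 2"]) (intro continuous_intros, simp)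
  have pk: "pker \<mu> g x y = integral\<^sup>L \<nu> (\<lambda>w. (poly g (x \<bullet> y + sqrt (1 - w) * z) + poly g (x \<bullet> y - sqrt (1 - w) * z)) / 2)" for g
  proof -
    have "integral\<^sup>L \<nu> (\<lambda>w. (poly g (x \<bullet> y + sqrt (1 - w) * z) + poly g (x \<bullet> y - sqrt (1 - w) * z)) / 2)
      = integral\<^sup>L \<nu> (\<lambda>w. \<Sum>p\<le>degree g. coeff g p * (((x \<bullet> y + sqrt (1 - w) * z) ^ p + (x \<bullet> y - sqrt (1 - w) * z) ^ p) / 2))"
      unfolding poly_altdef sum.distrib[symmetric] sum_divide_distrib by (simp add: algebra_simps add_divide_distrib)
    also have "\<dots> = (\<Sum>p\<le>degree g. coeff g p * integral\<^sup>L \<nu> (\<lambda>w. ((x \<bullet> y + sqrt (1 - w) * z) ^ p + (x \<bullet> y - sqrt (1 - w) * z) ^ p) / 2))"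
      by (subst Bochner_Integration.integral_sum) (intro integrable_mult_right intm, simp only: integral_mult_right_zero)
    also have "\<dots> = pker \<mu> g x y"
      unfolding avg_eq_integral[OF \<open>prob_space \<nu>\<close> sets AE mom] pker_def z2 ..
    finally show ?thesis by simp
  qed
  have "needlet_kernel a \<mu> n x y = (\<Sum>j\<le>2 * n. integral\<^sup>L \<nu> (\<lambda>w. a (real j / real n) * gegw l j *
     ((poly (geg l j) (x \<bullet> y + sqrt (1 - w) * z) + poly (geg l j) (x \<bullet> y - sqrt (1 - w) * z)) / 2)))"
    unfolding needlet_kernel_eq[OF assms(1,2)] pk by simp
  also have "\<dots> = integral\<^sup>L \<nu> (\<lambda>w. \<Sum>j\<le>2 * n. a (real j / real n) * gegw l j *
     ((poly (geg l j) (x \<bullet> y + sqrt (1 - w) * z) + poly (geg l j) (x \<bullet> y - sqrt (1 - w) * z)) / 2))"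
    by (rule Bochner_Integration.integral_sum[symmetric]) (intro integrable_mult_right intp)
  also have "\<dots> = integral\<^sup>L \<nu> (\<lambda>w. (gker a l n (x \<bullet> y + sqrt (1 - w) * z) + gker a l n (x \<bullet> y - sqrt (1 - w) * z)) / 2)"
    unfolding gker_def sum.distrib[symmetric] sum_divide_distrib by (simp add: algebra_simps add_divide_distrib)
  finally show ?thesis .
qed

text \<open>The one-dimensional bound is used with exponent \<open>2 * m\<close> and split into
  halves. One half keeps the localisation in \<open>1 - (x \<bullet> y + z)\<close>; the other is at
  least \<open>\<mu> + 1\<close> and is spent on the averaging variable, where it integrates to the
  power \<open>-\<mu>\<close>.\<close>

lemma localized_average_bound:
  assumes "admissible a" "real m \<ge> \<mu> + 1"
  shows "\<exists>C>0. \<forall>n\<ge>1. \<forall>x y :: real ^ 'd. norm x \<le> 1 \<longrightarrow> norm y \<le> 1 \<longrightarrow>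
    (let z = sqrt (1 - (norm x)\<^sup>2) * sqrt (1 - (norm y)\<^sup>2)
     in \<bar>needlet_kernel a \<mu> n x y\<bar>
       \<le> C * real n powr (2 * l + 1) * (1 + real n ^ 2 * z / 2) powr (- \<mu>) / (1 + real n ^ 2 * (1 - (x \<bullet> y + z))) ^ m)"
proof -
  obtain C1 where C1: "C1 > 0" "\<And>n t. n \<ge> 1 \<Longrightarrow> \<bar>t\<bar> \<le> 1 \<Longrightarrow>
      (1 + real n ^ 2 * (1 - t)) ^ (2 * m) * \<bar>gker a l n t\<bar> \<le> C1 * real n powr (2 * l + 1)"
    using gker_localized[OF l_half assms(1) geg_le_one, of "2 * m"] by metis
  obtain \<nu> :: "real measure" and C2 where nu: "prob_space \<nu>" "sets \<nu> = sets borel" "AE w in \<nu>. 0 \<le> w \<and> w \<le> 1"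
    "\<And>k. integral\<^sup>L \<nu> (\<lambda>w. (1 - w) ^ k) = umom \<mu> k" and C2: "C2 > 0"
    "\<And>S. S \<ge> 0 \<Longrightarrow> integral\<^sup>L \<nu> (\<lambda>w. (1 + S * w) powr (- (\<mu> + 1))) \<le> C2 * (1 + S) powr (- \<mu>)"
    using averaging_measure[OF mu] by blast
  interpret prob_space \<nu> by (rule nu)
  have main: "\<bar>needlet_kernel a \<mu> n x y\<bar>
       \<le> (C1 * C2) * real n powr (2 * l + 1) * (1 + real n ^ 2 * z / 2) powr (- \<mu>) / (1 + real n ^ 2 * (1 - (x \<bullet> y + z))) ^ m"
    if n: "n \<ge> 1" and x: "norm x \<le> 1" and y: "norm y \<le> 1"
      and z: "z = sqrt (1 - (norm x)\<^sup>2) * sqrt (1 - (norm y)\<^sup>2)" for n z and x y :: "real ^ 'd"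
  proof -
    define X where "X = C1 * real n powr (2 * l + 1)"
    define D where "D = 1 - (x \<bullet> y + z)"
    define S where "S = real n ^ 2 * z / 2"
    have z0: "z \<ge> 0" unfolding z using x y by (intro mult_nonneg_nonneg) (auto simp: power_le_one)
    have S0: "S \<ge> 0" using z0 by (simp add: S_def)
    have D0: "D \<ge> 0" using unit_lift_bounds(1)[OF x y, of 1] z by (simp add: D_def)
    have X0: "X \<ge> 0" using C1 by (simp add: X_def)
    \<comment> \<open>\<open>u\<close> stands for either sign of \<open>sqrt (1 - w)\<close>. Both
      satisfy \<open>1 - u \<ge> w / 2\<close>, which suffices to bound
      \<open>1 - t = D + z * (1 - u)\<close> from below by \<open>z * w / 2\<close> as well as by
      \<open>D\<close>.\<close>
    have pw: "\<bar>gker a l n (x \<bullet> y + u * z)\<bar> \<le> X / (1 + real n ^ 2 * D) ^ m * (1 + S * w) powr (- (\<mu> + 1))"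
      if w: "0 \<le> w" "w \<le> 1" and u: "\<bar>u\<bar> \<le> 1" "1 - u \<ge> w / 2" for u w
    proof -
      define t where "t = x \<bullet> y + u * z"
      have t1: "\<bar>t\<bar> \<le> 1" using unit_lift_bounds(1)[OF x y u(1)] by (simp add: t_def z)
      have 1: "1 - t = D + z * (1 - u)" by (simp add: t_def D_def algebra_simps)
      have a1: "1 + real n ^ 2 * D \<le> 1 + real n ^ 2 * (1 - t)"
        unfolding 1 using z0 u by (intro add_left_mono mult_left_mono) auto
      have a2: "1 + S * w \<le> 1 + real n ^ 2 * (1 - t)"
      proof -
        have "z * (w / 2) \<le> z * (1 - u)" using z0 u by (intro mult_left_mono) auto
        then have "real n ^ 2 * (z * (w / 2)) \<le> real n ^ 2 * (1 - t)"
          unfolding 1 using D0 by (intro mult_left_mono) auto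
        then show ?thesis by (simp add: S_def)
      qed
      have p1: "1 + real n ^ 2 * D \<ge> 1" "1 + S * w \<ge> 1" using D0 S0 w by auto
      have "(1 + S * w) powr (\<mu> + 1) \<le> (1 + S * w) powr real m"
        using p1 assms(2) by (intro powr_mono) auto
      then have "(1 + S * w) powr (\<mu> + 1) \<le> (1 + S * w) ^ m" using p1 by (simp add: powr_realpow)
      then have "(1 + real n ^ 2 * D) ^ m * (1 + S * w) powr (\<mu> + 1) \<le> (1 + real n ^ 2 * (1 - t)) ^ m * (1 + real n ^ 2 * (1 - t)) ^ m"
        using a1 a2 p1 by (intro mult_mono power_mono order.trans[OF _ power_mono[OF a2]]) auto
      also have "\<dots> = (1 + real n ^ 2 * (1 - t)) ^ (2 * m)" by (simp add: power_add[symmetric] mult_2)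
      finally have "(1 + real n ^ 2 * D) ^ m * (1 + S * w) powr (\<mu> + 1) * \<bar>gker a l n t\<bar> \<le> X"
        using C1(2)[OF n t1] unfolding X_def by (meson abs_ge_zero mult_right_mono order.trans)
      moreover have "(1 + real n ^ 2 * D) ^ m > 0" "(1 + S * w) powr (\<mu> + 1) > 0" using p1 by auto
      moreover have "G \<le> X / Q * inverse P" if "Q * P * G \<le> X" "Q > 0" "P > 0" for P Q G :: real
        using that by (simp add: field_simps)
      ultimately show ?thesis unfolding t_def powr_minus by blast
    qed
    have aew: "AE w in \<nu>. \<bar>(gker a l n (x \<bullet> y + sqrt (1 - w) * z) + gker a l n (x \<bullet> y - sqrt (1 - w) * z)) / 2\<bar>
        \<le> X / (1 + real n ^ 2 * D) ^ m * (1 + S * w) powr (- (\<mu> + 1))"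
      using nu(3)
    proof eventually_elim
      case (elim w)
      have s: "0 \<le> sqrt (1 - w)" "sqrt (1 - w) \<le> 1" "sqrt (1 - w) \<le> 1 - w / 2"
      proof -
        show "sqrt (1 - w) \<le> 1 - w / 2"
          by (rule real_le_lsqrt) (use elim in \<open>auto simp: power2_eq_square algebra_simps\<close>)
      qed (use elim in auto)
      have "\<bar>gker a l n (x \<bullet> y + sqrt (1 - w) * z)\<bar> \<le> X / (1 + real n ^ 2 * D) ^ m * (1 + S * w) powr (- (\<mu> + 1))"
        by (rule pw) (use elim s in auto)
      moreover have "\<bar>gker a l n (x \<bullet> y + (- sqrt (1 - w)) * z)\<bar> \<le> X / (1 + real n ^ 2 * D) ^ m * (1 + S * w) powr (- (\<mu> + 1))"
      proof (rule pw)
        show "w / 2 \<le> 1 - - sqrt (1 - w)" using s(1) elim by linarith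
      qed (use elim s in auto)
      moreover have "\<bar>(p + q) / 2\<bar> \<le> M" if "\<bar>p\<bar> \<le> M" "\<bar>q\<bar> \<le> M" for p q M :: real
        using that by (simp add: abs_le_iff)
      moreover have "x \<bullet> y + (- sqrt (1 - w)) * z = x \<bullet> y - sqrt (1 - w) * z" by simp
      ultimately show ?case by metis
    qed
    have "\<bar>needlet_kernel a \<mu> n x y\<bar>
      \<le> integral\<^sup>L \<nu> (\<lambda>w. \<bar>(gker a l n (x \<bullet> y + sqrt (1 - w) * z) + gker a l n (x \<bullet> y - sqrt (1 - w) * z)) / 2\<bar>)"
      unfolding needlet_kernel_integral[OF assms(1) n x y nu] z[symmetric] by (rule integral_abs_bound)
    also have "\<dots> \<le> integral\<^sup>L \<nu> (\<lambda>w. X / (1 + real n ^ 2 * D) ^ m * (1 + S * w) powr (- (\<mu> + 1)))"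
    proof (rule integral_mono_AE'[OF _ aew])
      have "integrable \<nu> (\<lambda>w. (1 + S * w) powr (- (\<mu> + 1)))"
      proof (rule integrable_const_bound[where B=1])
        show "AE w in \<nu>. norm ((1 + S * w) powr (- (\<mu> + 1))) \<le> 1" using nu(3)
        proof eventually_elim
          case (elim w)
          have "(1 + S * w) powr (- (\<mu> + 1)) \<le> 1 powr (- (\<mu> + 1))"
            using S0 elim mu by (intro powr_mono2') auto
          then show ?case by simp
        qed
      qed (simp add: nu(2) cong: measurable_cong_sets)
      then show "integrable \<nu> (\<lambda>w. X / (1 + real n ^ 2 * D) ^ m * (1 + S * w) powr (- (\<mu> + 1)))"
        by (rule integrable_mult_right)
    qed (intro AE_I2 mult_nonneg_nonneg divide_nonneg_nonneg zero_le_power add_nonneg_nonneg X0 D0, auto)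
    also have "\<dots> = X / (1 + real n ^ 2 * D) ^ m * integral\<^sup>L \<nu> (\<lambda>w. (1 + S * w) powr (- (\<mu> + 1)))" by simp
    also have "\<dots> \<le> X / (1 + real n ^ 2 * D) ^ m * (C2 * (1 + S) powr (- \<mu>))"
      using X0 D0 by (intro mult_left_mono C2 S0) (auto intro!: divide_nonneg_nonneg)
    finally show ?thesis by (simp add: X_def D_def S_def mult_ac)
  qed
  show ?thesis
    by (rule exI[of _ "C1 * C2"]) (use main C1(1) C2(1) in \<open>auto simp: Let_def\<close>)
qed

end

text \<open>\<open>A\<close> and \<open>B\<close> are the last coordinates of the lifts of \<open>x\<close> and \<open>y\<close> to the unit sphere,
  \<open>\<theta>\<close> is the angle between the lifts.\<close>

lemma weight_product_bound:
  fixes A B \<theta> n :: real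
  assumes "A \<ge> 0" "B \<ge> 0" "n \<ge> 0" "\<bar>A - B\<bar> \<le> \<theta>"
  shows "(n * A + 1) * (n * B + 1) \<le> 4 * (1 + n\<^sup>2 * (A * B) / 2) * (1 + n * \<theta>)"
proof -
  \<comment> \<open>By symmetry let \<open>A\<close> be the smaller one. Then
    \<open>n * B + 1\<close> costs at most a factor \<open>1 + n * \<theta>\<close> more than
    \<open>n * A + 1\<close>, and \<open>(n * A + 1)^2\<close> is controlled by
    \<open>A * A \<le> A * B\<close>.\<close>
  have *: "(n * A + 1) * (n * B + 1) \<le> 4 * (1 + n\<^sup>2 * (A * B) / 2) * (1 + n * \<theta>)"
    if A: "A \<ge> 0" "A \<le> B" "B - A \<le> \<theta>" for A B
  proof -
    have th: "\<theta> \<ge> 0" using A by simp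
    have "n * (B - A) \<le> n * \<theta>" using A assms by (intro mult_left_mono) auto
    moreover have "n * \<theta> \<le> (n * A + 1) * (n * \<theta>)" using A th assms by (simp add: distrib_right)
    ultimately have "n * B + 1 \<le> (n * A + 1) * (1 + n * \<theta>)" by (simp add: algebra_simps)
    then have "(n * A + 1) * (n * B + 1) \<le> (n * A + 1) * ((n * A + 1) * (1 + n * \<theta>))"
      using A assms by (intro mult_left_mono) auto
    also have "\<dots> = (n * A + 1)\<^sup>2 * (1 + n * \<theta>)" by (simp add: power2_eq_square mult.assoc)
    also have "\<dots> \<le> (4 * (1 + n\<^sup>2 * (A * B) / 2)) * (1 + n * \<theta>)"
    proof (intro mult_right_mono)
      have "0 \<le> (n * A - 1)\<^sup>2" by simp
      then have "(n * A + 1)\<^sup>2 \<le> 2 * (1 + n\<^sup>2 * (A * A))" by (simp add: power2_eq_square algebra_simps)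
      also have "n\<^sup>2 * (A * A) \<le> n\<^sup>2 * (A * B)" using A by (intro mult_left_mono) auto
      finally show "(n * A + 1)\<^sup>2 \<le> 4 * (1 + n\<^sup>2 * (A * B) / 2)" by (simp add: mult_ac)
    qed (use th assms in auto)
    finally show ?thesis .
  qed
  show ?thesis
  proof (cases "A \<le> B")
    case False
    then show ?thesis using *[of B A] assms by (simp add: mult.commute)
  qed (use *[of A B] assms in auto)
qed

theorem theorem4p2:
  fixes \<mu> :: real and a :: "real \<Rightarrow> real" and k :: real
  assumes "CARD('d::finite) > 1"
    and "\<mu> \<ge> 0"
    and "admissible a"
    and "k > 0"
  shows "\<exists>c>0. \<forall>n\<ge>1. \<forall>x\<in>(unit_ball :: (real ^ 'd) set). \<forall>y\<in>unit_ball.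
           \<bar>needlet_kernel a \<mu> n x y\<bar>
             \<le> c * (real n ^ CARD('d) /
                    (sqrt (ball_weight_n \<mu> n x) * sqrt (ball_weight_n \<mu> n y)
                      * (1 + real n * ball_dist x y) powr k))"
proof -
  define l where "l = \<mu> + (real CARD('d) - 1) / 2"
  interpret ball_setting \<mu> l "TYPE('d)"
    by standard (use assms in \<open>auto simp: l_def\<close>)
  \<comment> \<open>The averaged bound asks for at least \<open>\<mu> + 1\<close>. Below, a decay of
    order \<open>\<mu> + k\<close> in \<open>T\<close> is consumed: \<open>k\<close> for the claim
    and \<open>\<mu>\<close> for the passage from \<open>S\<close> to the weights.\<close>
  define m where "m = nat \<lceil>\<mu> + k + 1\<rceil>"
  have m: "real m \<ge> \<mu> + k + 1" unfolding m_def by (rule real_nat_ceiling_ge)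
  obtain C where C: "C > 0" and bound: "\<And>n x y :: real ^ 'd. n \<ge> 1 \<Longrightarrow> norm x \<le> 1 \<Longrightarrow> norm y \<le> 1 \<Longrightarrow>
      \<bar>needlet_kernel a \<mu> n x y\<bar> \<le> C * real n powr (2 * l + 1)
        * (1 + real n ^ 2 * (sqrt (1 - (norm x)\<^sup>2) * sqrt (1 - (norm y)\<^sup>2)) / 2) powr (- \<mu>)
        / (1 + real n ^ 2 * (1 - (x \<bullet> y + sqrt (1 - (norm x)\<^sup>2) * sqrt (1 - (norm y)\<^sup>2)))) ^ m"
    using localized_average_bound[OF assms(3), of m] m assms(4) unfolding Let_def by fastforce
  \<comment> \<open>\<open>4 powr \<mu>\<close> comes from \<open>W \<le> 4 * S * T\<close> and
    \<open>36 ^ m\<close> from the comparison of \<open>T^2\<close> with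
    \<open>1 + n^2 * D\<close>.\<close>
  define c where "c = C * 4 powr \<mu> * 36 ^ m"
  show ?thesis
  proof (intro exI[of _ c] conjI allI impI ballI)
    show "c > 0" using C by (simp add: c_def)
    fix n :: nat and x y :: "real ^ 'd"
    assume n: "1 \<le> n" and "x \<in> unit_ball" "y \<in> unit_ball"
    then have x: "norm x \<le> 1" and y: "norm y \<le> 1" by auto
    define A where "A = sqrt (1 - (norm x)\<^sup>2)"
    define B where "B = sqrt (1 - (norm y)\<^sup>2)"
    define \<theta> where "\<theta> = ball_dist x y"
    define D where "D = 1 - (x \<bullet> y + A * B)"
    define S where "S = 1 + real n ^ 2 * (A * B) / 2"
    define W where "W = (real n * A + 1) * (real n * B + 1)"
    define T where "T = 1 + real n * \<theta>"
    have AB: "A \<ge> 0" "B \<ge> 0" using x y by (auto simp: A_def B_def power_le_one)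
    have v: "\<bar>x \<bullet> y + A * B\<bar> \<le> 1" using unit_lift_bounds(1)[OF x y, of 1] by (simp add: A_def B_def)
    have th: "0 \<le> \<theta>" "\<theta> \<le> pi" "cos \<theta> = x \<bullet> y + A * B"
      using v arccos_lbound[of "x \<bullet> y + A * B"] arccos_ubound[of "x \<bullet> y + A * B"]
      unfolding \<theta>_def ball_dist_def A_def[symmetric] B_def[symmetric] by (auto simp: cos_arccos_abs)
    have D: "D = 1 - cos \<theta>" by (simp add: D_def th)
    \<comment> \<open>Chain through \<open>2 * D\<close>: the lifts give
      \<open>(A - B)^2 \<le> 2 * D\<close>, and \<open>D = 1 - cos \<theta>\<close> is at most half
      of \<open>\<theta>^2\<close>.\<close>
    have "(A - B)\<^sup>2 \<le> \<theta>\<^sup>2"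
      using unit_lift_bounds(2)[OF x y, of 1, simplified] one_minus_cos_le[of \<theta>] D unfolding A_def[symmetric] B_def[symmetric] D_def by argo
    then have "\<bar>A - B\<bar> \<le> \<theta>" using th(1) abs_le_square_iff[of "A - B" \<theta>] by simp
    from weight_product_bound[OF AB _ this, of "real n"] have W: "W \<le> 4 * S * T"
      unfolding W_def S_def T_def by simp
    have "W > 0" unfolding W_def using AB by (intro mult_pos_pos add_nonneg_pos mult_nonneg_nonneg) auto
    moreover have "S > 0" unfolding S_def using AB by (intro add_pos_nonneg) auto
    moreover have "T \<ge> 1" using th by (simp add: T_def)
    ultimately have pos: "W > 0" "S > 0" "T \<ge> 1" .
    \<comment> \<open>\<open>36 = 2 * 18\<close>: squaring the sum costs 2, and
      \<open>\<theta>^2 \<le> 18 * D\<close>.\<close>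
    have TD: "T\<^sup>2 \<le> 36 * (1 + real n ^ 2 * D)"
    proof -
      have "0 \<le> (real n * \<theta> - 1)\<^sup>2" by simp
      then have "T\<^sup>2 \<le> 2 * (1 + real n ^ 2 * \<theta>\<^sup>2)" by (simp add: T_def power2_eq_square algebra_simps)
      moreover have "real n ^ 2 * \<theta>\<^sup>2 \<le> real n ^ 2 * (18 * D)"
        using one_minus_cos_ge[OF th(1,2)] D by (intro mult_left_mono) auto
      ultimately show ?thesis by simp
    qed
    have "D \<ge> 0" unfolding D by simp
    then have Dpos: "1 + real n ^ 2 * D > 0" by (simp add: add_pos_nonneg)
    have Tm: "T powr (\<mu> + k) \<le> 36 ^ m * (1 + real n ^ 2 * D) ^ m"
    proof -
      have "T powr (\<mu> + k) \<le> T powr (real (2 * m))" using m pos by (intro powr_mono) auto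
      also have "\<dots> = (T\<^sup>2) ^ m" using pos powr_realpow[of T "2 * m"] power_mult[of T 2 m] by linarith
      also have "\<dots> \<le> (36 * (1 + real n ^ 2 * D)) ^ m" using TD by (intro power_mono) auto
      also have "\<dots> = 36 ^ m * (1 + real n ^ 2 * D) ^ m" by (rule power_mult_distrib)
      finally show ?thesis .
    qed
    have sq: "sqrt (ball_weight_n \<mu> n u) = (sqrt (1 - (norm u)\<^sup>2) + 1 / real n) powr \<mu>" for u :: "real ^ 'd"
    proof -
      have "sqrt (b powr (2 * \<mu>)) = b powr \<mu>" for b :: real
      proof -
        have "b powr (2 * \<mu>) = (b powr \<mu>)\<^sup>2" by (simp add: power2_eq_square powr_add[symmetric])
        then show ?thesis by simp
      qed
      then show ?thesis unfolding ball_weight_n_def .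
    qed
    have ww: "sqrt (ball_weight_n \<mu> n x) * sqrt (ball_weight_n \<mu> n y) = W powr \<mu> / real n powr (2 * \<mu>)"
    proof -
      have "A + 1 / real n = (real n * A + 1) / real n" "B + 1 / real n = (real n * B + 1) / real n"
        using n by (auto simp: field_simps)
      then have "sqrt (ball_weight_n \<mu> n x) * sqrt (ball_weight_n \<mu> n y)
        = ((real n * A + 1) powr \<mu> * (real n * B + 1) powr \<mu>) / (real n powr \<mu> * real n powr \<mu>)"
        unfolding sq A_def[symmetric] B_def[symmetric] using AB n by (simp add: powr_divide)
      also have "\<dots> = W powr \<mu> / real n powr (2 * \<mu>)"
        unfolding W_def using AB by (simp add: powr_mult powr_add[symmetric])
      finally show ?thesis .
    qed
    \<comment> \<open>The surplus \<open>n powr (2 * \<mu>)\<close> over \<open>n ^ CARD('d)\<close>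
      is what turns \<open>n * A + 1\<close> and \<open>n * B + 1\<close> back into the
      \<open>A + 1 / n\<close> and \<open>B + 1 / n\<close> of the weights.\<close>
    have npow: "real n powr (2 * l + 1) = real n powr (2 * \<mu>) * real n ^ CARD('d)"
    proof -
      have "2 * (u + (v - 1) / 2) + 1 = 2 * u + v" for u v :: real by (simp add: field_simps)
      then have "2 * l + 1 = 2 * \<mu> + real CARD('d)" unfolding l_def .
      then show ?thesis using n by (simp add: powr_add powr_realpow)
    qed
    have WS: "S powr (- \<mu>) \<le> 4 powr \<mu> * T powr \<mu> / W powr \<mu>"
    proof -
      have "W powr \<mu> \<le> (4 * S * T) powr \<mu>" using W pos assms(2) by (intro powr_mono2) auto
      also have "\<dots> = 4 powr \<mu> * S powr \<mu> * T powr \<mu>" using pos by (simp add: powr_mult)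
      finally show ?thesis using pos by (simp add: powr_minus field_simps)
    qed
    have TDm: "T powr \<mu> / (1 + real n ^ 2 * D) ^ m \<le> 36 ^ m / T powr k"
      using Tm Dpos pos by (simp add: powr_add field_simps)
    have "\<bar>needlet_kernel a \<mu> n x y\<bar> \<le> C * real n powr (2 * l + 1) * S powr (- \<mu>) / (1 + real n ^ 2 * D) ^ m"
      using bound[OF n x y] unfolding A_def[symmetric] B_def[symmetric] D_def[symmetric] S_def[symmetric] .
    also have "\<dots> \<le> C * real n powr (2 * l + 1) * (4 powr \<mu> * T powr \<mu> / W powr \<mu>) / (1 + real n ^ 2 * D) ^ m"
      using C Dpos by (intro divide_right_mono mult_left_mono WS) auto
    also have "\<dots> = C * 4 powr \<mu> * (real n powr (2 * l + 1) / W powr \<mu>) * (T powr \<mu> / (1 + real n ^ 2 * D) ^ m)"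
      by simp
    also have "\<dots> \<le> C * 4 powr \<mu> * (real n powr (2 * l + 1) / W powr \<mu>) * (36 ^ m / T powr k)"
      using C by (intro mult_left_mono TDm) auto
    also have "\<dots> = c * (real n ^ CARD('d) / (W powr \<mu> / real n powr (2 * \<mu>) * T powr k))"
      unfolding npow c_def by simp
    finally show "\<bar>needlet_kernel a \<mu> n x y\<bar>
             \<le> c * (real n ^ CARD('d) /
                    (sqrt (ball_weight_n \<mu> n x) * sqrt (ball_weight_n \<mu> n y)
                      * (1 + real n * ball_dist x y) powr k))"
      unfolding ww T_def \<theta>_def .
  qed
qed

end
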